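(* Let $\mathcal T$ be a triangulation of the punctured disc $S_\odot$. Then its matching numbers $m_{ij}$ ($i,j$ boundary vertices, $j\neq i+1$, $j=i$ allowed) and $m_{i0}$ form a frieze pattern of type $D_N$: they are positive integers and, with $m_{i,i+1}=1$ and indices modulo $N$, for all boundary vertices $i,j$: (R1) $m_{ij}\, m_{i+1,j+1}=m_{i+1,j}\, m_{i,j+1}+1$ whenever $j\notin\{i-1,i,i+1\}$; (R2) $m_{i,i-1}\, m_{i+1,i}=m_{i+1,i-1}\, m_{ii}\, m_{i0}+1$; (R3) $m_{ii}\, m_{i+1,0}=m_{i+1,i}+1$; (R4) $m_{i0}\, m_{i+1,i+1}=m_{i+1,i}+1$.
   Context: Let $N\ge 3$ and let $S_\odot$ be a closed disc with $N$ marked points on its boundary, labelled $1,\dots,N$ in clockwise order (labels are taken modulo $N$), and one marked point $0$ (the puncture) in its interior. For boundary vertices $k,l$ let $B_{kl}$ be the boundary path going clockwise from $k$ to $l$ ($B_{kk}$ is the whole boundary starting and ending at $k$), and let $V_{kl}$ be the set of marked points on $B_{kl}$, i.e. $\{k,k+1,\dots,l\}$ modulo $N$. Arcs are taken up to isotopy relative to the marked points; they do not self-intersect, their interiors avoid the boundary and the marked points, and they do not cut out an unpunctured monogon or digon. They are: for boundary vertices $i,j$ with $j\ne i+1$ (possibly $j=i$), the arc $D_{ij}$ from $i$ to $j$ which together with $B_{ij}$ bounds a disc not containing the puncture (for $i=j$, $D_{ii}$ is the loop based at $i$ enclosing the puncture; for $i\neq j$, $D_{ij}\ne D_{ji}$);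 and, for each boundary vertex $i$, the central arc $D_{i0}$ from $i$ to the puncture. A triangulation $\mathcal T$ is a maximal collection of pairwise non-crossing arcs; it cuts $S_\odot$ into $N$ triangles, one of which may be self-folded (sides $D_{i0}$ and $D_{ii}$; exactly when $D_{i0}$ is the only central arc of $\mathcal T$). A triangle (or a piece of a triangle) is incident with a marked point if that point is one of its corners (and lies on the closure of the piece). For a set $I$ of marked points and a finite set $R$ of such regions, a matching between $I$ and $R$ is an injective map $I\to R$ sending each $p\in I$ to a region incident with $p$; $\mathcal M(I,R)$ denotes the set of these. Truncation: for boundary vertices $i\ne j$, $j\ne i+1$, let $S_{ij}$ be the unpunctured disc bounded by $D_{ij}$ and $B_{ij}$ (marked points $V_{ij}$), and let $\mathcal T|_{S_{ij}}$ be the set of connected components of the intersections of the triangles of $\mathcal T$ with $S_{ij}$ (a triangle crossed by $D_{ij}$ may give two separate pieces, each its own region), a piece being incident with those corners of its triangle in $V_{ij}$ lying on its closure. The disc $P(i)$: if $\mathcal T$ has at least two central arcs, let $k$ be the first boundary vertex reached going anticlockwise from $i$, starting with $i$ itself, with $D_{k0}\in\mathcal T$, and $j$ the first boundary vertex strictly clockwise from $i$ with $D_{j0}\in\mathcal T$; $P(i)$ is the unpunctured disc bounded by $B_{kj}$, $D_{j0}$, $D_{k0}$, with marked points $V_{kj}\cup\{0\}$, triangulated by the triangles of $\mathcal T$ inside it. If $\mathcal T$ has exactly one central arc $D_{k0}$ ($k$ possibly equal to $i$), $P(i)$ is the unpunctured disc obtained by cutting $S_\odot$ open along $D_{k0}$,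 with marked points in clockwise order $k',k+1,\dots,k-1,k,0$ ($k',k$ the two copies of $k$), triangulated by the triangles of $\mathcal T$ (the self-folded triangle becoming a triangle with corners $k,0,k'$). Matching numbers: $m_{i,i+1}=1$; for $i\neq j$, $j\ne i+1$: $m_{ij}=|\mathcal M(V_{i+1,j-1},\mathcal T|_{S_{ij}})|$; $m_{ii}=|\mathcal M((\{1,\dots,N\}\setminus\{i\})\cup\{0\},\ \text{triangles of }\mathcal T)|$ (each triangle of $\mathcal T$ one region); $m_{i0}=|\mathcal M(V(P(i))\setminus\{i,0\},\ \text{triangles of }P(i))|$, $V(P(i))$ the marked points of $P(i)$. A frieze pattern of type $D_N$ is an assignment of positive integers $m_{ij}$ (to the arcs $D_{ij}$) and $m_{i0}$ (to the arcs $D_{i0}$) satisfying (R1)–(R4) with the convention $m_{i,i+1}=1$ (the paper displays these numbers in a certain array, which is immaterial here).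
   Formalization: In m_ii a matching that sends a vertex to a triangle with two corners at that vertex is counted once per corner; this matters only when T has exactly one central arc, where the literal count violates (R3)/(R4) (e.g. N=3, T={D_33,D_32,D_30}: m_30 m_11=2 but m_13+1=3). *)

theory Defs
  imports "HOL-Analysis.Analysis" "HOL-Number_Theory.Cong"
begin

text \<open>
  The punctured disc is the closed unit disc of the complex plane with puncture \<open>0\<close> and the
  \<open>N\<close>-th roots of unity as boundary marked points.  Its interior without the puncture is the
  quotient of the upper half plane by \<open>z \<mapsto> z + N\<close>; the integers lie over the boundary marked
  points, increasing integers run clockwise, and infinity lies over the puncture.  Boundary vertices
  are therefore indexed by integers, and everything below depends on them modulo \<open>N\<close> only.

  Every isotopy class of arcs is represented by its hyperbolic geodesic.  Geodesics are pairwise in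
  minimal position, so two classes are non-crossing exactly when the geodesics are disjoint, and the
  pieces cut out of a triangle by another arc can be read off as connected components.  Arcs are
  taken without their endpoints; regions are open sets, and a marked point is a corner of a region
  when it lies on the closure.
\<close>

definition upper :: "complex set" where
  "upper = {z. Im z > 0}"

definition cover :: "nat \<Rightarrow> complex \<Rightarrow> complex" where
  "cover N z = rcis (exp (- 2 * pi * Im z / real N)) (- 2 * pi * Re z / real N)"

definition vertex :: "nat \<Rightarrow> int \<Rightarrow> complex" where
  "vertex N i = cover N (of_int i)"

text \<open>The representative of \<open>j\<close> modulo \<open>N\<close> in \<open>{i + 1..i + N}\<close>, so that the boundary path clockwise
  from \<open>i\<close> to \<open>j\<close> (the whole boundary for \<open>j = i\<close>) lifts to the interval from \<open>i\<close> to \<open>cw N i j\<close>.\<close>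

definition cw :: "nat \<Rightarrow> int \<Rightarrow> int \<Rightarrow> int" where
  "cw N i j = i + 1 + (j - i - 1) mod int N"

definition geodesic :: "int \<Rightarrow> int \<Rightarrow> complex set" where
  "geodesic a b = {z \<in> upper. dist z (of_real ((of_int a + of_int b) / 2)) = (of_int b - of_int a) / 2}"

definition below_geodesic :: "int \<Rightarrow> int \<Rightarrow> complex set" where
  "below_geodesic a b = {z \<in> upper. dist z (of_real ((of_int a + of_int b) / 2)) < (of_int b - of_int a) / 2}"

definition peripheral_arc :: "nat \<Rightarrow> int \<Rightarrow> int \<Rightarrow> complex set" where
  "peripheral_arc N i j = cover N ` geodesic i (cw N i j)"

definition central_arc :: "nat \<Rightarrow> int \<Rightarrow> complex set" where
  "central_arc N i = open_segment (vertex N i) 0"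

definition arcs :: "nat \<Rightarrow> complex set set" where
  "arcs N = {peripheral_arc N i j |i j. \<not> [j = i + 1] (mod int N)} \<union> range (central_arc N)"

definition noncrossing :: "nat \<Rightarrow> complex set set \<Rightarrow> bool" where
  "noncrossing N T \<longleftrightarrow> T \<subseteq> arcs N \<and> pairwise disjnt T"

definition disc_triangulation :: "nat \<Rightarrow> complex set set \<Rightarrow> bool" where
  "disc_triangulation N T \<longleftrightarrow> noncrossing N T \<and> (\<forall>T'. noncrossing N T' \<and> T \<subseteq> T' \<longrightarrow> T' = T)"

definition triangles :: "nat \<Rightarrow> complex set set \<Rightarrow> complex set set" where
  "triangles N T = components (ball 0 1 - {0} - \<Union>T)"

definition matchings ::
    "('p \<Rightarrow> complex set \<Rightarrow> bool) \<Rightarrow> 'p set \<Rightarrow> complex set set \<Rightarrow> ('p \<Rightarrow> complex set) set" where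
  "matchings inc I R = {f \<in> I \<rightarrow>\<^sub>E R. inj_on f I \<and> (\<forall>p\<in>I. inc p (f p))}"

definition incident :: "complex \<Rightarrow> complex set \<Rightarrow> bool" where
  "incident p r \<longleftrightarrow> p \<in> closure r"

definition truncated_disc :: "nat \<Rightarrow> int \<Rightarrow> int \<Rightarrow> complex set" where
  "truncated_disc N i j = cover N ` below_geodesic i (cw N i j)"

definition truncation :: "nat \<Rightarrow> complex set set \<Rightarrow> int \<Rightarrow> int \<Rightarrow> complex set set" where
  "truncation N T i j = (\<Union>t\<in>triangles N T. components (t \<inter> truncated_disc N i j))"

text \<open>The number of corners of a triangle at the boundary vertex \<open>c\<close>: the lifts of the triangle with
  a corner at the integer \<open>c\<close> correspond to its corners at that vertex.  This number is at most 1,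
  unless the triangulation contains a loop based at \<open>c\<close>; then the two triangles having that loop
  as a side both have two corners at \<open>c\<close>.\<close>

definition corners_at :: "nat \<Rightarrow> complex set \<Rightarrow> int \<Rightarrow> nat" where
  "corners_at N t c = card {C \<in> components (upper \<inter> cover N -` t). of_int c \<in> closure C}"

text \<open>In the number for the loop at \<open>i\<close>, a matching that sends \<open>c\<close> to a triangle with two corners at
  \<open>c\<close> counts once for each of these corners.  Counting it only once would make the frieze relations
  fail for triangulations with a self-folded triangle.\<close>

definition matching_number :: "nat \<Rightarrow> complex set set \<Rightarrow> int \<Rightarrow> int \<Rightarrow> nat" where
  "matching_number N T i j =
    (if [j = i + 1] (mod int N) then 1
     else if [j = i] (mod int N) then
       (\<Sum>f\<in>matchings incident (insert 0 (range (vertex N) - {vertex N i})) (triangles N T).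
          \<Prod>c\<in>{i<..<i + int N}. corners_at N (f (vertex N c)) c)
     else card (matchings incident (vertex N ` {i<..<cw N i j}) (truncation N T i j)))"

definition spoke_before :: "nat \<Rightarrow> complex set set \<Rightarrow> int \<Rightarrow> int" where
  "spoke_before N T i = i - int (LEAST d. central_arc N (i - int d) \<in> T)"

definition spoke_after :: "nat \<Rightarrow> complex set set \<Rightarrow> int \<Rightarrow> int" where
  "spoke_after N T i = i + int (LEAST d. 0 < d \<and> central_arc N (i + int d) \<in> T)"

text \<open>The lift of the disc \<open>P(i)\<close>.  With \<open>k = spoke_before N T i\<close> and \<open>l = spoke_after N T i\<close>, its
  marked points are the integers \<open>k..l\<close> and infinity.  If there is only one central arc, then
  \<open>l = k + N\<close> and the strip is the disc cut open along that arc, with \<open>k\<close> and \<open>l\<close> the two copies of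
  its endpoint.\<close>

definition strip :: "nat \<Rightarrow> complex set set \<Rightarrow> int \<Rightarrow> complex set" where
  "strip N T i = {z \<in> upper. of_int (spoke_before N T i) < Re z \<and> Re z < of_int (spoke_after N T i)}"

definition strip_incident :: "nat \<Rightarrow> complex set set \<Rightarrow> int \<Rightarrow> int \<Rightarrow> complex set \<Rightarrow> bool" where
  "strip_incident N T i c t \<longleftrightarrow> of_int c \<in> closure (strip N T i \<inter> cover N -` t)"

text \<open>The position of \<open>i\<close> among the marked points of \<open>P(i)\<close>.  If the arc from \<open>i\<close> is the only central
  one, both ends of the strip lie over \<open>i\<close>, and \<open>i\<close> denotes the last one in clockwise order.\<close>

definition strip_position :: "nat \<Rightarrow> complex set set \<Rightarrow> int \<Rightarrow> int" where
  "strip_position N T i = (if spoke_after N T i = i + int N then i + int N else i)"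

definition central_matching_number :: "nat \<Rightarrow> complex set set \<Rightarrow> int \<Rightarrow> nat" where
  "central_matching_number N T i =
    card (matchings (strip_incident N T i)
      ({spoke_before N T i..spoke_after N T i} - {strip_position N T i})
      {t \<in> triangles N T. t \<subseteq> cover N ` strip N T i})"

definition frieze_pattern_D :: "nat \<Rightarrow> (int \<Rightarrow> int \<Rightarrow> nat) \<Rightarrow> (int \<Rightarrow> nat) \<Rightarrow> bool" where
  "frieze_pattern_D N m m0 \<longleftrightarrow>
    (\<forall>i i' j j'. [i = i'] (mod int N) \<longrightarrow> [j = j'] (mod int N) \<longrightarrow> m i j = m i' j') \<and>
    (\<forall>i i'. [i = i'] (mod int N) \<longrightarrow> m0 i = m0 i') \<and>
    (\<forall>i j. m i j > 0) \<and>
    (\<forall>i. m0 i > 0) \<and>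
    (\<forall>i. m i (i + 1) = 1) \<and>
    (\<forall>i j. \<not> [j = i - 1] (mod int N) \<and> \<not> [j = i] (mod int N) \<and> \<not> [j = i + 1] (mod int N) \<longrightarrow>
       m i j * m (i + 1) (j + 1) = m (i + 1) j * m i (j + 1) + 1) \<and>
    (\<forall>i. m i (i - 1) * m (i + 1) i = m (i + 1) (i - 1) * m i i * m0 i + 1) \<and>
    (\<forall>i. m i i * m0 (i + 1) = m (i + 1) i + 1) \<and>
    (\<forall>i. m0 i * m (i + 1) (i + 1) = m (i + 1) i + 1)"

end

theory Submission
  imports Defs
begin

text \<open>
  Lift the triangulation to a periodic triangulation of the upper half plane by geodesics between
  integers and vertical lines.  A piece of a lifted triangle below the geodesic from \<open>i\<close> to \<open>j\<close> is
  hyperbolically convex, hence connected, so \<open>m\<^sub>i\<^sub>j\<close> is simply the number \<open>F i j\<close> of injective assignments of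
  lifted triangles to the integers strictly between \<open>i\<close> and \<open>j\<close>; the truncation leaves no trace.

  Splitting at the third corner of the triangle below an edge, where the vertices strictly below an edge
  have to use up all the triangles below it, gives the Ptolemy relations for these numbers.  They imply
  \<open>F i j = X i * u j - X j * u i\<close> for suitable vectors \<open>(X i, u i)\<close>, with \<open>X i = m\<^sub>i\<^sub>0\<close>, and translation by
  \<open>N\<close> is the shear \<open>(X, u) \<mapsto> (X, u + s * X)\<close> with \<open>s\<close> the number of central arcs.  Similarly \<open>m\<^sub>i\<^sub>i = s * X i\<close>,
  as each of the \<open>s\<close> triangles at the puncture can be matched with the puncture in \<open>X i\<close> ways.
  All relations are then identities between two by two determinants, and positivity follows from them,
  since every entry is a factor of a number of the form \<open>n + 1\<close>.
\<close>

section \<open>Weighted matchings\<close>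

text \<open>Nearly every count rests on one principle, \<open>wmatch_split\<close>: a block of
  vertices that has exactly as many triangles at its disposal as it has members uses all of them,
  and the rest of the problem decouples. There are \<open>b - a - 1\<close> triangles below an edge
  from \<open>a\<close> to \<open>b\<close>, and \<open>B - A\<close> triangles between two spokes
  \<open>A\<close> and \<open>B\<close>, so such blocks are always at hand. Counts carry weights
  (\<open>wmatch\<close> is the permanent of a rectangular matrix) because the two triangles along a
  loop meet its base vertex with two corners; this weight 2 in \<open>m_ii\<close> is resolved by
  linearity in one row. The Ptolemy relation only lives below a single edge, and no edge passes over
  a spoke. Beyond the first spoke it is replaced by the fact that \<open>F i B\<close> grows by
  \<open>X i\<close> from each spoke \<open>B\<close> to the next. This arithmetic progression is
  the origin of the term \<open>rank i * X i\<close> in the second coordinate \<open>u\<close>, and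
  of the shear. Sides between neighbouring boundary points count as edges although no arc lies over
  them; the open regions extend down to the real line there.\<close>

definition wmatch :: "('p \<Rightarrow> 't \<Rightarrow> nat) \<Rightarrow> 'p set \<Rightarrow> 't set \<Rightarrow> nat" where
  "wmatch w I D = (\<Sum>f\<in>{f \<in> I \<rightarrow>\<^sub>E D. inj_on f I}. \<Prod>p\<in>I. w p (f p))"

lemma wmatch_empty [simp]: "wmatch w {} D = 1"
proof -
  have "{f \<in> {} \<rightarrow>\<^sub>E D. inj_on f {}} = {\<lambda>x. undefined}" by auto
  then show ?thesis by (simp add: wmatch_def)
qed

text \<open>Laplace expansion of the permanent along the row \<open>c\<close>. The functions are
  extensional, so resetting the value at \<open>c\<close> to \<open>undefined\<close> inverts
  \<open>g(c := t)\<close>.\<close>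

lemma wmatch_insert:
  assumes "finite I" "finite D" "c \<notin> I"
  shows "wmatch w (insert c I) D = (\<Sum>t\<in>D. w c t * wmatch w I (D - {t}))"
proof -
  let ?A = "SIGMA t:D. {g \<in> I \<rightarrow>\<^sub>E (D - {t}). inj_on g I}"
  let ?h = "\<lambda>(t, g). g(c := t)"
  have inj: "inj_on ?h ?A"
  proof (rule inj_onI, clarify)
    fix t g t' g'
    assume *: "g \<in> I \<rightarrow>\<^sub>E (D - {t})" "g' \<in> I \<rightarrow>\<^sub>E (D - {t'})" "g(c := t) = g'(c := t')"
    have "t = t'" using *(3) by (metis fun_upd_same)
    moreover have "g = g'"
    proof
      fix x
      have "g x = undefined" "g' x = undefined" if "x = c"
        using * assms(3) that by (auto simp: PiE_def extensional_def)
      then show "g x = g' x"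
        using fun_cong[OF *(3), of x] by (cases "x = c") auto
    qed
    ultimately show "t = t' \<and> g = g'" by simp
  qed
  have img: "{f \<in> insert c I \<rightarrow>\<^sub>E D. inj_on f (insert c I)} = ?h ` ?A"
  proof (intro equalityI subsetI)
    fix f assume f: "f \<in> {f \<in> insert c I \<rightarrow>\<^sub>E D. inj_on f (insert c I)}"
    let ?g = "f(c := undefined)"
    have "(f c, ?g) \<in> ?A"
      using f assms(3) by (auto simp: PiE_def extensional_def inj_on_def Pi_def)
    moreover have "f = ?h (f c, ?g)" by simp
    ultimately show "f \<in> ?h ` ?A" by blast
  next
    fix f assume "f \<in> ?h ` ?A"
    then obtain t g where "t \<in> D" "g \<in> I \<rightarrow>\<^sub>E (D - {t})" "inj_on g I" "f = g(c := t)" by auto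
    then show "f \<in> {f \<in> insert c I \<rightarrow>\<^sub>E D. inj_on f (insert c I)}"
      using assms(3) by (auto simp: PiE_def extensional_def inj_on_def Pi_def)
  qed
  have prod: "(\<Prod>p\<in>insert c I. w p ((g(c := t)) p)) = w c t * (\<Prod>p\<in>I. w p (g p))" for g t
    using assms by (auto intro!: prod.cong)
  have fin: "finite {g \<in> I \<rightarrow>\<^sub>E (D - {t}). inj_on g I}" for t
    using assms by (simp add: finite_PiE)
  have "wmatch w (insert c I) D = (\<Sum>(t, g)\<in>?A. \<Prod>p\<in>insert c I. w p ((g(c := t)) p))"
    unfolding wmatch_def img by (subst sum.reindex[OF inj]) (simp add: case_prod_unfold)
  also have "\<dots> = (\<Sum>t\<in>D. \<Sum>g\<in>{g \<in> I \<rightarrow>\<^sub>E (D - {t}). inj_on g I}. \<Prod>p\<in>insert c I. w p ((g(c := t)) p))"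
    using assms fin by (subst sum.Sigma) auto
  finally show ?thesis unfolding prod wmatch_def by (simp add: sum_distrib_left)
qed

text \<open>If \<open>I1\<close> has as many members as \<open>D1\<close>, an injection of
  \<open>I1\<close> into \<open>D1\<close> is onto and leaves nothing of \<open>D1\<close> for
  \<open>I2\<close>; otherwise \<open>I2\<close> has weight zero on \<open>D1\<close>. Either way
  the sum factors. Deleting a row \<open>c\<close> of \<open>I1\<close> and its column
  \<open>t\<close> preserves both alternatives, which drives the induction.\<close>

lemma wmatch_split:
  assumes "finite I1" "finite I2" "finite D" "I1 \<inter> I2 = {}" "D1 \<subseteq> D"
    and "\<And>p t. p \<in> I1 \<Longrightarrow> t \<in> D - D1 \<Longrightarrow> w p t = 0"
    and "card I1 = card D1 \<or> (\<forall>p\<in>I2. \<forall>t\<in>D1. w p t = 0)"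
  shows "wmatch w (I1 \<union> I2) D = wmatch w I1 D1 * wmatch w I2 (D - D1)"
  using assms
proof (induction I1 arbitrary: D D1 rule: finite_induct)
  case empty
  show ?case
  proof (cases "D1 = {}")
    case False
    have finD1: "finite D1" using empty by (meson finite_subset)
    then have z: "\<And>p t. p \<in> I2 \<Longrightarrow> t \<in> D1 \<Longrightarrow> w p t = 0" using empty False by auto
    \<comment> \<open>With \<open>I1\<close> empty and \<open>D1\<close> not, the cardinality
      alternative is impossible, so the columns of \<open>D1\<close> vanish on \<open>I2\<close>;
      they are discarded row by row.\<close>
    have "wmatch w J E = wmatch w J (E - D1)" if "finite J" "J \<subseteq> I2" "finite E" for J E
      using that
    proof (induction J arbitrary: E rule: finite_induct)
      case (insert c J)
      have "wmatch w (insert c J) E = (\<Sum>t\<in>E. w c t * wmatch w J (E - {t}))"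
        using insert.hyps insert.prems by (simp add: wmatch_insert)
      also have "\<dots> = (\<Sum>t\<in>E - D1. w c t * wmatch w J (E - {t}))"
        using insert.hyps insert.prems z by (intro sum.mono_neutral_right) auto
      also have "\<dots> = (\<Sum>t\<in>E - D1. w c t * wmatch w J (E - D1 - {t}))"
      proof (rule sum.cong[OF refl])
        fix t assume "t \<in> E - D1"
        have "E - {t} - D1 = E - D1 - {t}" by auto
        then show "w c t * wmatch w J (E - {t}) = w c t * wmatch w J (E - D1 - {t})"
          using insert.IH[of "E - {t}"] insert.prems by simp
      qed
      finally show ?case using insert.hyps insert.prems by (simp add: wmatch_insert)
    qed simp
    from this[OF empty(1) subset_refl empty(2)] show ?thesis by simp
  qed simp
next
  case (insert c I1)
  have finD1: "finite D1" by (rule finite_subset[OF insert.prems(4) insert.prems(2)])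
  have c: "c \<notin> I1 \<union> I2" using insert.hyps insert.prems(3) by auto
  have "wmatch w (insert c I1 \<union> I2) D = (\<Sum>t\<in>D. w c t * wmatch w (I1 \<union> I2) (D - {t}))"
    using insert.hyps insert.prems(1,2) c by (simp add: wmatch_insert)
  also have "\<dots> = (\<Sum>t\<in>D1. w c t * wmatch w (I1 \<union> I2) (D - {t}))"
    using insert.prems(2,4,5) by (intro sum.mono_neutral_right) auto
  also have "\<dots> = (\<Sum>t\<in>D1. w c t * (wmatch w I1 (D1 - {t}) * wmatch w I2 (D - D1)))"
  proof (rule sum.cong[OF refl])
    fix t assume t: "t \<in> D1"
    have "D - {t} - (D1 - {t}) = D - D1" using t by auto
    moreover have "card I1 = card (D1 - {t}) \<or> (\<forall>p\<in>I2. \<forall>t\<in>D1 - {t}. w p t = 0)"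
      using insert.prems(6) t finD1 insert.hyps by auto
    ultimately show "w c t * wmatch w (I1 \<union> I2) (D - {t})
        = w c t * (wmatch w I1 (D1 - {t}) * wmatch w I2 (D - D1))"
      using insert.IH[of "D - {t}" "D1 - {t}"] insert.prems t by auto
  qed
  also have "\<dots> = wmatch w (insert c I1) D1 * wmatch w I2 (D - D1)"
    using insert.hyps finD1 by (simp add: wmatch_insert sum_distrib_right mult.assoc)
  finally show ?case .
qed

lemma wmatch_drop:
  assumes "finite I" "finite D" "D1 \<subseteq> D" "\<And>p t. p \<in> I \<Longrightarrow> t \<in> D - D1 \<Longrightarrow> w p t = 0"
  shows "wmatch w I D = wmatch w I D1"
  using wmatch_split[of I "{}" D D1 w] assms by simp

lemma wmatch_zero:
  assumes "finite D" "card D < card I"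
  shows "wmatch w I D = 0"
proof -
  have "{f \<in> I \<rightarrow>\<^sub>E D. inj_on f I} = {}"
    using assms by (auto simp: PiE_def dest: card_inj_on_le[where B = D])
  then show ?thesis by (simp only: wmatch_def sum.empty)
qed

lemma wmatch_cong:
  assumes "I = I'" "D = D'" "\<And>p t. p \<in> I \<Longrightarrow> t \<in> D \<Longrightarrow> w p t = w' p t"
  shows "wmatch w I D = wmatch w' I' D'"
  using assms unfolding wmatch_def by (auto simp: PiE_def Pi_def intro!: sum.cong prod.cong)

text \<open>Outside the row \<open>c\<close> the column \<open>t\<close> is zero, so either
  \<open>c\<close> takes \<open>t\<close> or nobody does.\<close>

lemma wmatch_insert_column:
  assumes "finite I" "finite D" "c \<notin> I" "t \<notin> D" "\<And>p. p \<in> I \<Longrightarrow> w p t = 0"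
  shows "wmatch w (insert c I) (insert t D) = w c t * wmatch w I D + wmatch w (insert c I) D"
proof -
  have "wmatch w I (insert t D - {s}) = wmatch w I (D - {s})" if "s \<in> D" for s
    using assms that by (intro wmatch_drop) auto
  then show ?thesis using assms by (simp add: wmatch_insert)
qed

text \<open>A vertex \<open>c\<close> between two independent sides: the three summands are the
  cases that \<open>c\<close> takes a triangle of \<open>D1\<close>, the triangle \<open>t\<close>,
  or a triangle of \<open>D2\<close>.\<close>

lemma wmatch_separated:
  assumes fin: "finite I1" "finite I2" "finite D1" "finite D2"
    and c: "c \<notin> I1" "c \<notin> I2" "I1 \<inter> I2 = {}"
    and t: "t \<notin> D1" "t \<notin> D2" "D1 \<inter> D2 = {}"
    and z1: "\<And>p s. p \<in> I1 \<Longrightarrow> s \<in> insert t D2 \<Longrightarrow> w p s = 0"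
    and z2: "\<And>p s. p \<in> I2 \<Longrightarrow> s \<in> insert t D1 \<Longrightarrow> w p s = 0"
  shows "wmatch w (insert c (I1 \<union> I2)) (insert t (D1 \<union> D2)) =
    wmatch w (insert c I1) D1 * wmatch w I2 D2 + w c t * wmatch w I1 D1 * wmatch w I2 D2
      + wmatch w I1 D1 * wmatch w (insert c I2) D2"
proof -
  have prod: "wmatch w (I1 \<union> I2) D = wmatch w I1 (D \<inter> D1) * wmatch w I2 (D \<inter> D2)"
    if "D \<subseteq> insert t (D1 \<union> D2)" for D
  proof -
    have finD: "finite D" using that fin by (meson finite_insert finite_UnI finite_subset)
    have "wmatch w (I1 \<union> I2) D = wmatch w I1 (D \<inter> D1) * wmatch w I2 (D - D \<inter> D1)"
      using fin c t z1 z2 that finD by (intro wmatch_split) auto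
    moreover have "wmatch w I2 (D - D \<inter> D1) = wmatch w I2 (D \<inter> D2)"
      using fin c t z2 that finD by (intro wmatch_drop) auto
    ultimately show ?thesis by simp
  qed
  let ?D = "insert t (D1 \<union> D2)"
  have s1: "wmatch w (I1 \<union> I2) (?D - {s}) = wmatch w I1 (D1 - {s}) * wmatch w I2 D2" if "s \<in> D1" for s
  proof -
    have "(?D - {s}) \<inter> D1 = D1 - {s}" "(?D - {s}) \<inter> D2 = D2" using that t by auto
    then show ?thesis using prod[of "?D - {s}"] by auto
  qed
  have s2: "wmatch w (I1 \<union> I2) (?D - {s}) = wmatch w I1 D1 * wmatch w I2 (D2 - {s})" if "s \<in> D2" for s
  proof -
    have "(?D - {s}) \<inter> D1 = D1" "(?D - {s}) \<inter> D2 = D2 - {s}" using that t by auto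
    then show ?thesis using prod[of "?D - {s}"] by auto
  qed
  have s3: "wmatch w (I1 \<union> I2) (?D - {t}) = wmatch w I1 D1 * wmatch w I2 D2"
  proof -
    have "(?D - {t}) \<inter> D1 = D1" "(?D - {t}) \<inter> D2 = D2" using t by auto
    then show ?thesis using prod[of "?D - {t}"] by auto
  qed
  have "wmatch w (insert c (I1 \<union> I2)) ?D = (\<Sum>s\<in>?D. w c s * wmatch w (I1 \<union> I2) (?D - {s}))"
    using fin c by (simp add: wmatch_insert)
  also have "\<dots> = w c t * wmatch w (I1 \<union> I2) (?D - {t})
      + (\<Sum>s\<in>D1. w c s * wmatch w (I1 \<union> I2) (?D - {s}))
      + (\<Sum>s\<in>D2. w c s * wmatch w (I1 \<union> I2) (?D - {s}))"
    using fin t by (simp add: sum.union_disjoint)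
  also have "\<dots> = w c t * (wmatch w I1 D1 * wmatch w I2 D2)
      + (\<Sum>s\<in>D1. w c s * wmatch w I1 (D1 - {s})) * wmatch w I2 D2
      + wmatch w I1 D1 * (\<Sum>s\<in>D2. w c s * wmatch w I2 (D2 - {s}))"
    unfolding s3 using s1 s2
    by (simp add: sum_distrib_left sum_distrib_right mult.assoc mult.left_commute)
  finally show ?thesis using fin c by (simp add: wmatch_insert algebra_simps)
qed

text \<open>Linearity of the permanent in one row. It resolves a vertex that collects the corners of
  two lifts into one lift at a time.\<close>

lemma wmatch_row_sum:
  assumes "finite I" "finite D" "c \<notin> I" "c1 \<notin> I" "c2 \<notin> I"
    and "\<And>t. t \<in> D \<Longrightarrow> w c t = w' c1 t + w' c2 t"
    and "\<And>p t. p \<in> I \<Longrightarrow> w p t = w' p t"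
  shows "wmatch w (insert c I) D = wmatch w' (insert c1 I) D + wmatch w' (insert c2 I) D"
proof -
  have "wmatch w I E = wmatch w' I E" for E using assms(7) by (intro wmatch_cong) auto
  then show ?thesis using assms(1-6) by (simp add: wmatch_insert sum.distrib algebra_simps)
qed

lemma wmatch_image:
  assumes "finite I" "finite D" "inj_on h I" "inj_on g D"
    and "\<And>p t. p \<in> I \<Longrightarrow> t \<in> D \<Longrightarrow> w' (h p) (g t) = w p t"
  shows "wmatch w' (h ` I) (g ` D) = wmatch w I D"
  using assms
proof (induction I arbitrary: D rule: finite_induct)
  case (insert c I)
  have "wmatch w' (h ` I) (g ` D - {g t}) = wmatch w I (D - {t})" if "t \<in> D" for t
  proof -
    have "g ` D - {g t} = g ` (D - {t})" using insert.prems(3) that by (auto simp: inj_on_def)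
    then show ?thesis using insert.IH[of "D - {t}"] insert.prems by (auto simp: inj_on_diff)
  qed
  moreover have "h c \<notin> h ` I" using insert by auto
  ultimately show ?case using insert
    by (simp add: wmatch_insert sum.reindex)
qed simp

section \<open>Matchings in periodic triangulations of the half plane\<close>

text \<open>\<open>Tri a c b\<close> is used with \<open>a < c < b\<close>. \<open>Cen k l\<close>
  has its third corner at infinity, over the puncture, and \<open>corners\<close> lists the integer
  corners only; for a self-folded triangle \<open>l\<close> is the translate of \<open>k\<close> by
  one period.\<close>

datatype tri = Tri int int int | Cen int int

fun corners :: "tri \<Rightarrow> int set" where
  "corners (Tri a c b) = {a, c, b}"
| "corners (Cen k l) = {k, l}"

fun shift :: "int \<Rightarrow> tri \<Rightarrow> tri" where
  "shift m (Tri a c b) = Tri (a + m) (c + m) (b + m)"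
| "shift m (Cen k l) = Cen (k + m) (l + m)"

definition wt :: "int \<Rightarrow> tri \<Rightarrow> nat" where
  "wt p t = of_bool (p \<in> corners t)"

text \<open>\<open>E\<close> holds the boundary sides as well as the lifted peripheral arcs,
  \<open>K\<close> the feet of the lifted central arcs. \<open>edge_apex\<close> and
  \<open>spoke_edge\<close> are the traces of maximality; the other conditions are orientation,
  non-crossing, periodicity and the existence of a central arc.\<close>

locale lifted_triangulation =
  fixes N :: int and E :: "int \<Rightarrow> int \<Rightarrow> bool" and K :: "int set"
  assumes N_pos: "N > 0"
    and edge_less: "E a b \<Longrightarrow> a < b"
    and edge_succ: "E a (a + 1)"
    and edge_cross: "E a b \<Longrightarrow> E c d \<Longrightarrow> a < c \<Longrightarrow> c < b \<Longrightarrow> b < d \<Longrightarrow> False"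
    and edge_spoke: "E a b \<Longrightarrow> k \<in> K \<Longrightarrow> a < k \<Longrightarrow> k < b \<Longrightarrow> False"
    and edge_apex: "E a b \<Longrightarrow> a + 2 \<le> b \<Longrightarrow> \<exists>c. a < c \<and> c < b \<and> E a c \<and> E c b"
    and edge_period: "E (a + N) (b + N) \<longleftrightarrow> E a b"
    and spoke_period: "k + N \<in> K \<longleftrightarrow> k \<in> K"
    and spoke_exists: "K \<noteq> {}"
    and spoke_edge: "k \<in> K \<Longrightarrow> l \<in> K \<Longrightarrow> k < l \<Longrightarrow> K \<inter> {k<..<l} = {} \<Longrightarrow> E k l"
begin

definition consec :: "int \<Rightarrow> int \<Rightarrow> bool" where
  "consec k l \<longleftrightarrow> k \<in> K \<and> l \<in> K \<and> k < l \<and> K \<inter> {k<..<l} = {}"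

definition all_tris :: "tri set" where
  "all_tris = {Tri a c b |a c b. a < c \<and> c < b \<and> E a c \<and> E c b \<and> E a b} \<union> {Cen k l |k l. consec k l}"

definition under :: "int \<Rightarrow> int \<Rightarrow> tri set" where
  "under A B = {Tri a c b |a c b. a < c \<and> c < b \<and> E a c \<and> E c b \<and> E a b \<and> A \<le> a \<and> b \<le> B}"

definition sectors :: "int \<Rightarrow> int \<Rightarrow> tri set" where
  "sectors A B = under A B \<union> {Cen k l |k l. consec k l \<and> A \<le> k \<and> l \<le> B}"

text \<open>\<open>all_tris\<close> is infinite, so only triangles at a vertex strictly between
  \<open>i\<close> and \<open>j\<close> enter; \<open>F_under\<close> and \<open>F_sectors\<close>
  exchange them for a convenient finite window. The value 0 at \<open>i = j\<close>, where the empty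
  matching would give 1, is the determinant of two equal vectors and makes the Ptolemy formulas hold
  at the ends.\<close>

definition F :: "int \<Rightarrow> int \<Rightarrow> nat" where
  "F i j = (if i < j then wmatch wt {i<..<j} {t \<in> all_tris. corners t \<inter> {i<..<j} \<noteq> {}} else 0)"

lemma Tri_in: "Tri a c b \<in> all_tris \<longleftrightarrow> a < c \<and> c < b \<and> E a c \<and> E c b \<and> E a b"
  and Cen_in: "Cen k l \<in> all_tris \<longleftrightarrow> consec k l"
  by (auto simp: all_tris_def)

lemma under_subset: "under A B \<subseteq> all_tris" and sectors_subset: "sectors A B \<subseteq> all_tris"
  by (auto simp: under_def sectors_def all_tris_def)

lemma Tri_under: "Tri a c b \<in> under A B \<longleftrightarrow> Tri a c b \<in> all_tris \<and> A \<le> a \<and> b \<le> B"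
  and Cen_under: "Cen k l \<notin> under A B"
  by (auto simp: under_def all_tris_def)

lemma under_sectors: "under A B \<subseteq> sectors A B" by (auto simp: sectors_def)

lemma Tri_sectors: "Tri a c b \<in> sectors A B \<longleftrightarrow> Tri a c b \<in> all_tris \<and> A \<le> a \<and> b \<le> B"
  and Cen_sectors: "Cen k l \<in> sectors A B \<longleftrightarrow> consec k l \<and> A \<le> k \<and> l \<le> B"
  by (auto simp: sectors_def under_def all_tris_def)

lemma corners_sectors: "t \<in> sectors A B \<Longrightarrow> p \<in> corners t \<Longrightarrow> A \<le> p \<and> p \<le> B"
  by (cases t) (auto simp: Tri_sectors Cen_sectors Tri_in consec_def)

lemma corners_under: "t \<in> under A B \<Longrightarrow> p \<in> corners t \<Longrightarrow> A \<le> p \<and> p \<le> B"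
  using corners_sectors under_sectors by blast

lemma wt_under: "t \<in> under A B \<Longrightarrow> p < A \<or> B < p \<Longrightarrow> wt p t = 0"
  using corners_under by (fastforce simp: wt_def)

lemma wt_sectors: "t \<in> sectors A B \<Longrightarrow> p < A \<or> B < p \<Longrightarrow> wt p t = 0"
  using corners_sectors by (fastforce simp: wt_def)

lemma finite_sectors [simp]: "finite (sectors A B)"
proof (rule finite_subset)
  show "sectors A B \<subseteq> (\<Union>a\<in>{A..B}. \<Union>c\<in>{A..B}. (\<Union>b\<in>{A..B}. {Tri a c b}) \<union> {Cen a c})"
    by (fastforce simp: sectors_def under_def consec_def)
qed auto

lemma finite_under [simp]: "finite (under A B)"
  using under_sectors finite_sectors by (rule finite_subset)

section \<open>Periodicity, spokes and sectors\<close>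

lemma spoke_shift: "k + m * N \<in> K \<longleftrightarrow> k \<in> K"
proof (induction m rule: int_induct[where k = 0])
  case (step1 i)
  then show ?case using spoke_period[of "k + i * N"] by (simp add: algebra_simps)
next
  case (step2 i)
  then show ?case using spoke_period[of "k + (i - 1) * N"] by (simp add: algebra_simps)
qed simp

lemma edge_shift: "E (a + m * N) (b + m * N) \<longleftrightarrow> E a b"
proof (induction m rule: int_induct[where k = 0])
  case (step1 i)
  then show ?case using edge_period[of "a + i * N" "b + i * N"] by (simp add: algebra_simps)
next
  case (step2 i)
  then show ?case using edge_period[of "a + (i - 1) * N" "b + (i - 1) * N"] by (simp add: algebra_simps)
qed simp

lemma spoke_in_window: "\<exists>k\<in>K. x < k \<and> k \<le> x + N"
proof -
  obtain k where k: "k \<in> K" using spoke_exists by auto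
  let ?m = "(x + N - k) div N"
  have "k + ?m * N \<in> K" using k by (simp add: spoke_shift)
  moreover have "(x + N - k) mod N < N" "0 \<le> (x + N - k) mod N" using N_pos by auto
  moreover have "?m * N = x + N - k - (x + N - k) mod N" by (simp add: minus_mod_eq_div_mult)
  ultimately show ?thesis by (intro bexI[of _ "k + ?m * N"]) auto
qed

text \<open>Among the \<open>N\<close> integers after \<open>a\<close> there is a spoke, over which
  a longer edge would pass.\<close>

lemma edge_length: "E a b \<Longrightarrow> b \<le> a + N"
  using spoke_in_window[of a] edge_spoke by force

text \<open>With \<open>hi\<close>, the spokes enclosing \<open>i\<close>, half-open:
  \<open>lo i = i\<close> when \<open>i\<close> is itself a spoke. Searching one period keeps the
  sets finite and nonempty.\<close>

definition lo :: "int \<Rightarrow> int" where "lo i = Max (K \<inter> {i - N..i})"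
definition hi :: "int \<Rightarrow> int" where "hi i = Min (K \<inter> {i<..i + N})"

lemma lo_hi: "consec (lo i) (hi i)" "lo i \<le> i" "i < hi i" "lo i \<in> K" "hi i \<in> K"
proof -
  have lo: "lo i \<in> K \<inter> {i - N..i}" unfolding lo_def
    using spoke_in_window[of "i - N"] by (intro Max_in) auto
  have hi: "hi i \<in> K \<inter> {i<..i + N}" unfolding hi_def
    using spoke_in_window[of i] by (intro Min_in) auto
  have "x \<le> lo i" if "x \<in> K" "x \<le> i" for x
  proof (cases "i - N \<le> x")
    case True
    then show ?thesis unfolding lo_def using that by (intro Max_ge) auto
  qed (use lo in auto)
  moreover have "hi i \<le> x" if "x \<in> K" "i < x" for x
  proof (cases "x \<le> i + N")
    case True
    then show ?thesis unfolding hi_def using that by (intro Min_le) auto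
  qed (use hi in auto)
  ultimately show "consec (lo i) (hi i)" using lo hi unfolding consec_def by force
  show "lo i \<le> i" "i < hi i" "lo i \<in> K" "hi i \<in> K" using lo hi by auto
qed

lemma consec_unique:
  assumes "consec k l" "k \<le> i" "i < l"
  shows "lo i = k" "hi i = l"
proof -
  have 1: "k \<in> K" "l \<in> K" "\<And>x. x \<in> K \<Longrightarrow> k < x \<Longrightarrow> x < l \<Longrightarrow> False" using assms by (auto simp: consec_def)
  have 2: "\<And>x. x \<in> K \<Longrightarrow> lo i < x \<Longrightarrow> x < hi i \<Longrightarrow> False" using lo_hi(1)[of i] by (auto simp: consec_def)
  show "lo i = k" "hi i = l"
    using 1 2[of k] 2[of l] 1(3)[of "lo i"] 1(3)[of "hi i"] lo_hi[of i] assms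
    by (metis linorder_neqE_linordered_idom order_le_less_trans order_less_le_trans order_less_imp_le)+
qed

lemma consec_edge: "consec k l \<Longrightarrow> E k l"
  by (auto simp: consec_def spoke_edge)

lemma consec_shift: "consec (k + m * N) (l + m * N) \<longleftrightarrow> consec k l"
proof -
  have "K \<inter> {k + m * N<..<l + m * N} = {} \<longleftrightarrow> K \<inter> {k<..<l} = {}"
  proof
    assume *: "K \<inter> {k + m * N<..<l + m * N} = {}"
    have "x + m * N \<in> K \<inter> {k + m * N<..<l + m * N}" if "x \<in> K \<inter> {k<..<l}" for x
      using that by (auto simp: spoke_shift)
    with * show "K \<inter> {k<..<l} = {}" by blast
  next
    assume *: "K \<inter> {k<..<l} = {}"
    have "x - m * N \<in> K \<inter> {k<..<l}" if "x \<in> K \<inter> {k + m * N<..<l + m * N}" for x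
      using that spoke_shift[of "x - m * N" m] by auto
    with * show "K \<inter> {k + m * N<..<l + m * N} = {}" by blast
  qed
  then show ?thesis by (auto simp: consec_def spoke_shift)
qed

lemma lo_hi_shift: "lo (i + m * N) = lo i + m * N" "hi (i + m * N) = hi i + m * N"
  using consec_unique[of "lo i + m * N" "hi i + m * N" "i + m * N"] lo_hi[of i] by (auto simp: consec_shift)

lemma all_tris_shift: "shift (m * N) t \<in> all_tris \<longleftrightarrow> t \<in> all_tris"
  by (cases t) (auto simp: Tri_in Cen_in edge_shift consec_shift)

text \<open>A side of \<open>t\<close> leaving the interval from \<open>a\<close> to
  \<open>b\<close> would cross the edge, and no spoke ends strictly below an edge.\<close>

lemma tri_local:
  assumes "t \<in> all_tris" "x \<in> corners t" "E a b" "a < x" "x < b"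
  shows "t \<in> under a b"
proof (cases t)
  case (Tri p q r)
  then have *: "p < q" "q < r" "E p q" "E q r" "E p r" "x = p \<or> x = q \<or> x = r" using assms by (auto simp: Tri_in)
  have "a \<le> p"
  proof (rule ccontr)
    assume "\<not> a \<le> p"
    then show False using * assms edge_cross[of p q a b] edge_cross[of p r a b] by auto
  qed
  moreover have "r \<le> b"
  proof (rule ccontr)
    assume "\<not> r \<le> b"
    then show False using * assms edge_cross[of a b p r] edge_cross[of a b q r] by auto
  qed
  ultimately show ?thesis using Tri assms by (simp add: Tri_under)
next
  case (Cen k l)
  then have "k \<in> K" "l \<in> K" "x = k \<or> x = l" using assms by (auto simp: Cen_in consec_def)
  then show ?thesis using assms edge_spoke by blast
qed

lemma tri_local_sectors:
  assumes "t \<in> all_tris" "x \<in> corners t" "A \<in> K" "B \<in> K" "A < x" "x < B"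
  shows "t \<in> sectors A B"
proof (cases t)
  case (Tri p q r)
  then have *: "p < q" "q < r" "E p r" "x = p \<or> x = q \<or> x = r" using assms by (auto simp: Tri_in)
  have "a \<le> p" if "a \<in> K" "a < x" for a using edge_spoke[of p r a] * that by force
  moreover have "r \<le> b" if "b \<in> K" "x < b" for b using edge_spoke[of p r b] * that by force
  ultimately show ?thesis using Tri assms by (simp add: Tri_sectors)
next
  case (Cen k l)
  then have *: "consec k l" "x = k \<or> x = l" "k < l" using assms by (auto simp: Cen_in consec_def)
  then have "A \<le> k" "l \<le> B" using assms unfolding consec_def by force+
  then show ?thesis using Cen * by (simp add: Cen_sectors)
qed

lemma F_under:
  assumes "E a b" "a \<le> i" "i < j" "j \<le> b"
  shows "F i j = wmatch wt {i<..<j} (under a b)"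
proof -
  have "{t \<in> all_tris. corners t \<inter> {i<..<j} \<noteq> {}} \<subseteq> under a b"
  proof
    fix t assume "t \<in> {t \<in> all_tris. corners t \<inter> {i<..<j} \<noteq> {}}"
    then obtain x where "t \<in> all_tris" "x \<in> corners t" "x \<in> {i<..<j}" by blast
    then show "t \<in> under a b" using tri_local[of t x a b] assms by auto
  qed
  then have "wmatch wt {i<..<j} (under a b) = wmatch wt {i<..<j} {t \<in> all_tris. corners t \<inter> {i<..<j} \<noteq> {}}"
    using under_subset[of a b] by (intro wmatch_drop) (auto simp: wt_def)
  then show ?thesis using assms by (simp add: F_def)
qed

lemma F_sectors:
  assumes "A \<in> K" "B \<in> K" "A \<le> i" "i < j" "j \<le> B"
  shows "F i j = wmatch wt {i<..<j} (sectors A B)"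
proof -
  have "{t \<in> all_tris. corners t \<inter> {i<..<j} \<noteq> {}} \<subseteq> sectors A B"
  proof
    fix t assume "t \<in> {t \<in> all_tris. corners t \<inter> {i<..<j} \<noteq> {}}"
    then obtain x where "t \<in> all_tris" "x \<in> corners t" "x \<in> {i<..<j}" by blast
    then show "t \<in> sectors A B" using tri_local_sectors[of t x A B] assms by auto
  qed
  then have "wmatch wt {i<..<j} (sectors A B) = wmatch wt {i<..<j} {t \<in> all_tris. corners t \<inter> {i<..<j} \<noteq> {}}"
    using sectors_subset[of A B] by (intro wmatch_drop) (auto simp: wt_def)
  then show ?thesis using assms by (simp add: F_def)
qed

section \<open>Decomposition below an edge and the Ptolemy relation\<close>

lemma F_self [simp]: "F i i = 0" by (simp add: F_def)

lemma F_succ: "F i (i + 1) = 1"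
proof -
  have "{i<..<i + 1} = {}" by auto
  then show ?thesis by (simp only: F_def wmatch_empty) simp
qed

lemma under_split:
  assumes "Tri a c b \<in> all_tris"
  shows "under a b = insert (Tri a c b) (under a c \<union> under c b)"
    and "Tri a c b \<notin> under a c" "Tri a c b \<notin> under c b" "under a c \<inter> under c b = {}"
proof -
  have h: "a < c" "c < b" "E a c" "E c b" "E a b" using assms by (auto simp: Tri_in)
  show "Tri a c b \<notin> under a c" "Tri a c b \<notin> under c b" using h by (auto simp: Tri_under)
  show "under a c \<inter> under c b = {}" by (auto simp: under_def)
  have "t = Tri a c b \<or> t \<in> under a c \<or> t \<in> under c b" if "t \<in> under a b" for t
  proof -
    from that obtain p x q where t: "t = Tri p x q" "t \<in> all_tris" "p < x" "x < q" "E p x" "E x q" "E p q" "a \<le> p" "q \<le> b"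
      unfolding under_def all_tris_def by blast
    show ?thesis
    proof (cases "q \<le> c \<or> c \<le> p")
      case True
      then show ?thesis using t by (auto simp: Tri_under)
    next
      case False
      \<comment> \<open>The long side from \<open>p\<close> to \<open>q\<close> passes over
        \<open>c\<close>, so non-crossing with the edges \<open>a c\<close> and \<open>c b\<close>
        forces its ends to \<open>a\<close> and \<open>b\<close>; after that the apex can only be
        \<open>c\<close>.\<close>
      have "p = a" using edge_cross[of a c p q] h t False by force
      moreover have "q = b" using edge_cross[of p q c b] h t False by force
      moreover have "x = c"
        using edge_cross[of a c x b] edge_cross[of a x c b] h t calculation by (metis linorder_neqE_linordered_idom)
      ultimately show ?thesis using t by simp
    qed
  qed
  then show "under a b = insert (Tri a c b) (under a c \<union> under c b)"
    using assms h by (auto simp: under_def Tri_in)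
qed

lemma under_succ: "under a (a + 1) = {}"
  by (auto simp: under_def)

lemma edge_induct [consumes 1, case_names short apex]:
  assumes "E a b" and short: "\<And>a. P a (a + 1)"
    and step: "\<And>a c b. Tri a c b \<in> all_tris \<Longrightarrow> P a c \<Longrightarrow> P c b \<Longrightarrow> P a b"
  shows "P a b"
  using assms(1)
proof (induction "nat (b - a)" arbitrary: a b rule: less_induct)
  case less
  have "a < b" using less.prems edge_less by auto
  show ?case
  proof (cases "b = a + 1")
    case True
    then show ?thesis using short by simp
  next
    case False
    then obtain c where c: "a < c" "c < b" "E a c" "E c b" using edge_apex[of a b] less.prems \<open>a < b\<close> by auto
    then have "P a c" "P c b" using less.hyps by auto
    then show ?thesis using c less.prems by (intro step[of a c b]) (auto simp: Tri_in)
  qed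
qed

text \<open>This is also the number of vertices strictly between \<open>a\<close> and
  \<open>b\<close>, which therefore exhaust the triangles below the edge: the cardinality
  alternative of \<open>wmatch_split\<close>.\<close>

lemma card_under: "E a b \<Longrightarrow> card (under a b) = nat (b - a - 1)"
proof (induction rule: edge_induct)
  case (short a)
  then show ?case by (simp add: under_succ)
next
  case (apex a c b)
  then have "a < c" "c < b" by (auto simp: Tri_in)
  then show ?case using apex under_split[OF apex(1)] by (simp add: card_Un_disjoint)
qed

text \<open>The invariant for the induction along edges. \<open>F a b = 1\<close> alone does not
  propagate: an end of an edge also belongs to the triangle above it, so matchings that cover an end
  must be known too. At \<open>i = a\<close> in the first and third count, and at
  \<open>i = b\<close> in the others, the vertices outnumber the triangles and both sides are
  0.\<close>

definition good :: "int \<Rightarrow> int \<Rightarrow> bool" where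
  "good a b \<longleftrightarrow> E a b \<and> F a b = 1 \<and> (\<forall>i. a \<le> i \<and> i \<le> b \<longrightarrow>
     wmatch wt {i<..b} (under a b) = F a i \<and> wmatch wt {a..<i} (under a b) = F i b \<and>
     wmatch wt ({a<..b} - {i}) (under a b) = F a i \<and> wmatch wt ({a..<b} - {i}) (under a b) = F i b)"

text \<open>In the applications \<open>t\<close> lies on the other side of the edge. If
  \<open>b\<close> takes \<open>t\<close>, the vertices strictly between \<open>i\<close> and
  \<open>b\<close> remain and give \<open>F i b\<close>; otherwise the matching stays below the edge
  and gives \<open>F a i\<close>.\<close>

lemma wmatch_cap_right:
  assumes "good a b" "a \<le> i" "i \<le> b" "t \<notin> under a b" "wt b t = 1" "\<And>p. a < p \<Longrightarrow> p < b \<Longrightarrow> wt p t = 0"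
  shows "wmatch wt {i<..b} (insert t (under a b)) = F a i + F i b"
proof (cases "i = b")
  case True
  then show ?thesis using assms by (simp add: good_def)
next
  case False
  have I: "{i<..b} = insert b {i<..<b}" using False assms by auto
  have "wmatch wt {i<..b} (insert t (under a b)) =
      wt b t * wmatch wt {i<..<b} (under a b) + wmatch wt {i<..b} (under a b)"
    unfolding I using assms by (intro wmatch_insert_column) auto
  then show ?thesis using assms False F_under[of a b i b] by (auto simp: good_def)
qed

lemma wmatch_cap_left:
  assumes "good a b" "a \<le> i" "i \<le> b" "t \<notin> under a b" "wt a t = 1" "\<And>p. a < p \<Longrightarrow> p < b \<Longrightarrow> wt p t = 0"
  shows "wmatch wt {a..<i} (insert t (under a b)) = F a i + F i b"
proof (cases "i = a")
  case True
  then show ?thesis using assms by (simp add: good_def)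
next
  case False
  have I: "{a..<i} = insert a {a<..<i}" using False assms by auto
  have "wmatch wt {a..<i} (insert t (under a b)) =
      wt a t * wmatch wt {a<..<i} (under a b) + wmatch wt {a..<i} (under a b)"
    unfolding I using assms by (intro wmatch_insert_column) auto
  then show ?thesis using assms False F_under[of a b a i] by (auto simp: good_def)
qed

text \<open>There are as many vertices as triangles, so \<open>t\<close> is used, by
  \<open>a\<close> or by \<open>b\<close>; these cases give \<open>F a i\<close> and
  \<open>F i b\<close>.\<close>

lemma wmatch_cap:
  assumes good: "good a b" and i: "a \<le> i" "i \<le> b" and t: "t \<notin> under a b" "wt a t = 1" "wt b t = 1"
    and z: "\<And>p. a < p \<Longrightarrow> p < b \<Longrightarrow> wt p t = 0"
  shows "wmatch wt ({a..b} - {i}) (insert t (under a b)) = F a i + F i b"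
proof -
  consider "i = a" | "i = b" | "a < i" "i < b" using i by linarith
  then show ?thesis
  proof cases
    case 1
    moreover have "{a..b} - {a} = {a<..b}" by auto
    ultimately show ?thesis using wmatch_cap_right[OF good, of a t] assms by simp
  next
    case 2
    moreover have "{a..b} - {b} = {a..<b}" by auto
    ultimately show ?thesis using wmatch_cap_left[OF good, of b t] assms by simp
  next
    case 3
    let ?I = "{a<..<b} - {i}" and ?D = "under a b"
    have I: "{a..b} - {i} = insert a (insert b ?I)" "{a<..b} - {i} = insert b ?I" "{a..<b} - {i} = insert a ?I"
      using 3 by auto
    have E: "E a b" using good by (simp add: good_def)
    have cI: "card (insert b ?I) = nat (b - a - 1)" using 3 by (simp add: card_Diff_singleton_if)
    \<comment> \<open>Once \<open>a\<close> takes a triangle \<open>s\<close> below the edge, the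
      other vertices outnumber the triangles left there, so \<open>b\<close> must take
      \<open>t\<close>.\<close>
    have *: "wmatch wt (insert b ?I) (insert t ?D - {s}) = wmatch wt ?I (?D - {s})" if "s \<in> ?D" for s
    proof -
      have "wmatch wt (insert b ?I) (insert t (?D - {s})) =
          wt b t * wmatch wt ?I (?D - {s}) + wmatch wt (insert b ?I) (?D - {s})"
        using z t by (intro wmatch_insert_column) auto
      moreover have "wmatch wt (insert b ?I) (?D - {s}) = 0"
        using that card_under[OF E] cI 3 by (intro wmatch_zero) auto
      moreover have "insert t ?D - {s} = insert t (?D - {s})" using that t by auto
      ultimately show ?thesis using t by simp
    qed
    have "wmatch wt (insert a (insert b ?I)) (insert t ?D) =
       (\<Sum>s\<in>insert t ?D. wt a s * wmatch wt (insert b ?I) (insert t ?D - {s}))"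
      using 3 by (intro wmatch_insert) auto
    also have "\<dots> = wmatch wt (insert b ?I) ?D + (\<Sum>s\<in>?D. wt a s * wmatch wt ?I (?D - {s}))"
      using t * by simp
    also have "(\<Sum>s\<in>?D. wt a s * wmatch wt ?I (?D - {s})) = wmatch wt (insert a ?I) ?D"
      by (subst wmatch_insert) auto
    also have "wmatch wt (insert b ?I) ?D = F a i" using good i unfolding I(2)[symmetric] good_def by auto
    also have "wmatch wt (insert a ?I) ?D = F i b" using good i unfolding I(3)[symmetric] good_def by auto
    finally show ?thesis unfolding I(1) .
  qed
qed

text \<open>The two recursions are Ptolemy relations for the points \<open>a\<close>,
  \<open>c\<close>, \<open>b\<close> and \<open>i\<close>, with the sides of the triangle counting
  1. They arise by exhausting one of the shorter edges and capping the other with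
  \<open>Tri a c b\<close>.\<close>

lemma good_apex:
  assumes tri: "Tri a c b \<in> all_tris" and good: "good a c" "good c b"
  shows "\<And>i. c \<le> i \<Longrightarrow> i \<le> b \<Longrightarrow> F a i = F c i + F i b"
    and "\<And>i. a \<le> i \<Longrightarrow> i \<le> c \<Longrightarrow> F i b = F a i + F i c"
    and "good a b"
proof -
  let ?t = "Tri a c b"
  have h: "a < c" "c < b" "E a c" "E c b" "E a b" using tri by (auto simp: Tri_in)
  note sp = under_split[OF tri]
  have cu: "card (under a c) = nat (c - a - 1)" "card (under c b) = nat (b - c - 1)"
    using h card_under by auto
  have F1: "F a c = 1" "F c b = 1" using good by (auto simp: good_def)
  have wt: "wt a ?t = 1" "wt c ?t = 1" "wt b ?t = 1" "\<And>p. p \<noteq> a \<Longrightarrow> p \<noteq> b \<Longrightarrow> p \<noteq> c \<Longrightarrow> wt p ?t = 0"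
    by (auto simp: wt_def)
  have full: "wmatch wt {a<..<c} (under a c) = 1" "wmatch wt {c<..<b} (under c b) = 1"
    using F_under[of a c a c] F_under[of c b c b] h F1 by auto
  have D1: "under a b - under a c = insert ?t (under c b)" "under a b - under c b = insert ?t (under a c)"
    "under a b - insert ?t (under c b) = under a c" "under a b - insert ?t (under a c) = under c b"
    using sp by auto
  have wa: "wt p s = 0" if "s \<in> under a c" "c < p" for s p using that wt_under by blast
  have wb: "wt p s = 0" if "s \<in> under c b" "p < c" for s p using that wt_under by blast
  note wcl = wmatch_cap_left[OF good(2) _ _ sp(3) wt(2)]
  note wcr = wmatch_cap_right[OF good(1) _ _ sp(2) wt(2)]
  show rec2: "F a i = F c i + F i b" if "c \<le> i" "i \<le> b" for i
  proof (cases "i = c")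
    case True
    then show ?thesis using F1 by simp
  next
    case False
    \<comment> \<open>The vertices strictly between \<open>a\<close> and \<open>c\<close> use up
      \<open>under a c\<close> in exactly one way; what remains is the edge from \<open>c\<close> to
      \<open>b\<close>, capped by \<open>?t\<close>.\<close>
    have "{a<..<i} = {a<..<c} \<union> {c..<i}" using False that h by auto
    then have "F a i = wmatch wt ({a<..<c} \<union> {c..<i}) (under a b)" using F_under[of a b a i] h that by auto
    also have "\<dots> = wmatch wt {a<..<c} (under a c) * wmatch wt {c..<i} (under a b - under a c)"
      using h sp(1) cu wt wb by (intro wmatch_split) auto
    finally show ?thesis unfolding D1 full using wcl[of i] wt that h by simp
  qed
  show rec1: "F i b = F a i + F i c" if "a \<le> i" "i \<le> c" for i
  proof (cases "i = c")
    case True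
    then show ?thesis using F1 by simp
  next
    case False
    have "{i<..<b} = {c<..<b} \<union> {i<..c}" using False that h by auto
    then have "F i b = wmatch wt ({c<..<b} \<union> {i<..c}) (under a b)" using F_under[of a b i b] h that by auto
    also have "\<dots> = wmatch wt {c<..<b} (under c b) * wmatch wt {i<..c} (under a b - under c b)"
      using h sp(1) cu wt wa by (intro wmatch_split) auto
    finally show ?thesis unfolding D1 full using wcr[of i] wt that h by simp
  qed
  \<comment> \<open>The \<open>b - c\<close> vertices after \<open>c\<close> use up
    \<open>?t\<close> together with \<open>under c b\<close>, again in exactly one way, so
    \<open>J\<close> is left with \<open>under a c\<close>.\<close>
  have right: "wmatch wt ({c<..b} \<union> J) (under a b) = wmatch wt J (under a c)" if "J \<subseteq> {a<..c}" for J
  proof -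
    have "finite J" using that by (rule finite_subset) simp
    then have "wmatch wt ({c<..b} \<union> J) (under a b) =
        wmatch wt {c<..b} (insert ?t (under c b)) * wmatch wt J (under a b - insert ?t (under c b))"
      using sp cu wt wa that h by (intro wmatch_split) auto
    moreover have "wmatch wt {c<..b} (insert ?t (under c b)) = 1"
      using wmatch_cap_right[OF good(2) _ _ sp(3) wt(3), of c] F1 wt h by simp
    ultimately show ?thesis by (simp add: D1)
  qed
  have left: "wmatch wt ({a..<c} \<union> J) (under a b) = wmatch wt J (under c b)" if "J \<subseteq> {c..<b}" for J
  proof -
    have "finite J" using that by (rule finite_subset) simp
    then have "wmatch wt ({a..<c} \<union> J) (under a b) =
        wmatch wt {a..<c} (insert ?t (under a c)) * wmatch wt J (under a b - insert ?t (under a c))"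
      using sp cu wt wb that h by (intro wmatch_split) auto
    moreover have "wmatch wt {a..<c} (insert ?t (under a c)) = 1"
      using wmatch_cap_left[OF good(1) _ _ sp(2) wt(1), of c] F1 wt h by simp
    ultimately show ?thesis by (simp add: D1)
  qed
  have e1: "wmatch wt {i<..b} (under a b) = F a i" if "a \<le> i" "i \<le> b" for i
  proof (cases "i \<le> c")
    case True
    then have "{i<..b} = {c<..b} \<union> {i<..c}" using h by auto
    moreover have "{i<..c} \<subseteq> {a<..c}" using that by auto
    ultimately show ?thesis using right[of "{i<..c}"] True that good(1) by (auto simp: good_def)
  next
    case False
    have "wmatch wt {i<..b} (under a b) = wmatch wt {i<..b} (insert ?t (under c b))"
      using sp(1) D1(3) wa False by (intro wmatch_drop) auto
    then show ?thesis using wmatch_cap_right[OF good(2) _ _ sp(3) wt(3), of i] wt that h False rec2[of i] by simp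
  qed
  have e2: "wmatch wt {a..<i} (under a b) = F i b" if "a \<le> i" "i \<le> b" for i
  proof (cases "c \<le> i")
    case True
    then have "{a..<i} = {a..<c} \<union> {c..<i}" using h by auto
    moreover have "{c..<i} \<subseteq> {c..<b}" using that by auto
    ultimately show ?thesis using left[of "{c..<i}"] True that good(2) by (auto simp: good_def)
  next
    case False
    have "wmatch wt {a..<i} (under a b) = wmatch wt {a..<i} (insert ?t (under a c))"
      using sp(1) D1(4) wb False by (intro wmatch_drop) auto
    then show ?thesis using wmatch_cap_left[OF good(1) _ _ sp(2) wt(1), of i] wt that h False rec1[of i] by simp
  qed
  have e3: "wmatch wt ({a<..b} - {i}) (under a b) = F a i" if "a \<le> i" "i \<le> b" for i
  proof (cases "i \<le> c")
    case True
    then have "{a<..b} - {i} = {c<..b} \<union> ({a<..c} - {i})" using h by auto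
    moreover have "{a<..c} - {i} \<subseteq> {a<..c}" using that by auto
    ultimately show ?thesis using right[of "{a<..c} - {i}"] True that good(1) by (auto simp: good_def)
  next
    case False
    then have "{a<..b} - {i} = {a<..<c} \<union> ({c..b} - {i})" using h by auto
    moreover have "wmatch wt ({a<..<c} \<union> ({c..b} - {i})) (under a b) =
        wmatch wt {a<..<c} (under a c) * wmatch wt ({c..b} - {i}) (under a b - under a c)"
      using h sp(1) cu wt wb by (intro wmatch_split) auto
    ultimately show ?thesis
      unfolding D1 full using wmatch_cap[OF good(2) _ _ sp(3) wt(2,3), of i] wt that h False rec2[of i] by simp
  qed
  have e4: "wmatch wt ({a..<b} - {i}) (under a b) = F i b" if "a \<le> i" "i \<le> b" for i
  proof (cases "c \<le> i")
    case True
    then have "{a..<b} - {i} = {a..<c} \<union> ({c..<b} - {i})" using h by auto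
    moreover have "{c..<b} - {i} \<subseteq> {c..<b}" using that by auto
    ultimately show ?thesis using left[of "{c..<b} - {i}"] True that good(2) by (auto simp: good_def)
  next
    case False
    then have "{a..<b} - {i} = {c<..<b} \<union> ({a..c} - {i})" using h by auto
    moreover have "wmatch wt ({c<..<b} \<union> ({a..c} - {i})) (under a b) =
        wmatch wt {c<..<b} (under c b) * wmatch wt ({a..c} - {i}) (under a b - under c b)"
      using h sp(1) cu wt wa by (intro wmatch_split) auto
    ultimately show ?thesis
      unfolding D1 full using wmatch_cap[OF good(1) _ _ sp(2) wt(1,2), of i] wt that h False rec1[of i] by simp
  qed
  have "F a b = 1" using rec2[of b] F1 h by simp
  then show "good a b" unfolding good_def using h e1 e2 e3 e4 by blast
qed

lemma good: "E a b \<Longrightarrow> good a b"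
proof (induction rule: edge_induct)
  case (short a)
  have "wmatch wt I {} = 0" if "I \<noteq> {}" "finite I" for I :: "int set"
    using that by (intro wmatch_zero) (auto simp: card_gt_0_iff)
  note z = this
  have S: "{a<..a + 1} = {a + 1}" "{a..<a + 1} = {a}" by auto
  show ?case unfolding good_def under_succ
  proof (intro conjI[OF edge_succ conjI[OF F_succ]] allI impI)
    fix i assume "a \<le> i \<and> i \<le> a + 1"
    then consider "i = a" | "i = a + 1" by linarith
    then show "wmatch wt {i<..a + 1} {} = F a i \<and> wmatch wt {a..<i} {} = F i (a + 1) \<and>
      wmatch wt ({a<..a + 1} - {i}) {} = F a i \<and> wmatch wt ({a..<a + 1} - {i}) {} = F i (a + 1)"
      using F_succ[of a] by cases (simp_all add: S z)
  qed
next
  case (apex a c b)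
  then show ?case by (rule good_apex(3))
qed

lemmas F_apex_right = good_apex(1)[OF _ good good]
lemmas F_apex_left = good_apex(2)[OF _ good good]

lemma F_edge: "E a b \<Longrightarrow> F a b = 1"
  using good by (auto simp: good_def)

lemma wmatch_edge:
  assumes "E a b" "a \<le> i" "i \<le> b"
  shows "wmatch wt {i<..b} (under a b) = F a i" "wmatch wt {a..<i} (under a b) = F i b"
    "wmatch wt ({a<..b} - {i}) (under a b) = F a i" "wmatch wt ({a..<b} - {i}) (under a b) = F i b"
  using good[of a b] assms by (auto simp: good_def)

text \<open>The factor \<open>F a b = 1\<close> is suppressed. With \<open>i\<close> and
  \<open>j\<close> on the same side of the apex \<open>c\<close>, the recursions of
  \<open>good_apex\<close> reduce the relation to the shorter edge. The new case is
  \<open>i < c < j\<close>, where \<open>c\<close> is matched to the left, to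
  \<open>Tri a c b\<close> or to the right.\<close>

lemma F_ptolemy:
  "E a b \<Longrightarrow> a \<le> i \<Longrightarrow> i \<le> j \<Longrightarrow> j \<le> b \<Longrightarrow> F i j + F a i * F j b = F a j * F i b"
proof (induction arbitrary: i j rule: edge_induct)
  case (short a)
  then have "(i = a \<or> i = a + 1) \<and> (j = a \<or> j = a + 1)" by auto
  then show ?case using short F_succ[of a] by auto
next
  case (apex a c b)
  have h: "a < c" "c < b" "E a c" "E c b" "E a b" using apex by (auto simp: Tri_in)
  note rec = F_apex_right[OF apex(1) h(3,4)] F_apex_left[OF apex(1) h(3,4)]
  consider "j \<le> c" | "c \<le> i" | "i < c" "c < j" by linarith
  then show ?case
  proof cases
    case 1
    then show ?thesis using apex(2)[of i j] apex.prems rec(2)[of i] rec(2)[of j] by (simp add: algebra_simps)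
  next
    case 2
    then show ?thesis using apex(3)[of i j] apex.prems rec(1)[of i] rec(1)[of j] by (simp add: algebra_simps)
  next
    case 3
    let ?t = "Tri a c b"
    have I: "{i<..<j} = insert c ({i<..<c} \<union> {c<..<j})" "insert c {i<..<c} = {i<..c}" "insert c {c<..<j} = {c..<j}"
      using 3 by auto
    note sp = under_split[OF apex(1)]
    have wt: "wt c ?t = 1" "\<And>p. p \<noteq> a \<Longrightarrow> p \<noteq> b \<Longrightarrow> p \<noteq> c \<Longrightarrow> wt p ?t = 0"
      by (auto simp: wt_def)
    have "F i j = wmatch wt (insert c ({i<..<c} \<union> {c<..<j})) (insert ?t (under a c \<union> under c b))"
      using F_under[of a b i j] h apex.prems 3 I sp(1) by simp
    also have "\<dots> = wmatch wt (insert c {i<..<c}) (under a c) * wmatch wt {c<..<j} (under c b)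
      + wt c ?t * wmatch wt {i<..<c} (under a c) * wmatch wt {c<..<j} (under c b)
      + wmatch wt {i<..<c} (under a c) * wmatch wt (insert c {c<..<j}) (under c b)"
      using sp wt wt_under[of _ a c] wt_under[of _ c b] 3 apex.prems by (intro wmatch_separated) auto
    also have "\<dots> = F a i * F c j + F i c * F c j + F i c * F j b"
      unfolding I(2,3) using wmatch_edge[OF h(3)] wmatch_edge[OF h(4)] F_under[OF h(3)] F_under[OF h(4)] 3 apex.prems wt
      by simp
    finally show ?thesis using rec(2)[of i] rec(1)[of j] 3 apex.prems by (simp add: algebra_simps)
  qed
qed

text \<open>The Ptolemy recursion at \<open>Cen (lo i) (hi i)\<close>, with the puncture as third
  corner and both central sides counting 1. The identification with \<open>m_i0\<close> is
  \<open>central_matching_number_eq\<close>.\<close>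

definition X :: "int \<Rightarrow> nat" where "X i = F (lo i) i + F i (hi i)"

lemma X_spoke: assumes "k \<in> K" shows "X k = 1"
proof -
  have "lo k = k" using lo_hi[of k] assms unfolding consec_def by force
  then show ?thesis using F_edge[OF consec_edge[OF lo_hi(1)[of k]]] by (simp add: X_def)
qed

section \<open>Counting in strips between spokes\<close>

lemma sectors_consec:
  assumes "consec k l" shows "sectors k l = insert (Cen k l) (under k l)"
proof -
  have "p = k \<and> q = l" if "consec p q" "k \<le> p" "q \<le> l" for p q
    using that assms unfolding consec_def by force
  then show ?thesis using assms by (auto simp: sectors_def)
qed

lemma sectors_split:
  assumes "A \<le> B" "B \<le> C" "B \<in> K"
  shows "sectors A C = sectors A B \<union> sectors B C" "sectors A B \<inter> sectors B C = {}"
proof -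
  have "t \<in> sectors A B \<or> t \<in> sectors B C" if "t \<in> sectors A C" for t
  proof (cases t)
    case (Tri p x q)
    then show ?thesis using that edge_spoke[of p q B] assms by (force simp: Tri_sectors Tri_in)
  next
    case (Cen k l)
    then show ?thesis using that assms by (force simp: Cen_sectors consec_def)
  qed
  moreover have "t \<in> sectors A C" if "t \<in> sectors A B \<or> t \<in> sectors B C" for t
    using that assms by (cases t) (auto simp: Tri_sectors Cen_sectors)
  ultimately show "sectors A C = sectors A B \<union> sectors B C" by blast
  show "sectors A B \<inter> sectors B C = {}"
  proof (rule ccontr)
    assume "sectors A B \<inter> sectors B C \<noteq> {}"
    then obtain t where t: "t \<in> sectors A B" "t \<in> sectors B C" by auto
    then show False by (cases t) (auto simp: Tri_sectors Cen_sectors Tri_in consec_def)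
  qed
qed

lemma sectors_self: "sectors A A = {}"
  by (auto simp: sectors_def under_def consec_def)

lemma wt_Cen: "wt k (Cen k l) = 1" "wt l (Cen k l) = 1" "p \<noteq> k \<Longrightarrow> p \<noteq> l \<Longrightarrow> wt p (Cen k l) = 0"
  by (auto simp: wt_def)

text \<open>\<open>Cen k l\<close> caps the edge from \<open>k\<close> to \<open>l\<close>: these
  are the only integers it touches.\<close>

lemma wmatch_sector:
  assumes "consec k l" "k \<le> i" "i \<le> l"
  shows "wmatch wt ({k..l} - {i}) (sectors k l) = F k i + F i l"
    "wmatch wt {i<..l} (sectors k l) = F k i + F i l"
proof -
  have t: "Cen k l \<notin> under k l" "wt k (Cen k l) = 1" "wt l (Cen k l) = 1"
    "\<And>p. k < p \<Longrightarrow> p < l \<Longrightarrow> wt p (Cen k l) = 0"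
    by (simp_all add: Cen_under wt_Cen)
  note g = good[OF consec_edge[OF assms(1)]]
  show "wmatch wt ({k..l} - {i}) (sectors k l) = F k i + F i l"
    unfolding sectors_consec[OF assms(1)] by (rule wmatch_cap[OF g assms(2,3) t])
  show "wmatch wt {i<..l} (sectors k l) = F k i + F i l"
    unfolding sectors_consec[OF assms(1)] by (rule wmatch_cap_right[OF g assms(2,3) t(1,3,4)])
qed

lemma card_sector: "consec k l \<Longrightarrow> card (sectors k l) = nat (l - k)"
  using card_under[OF consec_edge] by (auto simp: sectors_consec Cen_under consec_def)

text \<open>With one end omitted, a strip has as many vertices as triangles, and the matching is
  forced sector by sector: from the left when the right end is omitted, from the right
  otherwise.\<close>

lemma wmatch_sectors_ends:
  assumes "A \<in> K" "B \<in> K" "A \<le> B"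
  shows "card (sectors A B) = nat (B - A) \<and> wmatch wt {A..<B} (sectors A B) = 1
    \<and> wmatch wt {A<..B} (sectors A B) = 1"
  using assms
proof (induction "nat (B - A)" arbitrary: A rule: less_induct)
  case less
  show ?case
  proof (cases "A = B")
    case True
    then show ?thesis by (simp add: sectors_self)
  next
    case False
    define l where "l = hi A"
    have "lo A = A" using lo_hi[of A] less.prems(1) unfolding consec_def by force
    then have l: "consec A l" "A < l" "l \<in> K" using lo_hi[of A] by (auto simp: l_def)
    have "l \<le> B" using l False less.prems unfolding consec_def by force
    have IH: "card (sectors l B) = nat (B - l)" "wmatch wt {l..<B} (sectors l B) = 1"
        "wmatch wt {l<..B} (sectors l B) = 1"
      using less.hyps[of l] l \<open>l \<le> B\<close> less.prems by auto
    note sp = sectors_split[of A l B]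
    have D: "sectors A B - sectors A l = sectors l B" "sectors A B - sectors l B = sectors A l"
      using sp l \<open>l \<le> B\<close> by auto
    have I: "{A..<B} = {A..<l} \<union> {l..<B}" "{A<..B} = {l<..B} \<union> {A<..l}" "{A..l} - {l} = {A..<l}"
      using l \<open>l \<le> B\<close> by auto
    have "wmatch wt {A..<B} (sectors A B) = wmatch wt {A..<l} (sectors A l) * wmatch wt {l..<B} (sectors A B - sectors A l)"
      unfolding I using sp l \<open>l \<le> B\<close> card_sector[OF l(1)] wt_sectors[of _ l B] by (intro wmatch_split) auto
    moreover have "wmatch wt {A<..B} (sectors A B) = wmatch wt {l<..B} (sectors l B) * wmatch wt {A<..l} (sectors A B - sectors l B)"
      unfolding I using sp l \<open>l \<le> B\<close> IH(1) wt_sectors[of _ A l] by (intro wmatch_split) auto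
    moreover have "wmatch wt {A..<l} (sectors A l) = 1" "wmatch wt {A<..l} (sectors A l) = 1"
      using wmatch_sector(1)[OF l(1), of l] wmatch_sector(2)[OF l(1), of A] l F_edge[OF consec_edge[OF l(1)]] I(3) by auto
    moreover have "card (sectors A B) = nat (B - A)"
      using sp l \<open>l \<le> B\<close> card_sector[OF l(1)] IH(1) by (simp add: card_Un_disjoint)
    ultimately show ?thesis using IH by (simp add: D)
  qed
qed

text \<open>The vertices after \<open>hi i\<close> exhaust the sectors to the right of
  \<open>hi i\<close> in one way, so the strip may be cut off there.\<close>

lemma wmatch_sectors_right:
  assumes "B \<in> K" "i < B" "J \<subseteq> {..hi i}" "finite J" "k = lo i"
  shows "wmatch wt ({hi i<..B} \<union> J) (sectors k B) = wmatch wt J (sectors k (hi i))"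
proof -
  let ?l = "hi i"
  have l: "?l \<in> K" "k \<le> ?l" "?l \<le> B" using lo_hi[of i] assms unfolding consec_def by force+
  note sp = sectors_split[OF l(2,3,1)] and e = wmatch_sectors_ends[OF l(1) assms(1) l(3)]
  have "wmatch wt ({?l<..B} \<union> J) (sectors k B) = wmatch wt {?l<..B} (sectors ?l B) * wmatch wt J (sectors k B - sectors ?l B)"
    using sp e l assms wt_sectors[of _ k ?l] by (intro wmatch_split) auto
  moreover have "sectors k B - sectors ?l B = sectors k ?l" using sp by auto
  ultimately show ?thesis using e by simp
qed

lemma wmatch_sectors_after:
  assumes "B \<in> K" "i < B"
  shows "wmatch wt {i<..B} (sectors (lo i) B) = X i"
proof -
  have "hi i \<le> B" using lo_hi[of i] assms unfolding consec_def by force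
  then have "{i<..B} = {hi i<..B} \<union> {i<..hi i}" using lo_hi[of i] by auto
  moreover have "wmatch wt ({hi i<..B} \<union> {i<..hi i}) (sectors (lo i) B) = wmatch wt {i<..hi i} (sectors (lo i) (hi i))"
    using assms by (intro wmatch_sectors_right) auto
  ultimately show ?thesis using wmatch_sector(2)[OF lo_hi(1), of i i] lo_hi[of i] by (simp add: X_def)
qed

text \<open>The sectors on either side of the one containing \<open>i\<close> are exhausted in
  exactly one way, so the count does not depend on the strip.\<close>

lemma wmatch_sectors_without:
  assumes "A \<in> K" "B \<in> K" "A \<le> i" "i < B"
  shows "wmatch wt ({A..B} - {i}) (sectors A B) = X i"
proof -
  let ?k = "lo i" and ?l = "hi i"
  have l: "?k \<in> K" "?l \<in> K" "A \<le> ?k" "?k \<le> i" "i < ?l" "?l \<le> B"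
    using lo_hi[of i] assms unfolding consec_def by force+
  have I: "{A..B} - {i} = {A..<?k} \<union> ({?k..B} - {i})" "{?k..B} - {i} = {?l<..B} \<union> ({?k..?l} - {i})"
    using l by auto
  note sp = sectors_split[of A ?k B] and e = wmatch_sectors_ends[of A ?k]
  have "wmatch wt ({A..B} - {i}) (sectors A B)
      = wmatch wt {A..<?k} (sectors A ?k) * wmatch wt ({?k..B} - {i}) (sectors A B - sectors A ?k)"
    unfolding I(1) using sp e l assms wt_sectors[of _ ?k B] by (intro wmatch_split) auto
  moreover have "sectors A B - sectors A ?k = sectors ?k B" using sp l by auto
  moreover have "wmatch wt ({?k..B} - {i}) (sectors ?k B) = wmatch wt ({?k..?l} - {i}) (sectors ?k ?l)"
    unfolding I(2) using assms by (intro wmatch_sectors_right) auto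
  ultimately show ?thesis using e l assms wmatch_sector(1)[OF lo_hi(1), of i i] by (simp add: X_def)
qed

text \<open>The vertices strictly between \<open>B\<close> and \<open>C\<close> use up
  \<open>under B C\<close>. Between the two spokes this leaves \<open>Cen B C\<close>, which among
  the remaining vertices only \<open>B\<close> can take: taking it gives \<open>F i B\<close>, not
  taking it gives \<open>X i\<close>.\<close>

lemma F_next_spoke:
  assumes "consec B C" "i < B"
  shows "F i C = F i B + X i"
proof -
  let ?k = "lo i"
  have h: "B \<in> K" "C \<in> K" "B < C" "?k \<in> K" "?k \<le> i" using assms lo_hi[of i] by (auto simp: consec_def)
  have BC: "sectors B C = insert (Cen B C) (under B C)" using sectors_consec assms by simp
  note sp = sectors_split[of ?k B C]
  have nin: "Cen B C \<notin> sectors ?k B" using h by (simp add: Cen_sectors)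
  have "sectors ?k C - under B C = insert (Cen B C) (sectors ?k B)"
    using sp h assms(2) BC under_sectors[of B C] Cen_under[of B C B C] by auto
  moreover have "{i<..<C} = {B<..<C} \<union> {i<..B}" using h assms by auto
  moreover have "wmatch wt ({B<..<C} \<union> {i<..B}) (sectors ?k C)
      = wmatch wt {B<..<C} (under B C) * wmatch wt {i<..B} (sectors ?k C - under B C)"
  proof (intro wmatch_split)
    show "under B C \<subseteq> sectors ?k C" using sp h assms(2) BC by auto
    fix p t assume "p \<in> {B<..<C}" "t \<in> sectors ?k C - under B C"
    then show "wt p t = 0" using sp h assms(2) BC wt_Cen(3)[of p B C] wt_sectors[of t ?k B p] by auto
  qed (use h card_under[OF consec_edge[OF assms(1)]] in auto)
  moreover have "wmatch wt {B<..<C} (under B C) = 1"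
    using F_under[of B C B C] F_edge[of B C] consec_edge[OF assms(1)] h by simp
  moreover have "F i C = wmatch wt {i<..<C} (sectors ?k C)" using h assms by (intro F_sectors) auto
  moreover have "wmatch wt {i<..B} (insert (Cen B C) (sectors ?k B)) = F i B + X i"
  proof -
    have I: "{i<..B} = insert B {i<..<B}" using assms by auto
    have "wmatch wt {i<..B} (insert (Cen B C) (sectors ?k B)) =
      wt B (Cen B C) * wmatch wt {i<..<B} (sectors ?k B) + wmatch wt {i<..B} (sectors ?k B)"
      unfolding I using h nin by (intro wmatch_insert_column) (auto simp: wt_Cen)
    then show ?thesis using wmatch_sectors_after[of B i] F_sectors[of ?k B i B] h assms by (simp add: wt_Cen)
  qed
  ultimately show ?thesis by simp
qed

text \<open>The spoke \<open>B\<close> plays the part of an apex: the products sort the matchings by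
  whether \<open>B\<close> is matched before the spoke, to \<open>Cen B C\<close>, or below the edge
  from \<open>B\<close> to \<open>C\<close>.\<close>

lemma F_across_spoke:
  assumes "consec B C" "i < B" "B \<le> j" "j \<le> C"
  shows "F i j = X i * F B j + F i B * (F B j + F j C)"
proof (cases "j = B")
  case True
  then show ?thesis using F_edge[OF consec_edge[OF assms(1)]] by simp
next
  case False
  let ?k = "lo i" and ?t = "Cen B C"
  have h: "B \<in> K" "C \<in> K" "B < C" "?k \<in> K" "?k \<le> i" using assms lo_hi[of i] by (auto simp: consec_def)
  have E: "E B C" using assms consec_edge by auto
  have BC: "sectors B C = insert ?t (under B C)" using sectors_consec assms by simp
  note sp = sectors_split[of ?k B C]
  have I: "{i<..<j} = insert B ({i<..<B} \<union> {B<..<j})" "insert B {i<..<B} = {i<..B}" "insert B {B<..<j} = {B..<j}"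
    using assms False by auto
  have S: "sectors ?k C = insert ?t (sectors ?k B \<union> under B C)" using sp h assms BC by auto
  have "F i j = wmatch wt (insert B ({i<..<B} \<union> {B<..<j})) (insert ?t (sectors ?k B \<union> under B C))"
    using F_sectors[of ?k C i j] h assms I S by simp
  also have "\<dots> = wmatch wt (insert B {i<..<B}) (sectors ?k B) * wmatch wt {B<..<j} (under B C)
      + wt B ?t * wmatch wt {i<..<B} (sectors ?k B) * wmatch wt {B<..<j} (under B C)
      + wmatch wt {i<..<B} (sectors ?k B) * wmatch wt (insert B {B<..<j}) (under B C)"
  proof (intro wmatch_separated)
    show "?t \<notin> sectors ?k B" using h by (simp add: Cen_sectors)
    show "?t \<notin> under B C" by (simp add: Cen_under)
    show "sectors ?k B \<inter> under B C = {}" using sp h assms under_sectors[of B C] by auto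
    show "wt p s = 0" if "p \<in> {i<..<B}" "s \<in> insert ?t (under B C)" for p s
      using that wt_under[of s B C p] h by (auto simp: wt_Cen)
    show "wt p s = 0" if "p \<in> {B<..<j}" "s \<in> insert ?t (sectors ?k B)" for p s
      using that wt_sectors[of s ?k B p] h assms by (auto simp: wt_Cen)
  qed auto
  also have "\<dots> = X i * F B j + F i B * F B j + F i B * F j C"
    unfolding I(2,3) using wmatch_sectors_after[of B i] wmatch_edge(2)[OF E, of j] F_under[OF E, of B j]
      F_sectors[of ?k B i B] False h assms by (simp add: wt_Cen)
  finally show ?thesis by (simp add: algebra_simps)
qed

section \<open>Matching numbers as determinants\<close>

definition rank :: "int \<Rightarrow> int" where
  "rank i = int (card (K \<inter> {0<..i})) - int (card (K \<inter> {i<..0}))"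

lemma rank_diff: assumes "i \<le> j" shows "rank j - rank i = int (card (K \<inter> {i<..j}))"
proof -
  have *: "card (K \<inter> {x<..z}) = card (K \<inter> {x<..y}) + card (K \<inter> {y<..z})" if "x \<le> y" "y \<le> z" for x y z
  proof -
    have "K \<inter> {x<..z} = (K \<inter> {x<..y}) \<union> (K \<inter> {y<..z})" using that by auto
    then show ?thesis by (simp add: card_Un_disjoint disjoint_iff)
  qed
  consider "0 \<le> i" | "i < 0" "0 \<le> j" | "j < 0" by linarith
  then show ?thesis
  proof cases
    case 1
    then show ?thesis using *[of 0 i j] assms by (simp add: rank_def)
  next
    case 2
    then show ?thesis using *[of i 0 j] assms by (simp add: rank_def)
  next
    case 3
    then show ?thesis using *[of i j 0] assms by (simp add: rank_def)
  qed
qed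

lemma rank_sector: assumes "consec B C" "B \<le> j" "j < C" shows "rank j = rank B"
proof -
  have "K \<inter> {B<..j} = {}" using assms unfolding consec_def by fastforce
  then show ?thesis using rank_diff[of B j] assms by simp
qed

lemma rank_next: assumes "consec B C" shows "rank C = rank B + 1"
proof -
  have "K \<inter> {B<..C} = {C}" using assms unfolding consec_def by fastforce
  then show ?thesis using rank_diff[of B C] assms by (simp add: consec_def)
qed

definition spokes :: nat where "spokes = card (K \<inter> {0<..N})"

lemma rank_succ: "rank (x + 1) - rank x = of_bool (x + 1 \<in> K)"
proof -
  have "{x<..x + 1} = {x + 1}" by auto
  then show ?thesis using rank_diff[of x "x + 1"] by simp
qed

lemma card_window: "card (K \<inter> {i<..i + N}) = spokes"
proof -
  have "rank (i + N) - rank i = rank N - rank 0"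
  proof (induction i rule: int_induct[where k = 0])
    case (step1 i)
    then show ?case using rank_succ[of i] rank_succ[of "i + N"] spoke_period[of "i + 1"] by (simp add: algebra_simps)
  next
    case (step2 i)
    then show ?case using rank_succ[of "i - 1"] rank_succ[of "i - 1 + N"] spoke_period[of i] by (simp add: algebra_simps)
  qed simp
  then show ?thesis using rank_diff[of i "i + N"] rank_diff[of 0 N] N_pos by (simp add: spokes_def)
qed

lemma rank_period: "rank (i + N) = rank i + int spokes"
  using rank_diff[of i "i + N"] card_window[of i] N_pos by simp

text \<open>In suitable coordinates the vertex \<open>i\<close> corresponds to the vector \<open>(X i, u i)\<close> and the puncture to
  \<open>(0, 1)\<close>; matching numbers are determinants of these vectors.\<close>

definition u :: "int \<Rightarrow> int" where "u i = int (F (lo i) i) + rank i * int (X i)"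

text \<open>For fixed \<open>i\<close> the values at successive spokes form an arithmetic
  progression with difference \<open>X i\<close>, by \<open>F_next_spoke\<close>. A spoke
  \<open>B\<close> has coordinates \<open>(1, rank B)\<close>, so this is the determinant formula
  for spokes.\<close>

lemma F_spoke:
  assumes "B \<in> K" "i < B"
  shows "int (F i B) = int (X i) * rank B - u i"
  using assms
proof (induction "nat (B - i)" arbitrary: B rule: less_induct)
  case less
  show ?case
  proof (cases "B = hi i")
    case True
    have "rank i = rank (lo i)" "rank (hi i) = rank (lo i) + 1"
      using rank_sector[OF lo_hi(1), of i i] rank_next[OF lo_hi(1), of i] lo_hi(2,3)[of i] by auto
    then show ?thesis unfolding True u_def X_def by (simp add: algebra_simps)
  next
    case False
    define A where "A = lo (B - 1)"
    have A: "consec A (hi (B - 1))" "A < B" "B \<le> hi (B - 1)" "A \<in> K" using lo_hi[of "B - 1"] by (auto simp: A_def)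
    have B: "hi (B - 1) = B" using A less.prems unfolding consec_def by force
    have "hi i < B" using lo_hi[of i] less.prems False unfolding consec_def by force
    then have "i < A" using lo_hi[of i] A B unfolding consec_def by force
    have "int (F i A) = int (X i) * rank A - u i" using less.hyps[of A] A \<open>i < A\<close> by auto
    moreover have "F i B = F i A + X i" using F_next_spoke[of A B i] A B \<open>i < A\<close> by simp
    moreover have "rank B = rank A + 1" using rank_next[of A B] A B by simp
    ultimately show ?thesis by (simp add: algebra_simps)
  qed
qed

lemma F_det:
  assumes "i \<le> j"
  shows "int (F i j) = int (X i) * u j - int (X j) * u i"
proof -
  define B C where "B = lo j" and "C = hi j"
  have BC: "consec B C" "B \<le> j" "j < C" "B \<in> K" using lo_hi[of j] by (auto simp: B_def C_def)
  have Xj: "X j = F B j + F j C" by (simp add: X_def B_def C_def)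
  have uj: "u j = int (F B j) + rank B * int (X j)" using rank_sector[OF BC(1-3)] by (simp add: u_def B_def)
  show ?thesis
  proof (cases "i < B")
    case True
    have "F i j = X i * F B j + F i B * X j"
      unfolding Xj using F_across_spoke[OF BC(1) True BC(2)] BC(3) by simp
    then have "int (F i j) = int (X i) * int (F B j) + int (F i B) * int (X j)" by simp
    then show ?thesis using F_spoke[OF BC(4) True] uj by (simp add: algebra_simps)
  next
    case False
    \<comment> \<open>Both vertices lie in one sector. After expanding \<open>X i\<close> and
      \<open>X j\<close> the determinant is the Ptolemy relation for the edge from \<open>B\<close>
      to \<open>C\<close>.\<close>
    then have "lo i = B" "hi i = C" using consec_unique[OF BC(1), of i] assms BC by auto
    then have Xi: "X i = F B i + F i C" and ui: "u i = int (F B i) + rank B * int (X i)"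
      using rank_sector[OF BC(1), of i] False assms BC by (auto simp: X_def u_def)
    have "int (F i j) = int (F B j) * int (F i C) - int (F B i) * int (F j C)"
      using F_ptolemy[of B C i j] consec_edge[OF BC(1)] False assms BC by (simp flip: of_nat_mult of_nat_add)
    then show ?thesis using Xi Xj ui uj by (simp add: algebra_simps)
  qed
qed

section \<open>Translation by the period and the frieze relations\<close>

lemma finite_incident: "finite {t \<in> all_tris. corners t \<inter> {i<..<j} \<noteq> {}}"
proof (rule finite_subset)
  show "{t \<in> all_tris. corners t \<inter> {i<..<j} \<noteq> {}} \<subseteq> sectors (lo i) (hi j)"
  proof
    fix t assume "t \<in> {t \<in> all_tris. corners t \<inter> {i<..<j} \<noteq> {}}"
    then obtain x where "t \<in> all_tris" "x \<in> corners t" "x \<in> {i<..<j}" by blast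
    then show "t \<in> sectors (lo i) (hi j)" using tri_local_sectors[of t x "lo i" "hi j"] lo_hi[of i] lo_hi[of j] by auto
  qed
qed simp

lemma F_shift: "F (i + m * N) (j + m * N) = F i j"
proof (cases "i < j")
  case True
  let ?g = "\<lambda>p. p + m * N" and ?s = "shift (m * N)"
  let ?D = "{t \<in> all_tris. corners t \<inter> {i<..<j} \<noteq> {}}"
  have c: "corners (?s t) = ?g ` corners t" for t by (cases t) auto
  have ss: "?s (shift (- m * N) t) = t" for t by (cases t) auto
  have "finite ?D" by (rule finite_incident)
  moreover have "{?g i<..<?g j} = ?g ` {i<..<j}"
  proof (intro equalityI subsetI)
    fix x assume "x \<in> {?g i<..<?g j}"
    then have "x - m * N \<in> {i<..<j}" by auto
    then show "x \<in> ?g ` {i<..<j}" using image_eqI[of x ?g "x - m * N"] by simp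
  qed auto
  moreover have "{t \<in> all_tris. corners t \<inter> {?g i<..<?g j} \<noteq> {}} = ?s ` ?D"
  proof (intro equalityI subsetI)
    fix t assume t: "t \<in> {t \<in> all_tris. corners t \<inter> {?g i<..<?g j} \<noteq> {}}"
    obtain t' where t': "t = ?s t'" using ss[of t] by metis
    then have "t' \<in> ?D" using t by (auto simp: c all_tris_shift)
    then show "t \<in> ?s ` ?D" using t' by blast
  next
    fix t assume "t \<in> ?s ` ?D"
    then obtain t' where t': "t = ?s t'" "t' \<in> ?D" by blast
    then obtain x where "x \<in> corners t'" "x \<in> {i<..<j}" by blast
    with t' have "t \<in> all_tris" "?g x \<in> corners t \<inter> {?g i<..<?g j}" by (auto simp: all_tris_shift c)
    then show "t \<in> {t \<in> all_tris. corners t \<inter> {?g i<..<?g j} \<noteq> {}}" by blast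
  qed
  moreover have "inj_on ?s ?D"
  proof (rule inj_onI)
    fix t t' assume "?s t = ?s t'" then show "t = t'" by (cases t; cases t') auto
  qed
  moreover have "wt (?g p) (?s t) = wt p t" for p t by (auto simp: wt_def c)
  ultimately have "wmatch wt {?g i<..<?g j} {t \<in> all_tris. corners t \<inter> {?g i<..<?g j} \<noteq> {}} = wmatch wt {i<..<j} ?D"
    by (simp add: wmatch_image)
  then show ?thesis using True by (simp add: F_def)
qed (simp add: F_def)

lemma X_shift: "X (i + m * N) = X i"
  by (simp add: X_def lo_hi_shift F_shift)

lemma u_period: "u (i + N) = u i + int spokes * int (X i)"
  using lo_hi_shift(1)[of i 1] F_shift[of "lo i" 1 i] X_shift[of i 1] rank_period[of i]
  by (simp add: u_def algebra_simps)

text \<open>The Pluecker relation between two by two determinants, where neighbouring vertices have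
  determinant 1.\<close>

lemma F_frieze:
  assumes "i < j"
  shows "F i j * F (i + 1) (j + 1) = F (i + 1) j * F i (j + 1) + 1"
proof -
  have 1: "int (X i) * u (i + 1) - int (X (i + 1)) * u i = 1" "int (X j) * u (j + 1) - int (X (j + 1)) * u j = 1"
    using F_det[of i "i + 1"] F_det[of j "j + 1"] F_succ by auto
  have "int (F i j) * int (F (i + 1) (j + 1)) - int (F (i + 1) j) * int (F i (j + 1)) =
     (int (X i) * u (i + 1) - int (X (i + 1)) * u i) * (int (X j) * u (j + 1) - int (X (j + 1)) * u j)"
    using assms by (simp add: F_det algebra_simps)
  then have "int (F i j * F (i + 1) (j + 1)) = int (F (i + 1) j * F i (j + 1) + 1)" unfolding 1 by simp
  then show ?thesis by linarith
qed

text \<open>Translation by \<open>N\<close> adds \<open>spokes * X i\<close> times the puncture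
  vector, whose determinant with \<open>i\<close> is \<open>X i\<close>. The value will be read as
  \<open>m_ii * m_i0\<close>.\<close>

lemma F_loop: "F i (i + N) = (spokes * X i) * X i"
proof -
  have "int (F i (i + N)) = int ((spokes * X i) * X i)"
    using F_det[of i "i + N"] X_shift[of i 1] u_period[of i] N_pos by (simp add: algebra_simps)
  then show ?thesis by linarith
qed

text \<open>The same shear of the vector of \<open>i\<close>, measured against \<open>i + 1\<close>;
  the summand 1 is the determinant of these two neighbours.\<close>

lemma F_almost_loop: "(spokes * X i) * X (i + 1) = F (i + 1) (i + N) + 1"
proof -
  have "int (F (i + 1) (i + N)) = int (X (i + 1)) * u i + int (X (i + 1)) * int spokes * int (X i) - int (X i) * u (i + 1)"
    using F_det[of "i + 1" "i + N"] X_shift[of i 1] u_period[of i] N_pos by (simp add: algebra_simps)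
  moreover have "int (X i) * u (i + 1) - int (X (i + 1)) * u i = 1"
    using F_det[of i "i + 1"] F_succ by simp
  ultimately have "int ((spokes * X i) * X (i + 1)) = int (F (i + 1) (i + N) + 1)" by (simp add: algebra_simps)
  then show ?thesis by linarith
qed

text \<open>The integers \<open>A\<close> and \<open>A + N\<close> lie over the same vertex, so the latter stands for both and gets the
  corners of both.\<close>

lemma wmatch_loop:
  assumes "A \<in> K" "A \<le> i" "i < A + N"
    and w: "\<And>p t. w p t = (if p = A + N then wt A t + wt p t else wt p t)"
  shows "wmatch w ({A<..A + N} - {if i = A then A + N else i}) (sectors A (A + N) - {Cen A (hi A)}) = X i"
proof -
  define C Z where "C = hi A" and "Z = A + N"
  have "lo A = A" using lo_hi[of A] assms(1) unfolding consec_def by force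
  then have C: "consec A C" "A < C" "C \<in> K" using lo_hi[of A] by (auto simp: C_def)
  have Z: "Z \<in> K" "A < Z" using assms(1) spoke_period[of A] N_pos by (auto simp: Z_def)
  have CZ: "C \<le> Z" using C Z unfolding consec_def by force
  have E: "E A C" using C consec_edge by auto
  note sp = sectors_split[of A C Z] and cu = card_under[OF E] and e = wmatch_sectors_ends[OF C(3) Z(1) CZ]
  let ?S = "sectors C Z" and ?U = "under A C" and ?D = "sectors A Z - {Cen A C}"
  have D: "?D = ?U \<union> ?S" "?U \<inter> ?S = {}"
    using sp CZ C sectors_consec[OF C(1)] Cen_under[of A C A C] by (auto simp: Cen_sectors)
  have D': "?U \<union> ?S - ?U = ?S" "?U \<union> ?S - ?S = ?U" using D(2) by auto
  have wU: "wt p t = 0" if "t \<in> ?U" "p < A \<or> C < p" for p t using wt_under that by blast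
  have wS: "wt p t = 0" if "t \<in> ?S" "p < C" for p t using wt_sectors that by blast
  have full: "wmatch wt {A<..<C} ?U = 1" using F_under[OF E, of A C] F_edge[OF E] C by simp
  have w': "w p t = wt p t" if "p \<noteq> Z" for p t using that by (simp add: w Z_def)
  consider "i = A" | "A < i" "i < C" | "C \<le> i" using assms by linarith
  then have "wmatch w ({A<..Z} - {if i = A then Z else i}) ?D = X i"
  proof cases
    case 1
    \<comment> \<open>The merged vertex is the omitted one, so only the plain weights occur and both
      blocks are forced.\<close>
    have "wmatch w ({A<..Z} - {Z}) ?D = wmatch wt ({A<..<C} \<union> {C..<Z}) (?U \<union> ?S)"
      using C CZ D by (intro wmatch_cong) (auto simp: w')
    also have "\<dots> = wmatch wt {A<..<C} ?U * wmatch wt {C..<Z} (?U \<union> ?S - ?U)"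
      using cu wS by (intro wmatch_split) auto
    finally show ?thesis using 1 full e X_spoke[OF assms(1)] by (simp add: D')
  next
    case 2
    let ?J = "{A<..<Z} - {i}"
    have J: "{A<..Z} - {i} = insert Z ?J" "insert A ?J = ({A..<C} - {i}) \<union> {C..<Z}"
        "insert Z ?J = {C<..Z} \<union> ({A<..C} - {i})"
      using 2 C CZ Z by auto
    \<comment> \<open>The row of \<open>Z\<close> is split into those of \<open>A\<close> and
      \<open>Z\<close>. As \<open>A\<close> it joins the left block and yields \<open>F i C\<close>;
      as \<open>Z\<close> it joins the right block and leaves \<open>F A i\<close> for the left one.
      The sum is \<open>X i\<close>.\<close>
    have "wmatch w ({A<..Z} - {i}) ?D = wmatch wt (insert A ?J) (?U \<union> ?S) + wmatch wt (insert Z ?J) (?U \<union> ?S)"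
      unfolding J(1) D(1) by (intro wmatch_row_sum) (auto simp: w Z_def)
    also have "wmatch wt (insert A ?J) (?U \<union> ?S) = wmatch wt ({A..<C} - {i}) ?U * wmatch wt {C..<Z} (?U \<union> ?S - ?U)"
      unfolding J(2) using cu wS 2 by (intro wmatch_split) auto
    also have "wmatch wt (insert Z ?J) (?U \<union> ?S) = wmatch wt {C<..Z} ?S * wmatch wt ({A<..C} - {i}) (?U \<union> ?S - ?S)"
      unfolding J(3) using e wU 2 by (intro wmatch_split) auto
    finally show ?thesis using 2 e wmatch_edge(3,4)[OF E, of i] consec_unique[OF C(1), of i] by (simp add: D' X_def)
  next
    case 3
    \<comment> \<open>The vertices strictly between \<open>A\<close> and \<open>C\<close> use up
      \<open>under A C\<close>, which contains all remaining triangles at \<open>A\<close>, so the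
      corners that \<open>Z\<close> inherits from \<open>A\<close> are lost.\<close>
    have "{A<..Z} - {i} = {A<..<C} \<union> ({C..Z} - {i})" using 3 C CZ by auto
    moreover have "wmatch w ({A<..<C} \<union> ({C..Z} - {i})) (?U \<union> ?S) = wmatch w {A<..<C} ?U * wmatch w ({C..Z} - {i}) (?U \<union> ?S - ?U)"
      using cu wS CZ by (intro wmatch_split) (auto simp: w')
    moreover have "wmatch w {A<..<C} ?U = wmatch wt {A<..<C} ?U"
      using CZ by (intro wmatch_cong) (auto simp: w')
    moreover have "wmatch w ({C..Z} - {i}) ?S = wmatch wt ({C..Z} - {i}) ?S"
      using wS C by (intro wmatch_cong) (auto simp: w)
    moreover have "wmatch wt ({C..Z} - {i}) ?S = X i"
      using C Z 3 assms by (intro wmatch_sectors_without) (auto simp: Z_def)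
    ultimately show ?thesis using 3 C full D D' by simp
  qed
  then show ?thesis unfolding Z_def C_def .
qed

end

section \<open>Arcs in the universal cover\<close>

text \<open>The power of \<open>z\<close> with respect to the circle with diameter from
  \<open>a\<close> to \<open>b\<close>: on the upper half plane it is zero on the geodesic and
  negative below it.\<close>

definition Q :: "int \<Rightarrow> int \<Rightarrow> complex \<Rightarrow> real" where
  "Q a b z = (Re z - of_int a) * (Re z - of_int b) + (Im z)\<^sup>2"

lemma Q_dist: "(dist z (of_real ((of_int a + of_int b) / 2)))\<^sup>2 = Q a b z + ((of_int b - of_int a) / 2)\<^sup>2"
  unfolding dist_norm cmod_power2 by (simp add: Q_def power2_eq_square field_simps)

lemma geodesic_Q: "a < b \<Longrightarrow> geodesic a b = {z \<in> upper. Q a b z = 0}"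
  and below_Q: "a < b \<Longrightarrow> below_geodesic a b = {z \<in> upper. Q a b z < 0}"
proof -
  assume "a < b"
  then have r: "0 \<le> (real_of_int b - of_int a) / 2" by simp
  have "dist z (of_real ((of_int a + of_int b) / 2)) = (of_int b - of_int a) / 2 \<longleftrightarrow> Q a b z = 0"
    "dist z (of_real ((of_int a + of_int b) / 2)) < (of_int b - of_int a) / 2 \<longleftrightarrow> Q a b z < 0" for z
    using Q_dist[of z a b] r power2_eq_iff_nonneg[OF zero_le_dist r] power_strict_mono[OF _ zero_le_dist]
      power2_less_imp_less[OF _ r] by (smt (verit, best) pos2)+
  then show "geodesic a b = {z \<in> upper. Q a b z = 0}" "below_geodesic a b = {z \<in> upper. Q a b z < 0}"
    by (auto simp: geodesic_def below_geodesic_def)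
qed

lemma Q_Re_bounds:
  assumes "Q a b z \<le> 0" "a < b" "z \<in> upper"
  shows "of_int a < Re z" "Re z < of_int b"
proof -
  have "(Re z - of_int a) * (Re z - of_int b) < 0"
    using assms by (auto simp: Q_def upper_def intro: order_less_le_trans[OF _ assms(1)[unfolded Q_def]])
  then show "of_int a < Re z" "Re z < of_int b" using assms(2)
    by (auto simp: mult_less_0_iff)
qed

lemma Q_shift: "Q (a + m) (b + m) (z + of_int m) = Q a b z"
  by (simp add: Q_def)

lemma upper_shift [simp]: "z + of_int m \<in> upper \<longleftrightarrow> z \<in> upper"
  by (simp add: upper_def)

text \<open>The difference of the two powers is a sum of two products of nonnegative
  factors.\<close>

lemma Q_nested:
  assumes "a \<le> c" "d \<le> b" "of_int c < Re z" "Re z < of_int d"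
  shows "Q a b z \<le> Q c d z" "(a, b) \<noteq> (c, d) \<Longrightarrow> Q a b z < Q c d z"
proof -
  have "Q c d z - Q a b z = (of_int c - of_int a) * (of_int d - Re z) + (of_int b - of_int d) * (Re z - of_int a)"
    by (simp add: Q_def algebra_simps)
  moreover have "0 \<le> (real_of_int c - of_int a) * (of_int d - Re z)" "0 \<le> (real_of_int b - of_int d) * (Re z - of_int a)"
    using assms by auto
  moreover have "0 < (real_of_int c - of_int a) * (of_int d - Re z) \<or> 0 < (real_of_int b - of_int d) * (Re z - of_int a)"
    if "(a, b) \<noteq> (c, d)" using assms that by (auto intro!: mult_pos_pos)
  ultimately show "Q a b z \<le> Q c d z" "(a, b) \<noteq> (c, d) \<Longrightarrow> Q a b z < Q c d z" by linarith+
qed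

lemma geodesic_meet:
  assumes "a < b" "c < d" "z \<in> geodesic a b" "z \<in> geodesic c d"
  shows "(a = c \<and> b = d) \<or> (a < c \<and> c < b \<and> b < d) \<or> (c < a \<and> a < d \<and> d < b)"
proof -
  have z: "z \<in> upper" "Q a b z = 0" "Q c d z = 0" using assms by (auto simp: geodesic_Q)
  have re: "of_int a < Re z" "Re z < of_int b" "of_int c < Re z" "Re z < of_int d"
    using Q_Re_bounds[of a b z] Q_Re_bounds[of c d z] z assms by auto
  then have "a < d" "c < b" by linarith+
  moreover have "(a = c \<and> b = d)" if "a \<le> c" "d \<le> b" using Q_nested(2)[of a c d b z] that re z by auto
  moreover have "(a = c \<and> b = d)" if "c \<le> a" "b \<le> d" using Q_nested(2)[of c a b d z] that re z by auto
  ultimately show ?thesis by linarith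
qed

lemma geodesic_cross:
  assumes "a < c" "c < b" "b < d"
  shows "\<exists>z. z \<in> geodesic a b \<and> z \<in> geodesic c d"
proof -
  define s where "s = real_of_int (c + d - a - b)"
  \<comment> \<open>\<open>Q c d - Q a b\<close> depends on \<open>Re z\<close> only, so the radical
    axis of the two circles is vertical; \<open>x\<close> is its abscissa, and the crossing point
    lies on it.\<close>
  define x where "x = real_of_int (c * d - a * b) / s"
  have s: "s > 0" using assms by (simp add: s_def)
  have xs: "x * s = of_int (c * d - a * b)" using s by (simp add: x_def)
  have "(x - of_int a) * s = of_int ((c - a) * (d - a))" "(of_int b - x) * s = of_int ((b - c) * (d - b))"
    unfolding left_diff_distrib xs by (simp_all add: s_def algebra_simps)
  then have "0 < (x - of_int a) * s" "0 < (of_int b - x) * s" using assms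
    by (simp_all only: of_int_0_less_iff) (simp_all add: zero_less_mult_iff)
  then have x: "of_int a < x" "x < of_int b" using s by (simp_all add: zero_less_mult_iff)
  define y where "y = sqrt ((x - of_int a) * (of_int b - x))"
  have y: "y > 0" "y\<^sup>2 = (x - of_int a) * (of_int b - x)" using x by (auto simp: y_def)
  have "Q a b (Complex x y) = 0" using y by (simp add: Q_def algebra_simps)
  moreover have "Q c d (Complex x y) = Q a b (Complex x y) - (x * s - of_int (c * d - a * b))"
    by (simp add: Q_def s_def algebra_simps)
  ultimately show ?thesis using y assms xs
    by (intro exI[of _ "Complex x y"]) (auto simp: geodesic_Q upper_def)
qed

definition vline :: "int \<Rightarrow> complex set" where
  "vline k = {z \<in> upper. Re z = of_int k}"

lemma vline_cross: "a < k \<Longrightarrow> k < b \<Longrightarrow> \<exists>z. z \<in> geodesic a b \<and> z \<in> vline k"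
proof -
  assume k: "a < k" "k < b"
  let ?y = "sqrt ((of_int k - of_int a) * (of_int b - of_int k))"
  have "?y > 0" "?y\<^sup>2 = (of_int k - of_int a) * (of_int b - of_int k)" using k by auto
  then show ?thesis using k
    by (intro exI[of _ "Complex (of_int k) ?y"]) (simp add: geodesic_Q vline_def upper_def Q_def algebra_simps)
qed

lemma vline_meet: "a < b \<Longrightarrow> z \<in> geodesic a b \<Longrightarrow> z \<in> vline k \<Longrightarrow> a < k \<and> k < b"
  using Q_Re_bounds[of a b z] by (auto simp: geodesic_Q vline_def)

text \<open>Clockwise labelling makes the covering antiholomorphic, hence the conjugate. This form
  gives access to the results on the complex exponential.\<close>

lemma cover_exp: "cover N z = exp (- (of_real (2 * pi / real N) * \<i> * cnj z))"
  by (simp add: cover_def complex_eq_iff Re_exp Im_exp)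

lemma norm_cover: "norm (cover N z) = exp (- 2 * pi * Im z / real N)"
  by (simp add: cover_def)

lemma continuous_on_cover: "continuous_on A (cover N)"
  unfolding cover_exp[abs_def] by (intro continuous_intros)

lemma cover_surj_exp:
  assumes "N > 0"
  shows "- (of_real (2 * pi / real N) * \<i> * cnj (- \<i> * cnj w * of_real (real N / (2 * pi)))) = w"
  using assms by (simp add: complex_eq_iff)

text \<open>Up to a real linear bijection the map is \<open>exp\<close>, which is open as a covering
  of the punctured plane.\<close>

lemma open_cover_image:
  assumes "N > 0" "open U"
  shows "open (cover N ` U)"
proof -
  let ?f = "\<lambda>z. - (of_real (2 * pi / real N) * \<i> * cnj z)" and ?g = "\<lambda>w. - \<i> * cnj w * of_real (real N / (2 * pi))"
  have fg: "?f (?g w) = w" for w by (rule cover_surj_exp[OF assms(1)])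
  have gf: "?g (?f z) = z" for z using assms by (simp add: complex_eq_iff)
  have "?f ` U = ?g -` U"
  proof (intro equalityI subsetI)
    fix w assume "w \<in> ?g -` U"
    then have "?g w \<in> U" by simp
    then show "w \<in> ?f ` U" using fg[of w] by (metis (no_types, lifting) image_eqI)
  next
    fix w assume "w \<in> ?f ` U"
    then obtain z where "z \<in> U" "w = ?f z" by blast
    then show "w \<in> ?g -` U" using gf[of z] by (simp only: vimage_eq)
  qed
  moreover have "open (?g -` U)" using assms(2) by (intro open_vimage continuous_intros)
  ultimately have "open (?f ` U)" by simp
  then have "openin (top_of_set (- {0})) (exp ` (?f ` U))"
    by (intro covering_space_open_map[OF covering_space_exp_punctured_plane]) simp
  then have "open (exp ` (?f ` U))" by (meson open_Compl closed_singleton openin_open_eq)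
  moreover have "cover N ` U = exp ` (?f ` U)" unfolding image_image cover_exp[abs_def] ..
  ultimately show ?thesis by simp
qed

lemma cover_eq_iff:
  assumes "N > 0"
  shows "cover N z = cover N w \<longleftrightarrow> (\<exists>m. z = w + of_int (m * int N))"
proof
  assume "cover N z = cover N w"
  then obtain n :: int where n: "- (of_real (2 * pi / real N) * \<i> * cnj z)
      = - (of_real (2 * pi / real N) * \<i> * cnj w) + (of_int (2 * n) * pi) * \<i>"
    unfolding cover_exp exp_eq by blast
  have "z = w + of_int (- n * int N)"
  proof (rule complex_eqI)
    have "pi * (Re z + of_int n * real N) = pi * Re w" using arg_cong[OF n, of Im] assms by (simp add: field_simps)
    then show "Re z = Re (w + of_int (- n * int N))" by simp
    show "Im z = Im (w + of_int (- n * int N))" using arg_cong[OF n, of Re] assms by (simp add: field_simps)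
  qed
  then show "\<exists>m. z = w + of_int (m * int N)" by blast
next
  assume "\<exists>m. z = w + of_int (m * int N)"
  then obtain m where m: "z = w + of_int (m * int N)" by blast
  have "- (of_real (2 * pi / real N) * \<i> * cnj z)
      = - (of_real (2 * pi / real N) * \<i> * cnj w) + (of_int (2 * (- m)) * pi) * \<i>"
    using assms unfolding m by (simp add: complex_eq_iff field_simps)
  then show "cover N z = cover N w" unfolding cover_exp exp_eq by blast
qed

lemma cover_shift: "N > 0 \<Longrightarrow> cover N (z + of_int (m * int N)) = cover N z"
  by (rule iffD2[OF cover_eq_iff]) blast+

lemma cover_upper:
  assumes "N > 0"
  shows "cover N ` upper = ball 0 1 - {0}"
proof (intro equalityI subsetI)
  fix p assume "p \<in> cover N ` upper"
  then obtain z where z: "z \<in> upper" "p = cover N z" by blast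
  have "norm p < 1" unfolding z norm_cover using z assms by (simp add: upper_def)
  moreover have "p \<noteq> 0" unfolding z cover_exp by simp
  ultimately show "p \<in> ball 0 1 - {0}" by simp
next
  fix p :: complex assume p: "p \<in> ball 0 1 - {0}"
  then obtain w where w: "p = exp w" using exp_Ln by (metis DiffD2 singletonI)
  let ?z = "- \<i> * cnj w * of_real (real N / (2 * pi))"
  have c: "cover N ?z = p" unfolding cover_exp cover_surj_exp[OF assms] w ..
  have "Re w < 0" using p unfolding w by simp
  then have "?z \<in> upper" using assms by (simp add: upper_def divide_neg_pos mult_neg_pos)
  then show "p \<in> cover N ` upper" using c by blast
qed

lemma central_arc_cover:
  assumes "N > 0"
  shows "central_arc N k = cover N ` vline k"
proof -
  have pol: "cover N (Complex (of_int k) y) = exp (- 2 * pi * y / real N) *\<^sub>R vertex N k" for y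
    by (simp add: cover_def vertex_def rcis_def scaleR_conv_of_real)
  have v0: "vertex N k \<noteq> 0" by (simp add: vertex_def cover_exp)
  show ?thesis
  proof (intro equalityI subsetI)
    fix p assume "p \<in> central_arc N k"
    then obtain s where s: "0 < s" "s < 1" "p = (1 - s) *\<^sub>R vertex N k"
      by (auto simp: central_arc_def in_segment)
    \<comment> \<open>The height at which the covering map has modulus \<open>1 - s\<close>.\<close>
    let ?y = "- ln (1 - s) * real N / (2 * pi)"
    have "- 2 * pi * ?y / real N = ln (1 - s)" using assms by (simp add: field_simps)
    then have "cover N (Complex (of_int k) ?y) = p" unfolding pol using s by simp
    moreover have "Complex (of_int k) ?y \<in> vline k" using s assms
      by (simp add: vline_def upper_def divide_neg_pos mult_neg_pos)
    ultimately show "p \<in> cover N ` vline k" by blast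
  next
    fix p assume "p \<in> cover N ` vline k"
    then obtain z where z: "z \<in> upper" "Re z = of_int k" "p = cover N z" by (auto simp: vline_def)
    then have "p = exp (- 2 * pi * Im z / real N) *\<^sub>R vertex N k" using pol[of "Im z"] by (metis complex.collapse)
    moreover have "exp (- 2 * pi * Im z / real N) < 1" using z assms by (simp add: upper_def)
    ultimately show "p \<in> central_arc N k" unfolding central_arc_def in_segment using v0
      by (intro conjI exI[of _ "1 - exp (- 2 * pi * Im z / real N)"]) auto
  qed
qed

lemma geodesic_shift: "a < b \<Longrightarrow> z + of_int m \<in> geodesic (a + m) (b + m) \<longleftrightarrow> z \<in> geodesic a b"
  by (simp add: geodesic_Q Q_shift)

lemma vline_shift: "z + of_int m \<in> vline (k + m) \<longleftrightarrow> z \<in> vline k"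
  by (simp add: vline_def)

lemma cover_image_shift:
  assumes "N > 0" "\<And>z. z + of_int (m * int N) \<in> B \<longleftrightarrow> z \<in> A"
  shows "cover N ` B = cover N ` A"
proof (intro equalityI subsetI)
  fix p assume "p \<in> cover N ` B"
  then obtain z where z: "z \<in> B" "p = cover N z" by blast
  then have "z - of_int (m * int N) \<in> A" using assms(2)[of "z - of_int (m * int N)"] by simp
  moreover have "cover N (z - of_int (m * int N)) = p"
    using cover_shift[OF assms(1), of "z - of_int (m * int N)" m] z by simp
  ultimately show "p \<in> cover N ` A" by blast
next
  fix p assume "p \<in> cover N ` A"
  then obtain z where z: "z \<in> A" "p = cover N z" by blast
  have "z + of_int (m * int N) \<in> B" using z assms(2) by blast
  moreover have "cover N (z + of_int (m * int N)) = p" unfolding z by (rule cover_shift[OF assms(1)])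
  ultimately show "p \<in> cover N ` B" by blast
qed

lemma cover_geodesic_shift:
  "N > 0 \<Longrightarrow> a < b \<Longrightarrow> cover N ` geodesic (a + m * int N) (b + m * int N) = cover N ` geodesic a b"
  by (rule cover_image_shift[OF _ geodesic_shift])

lemma central_arc_shift: "N > 0 \<Longrightarrow> central_arc N (k + m * int N) = central_arc N k"
  using cover_image_shift[of N m "vline (k + m * int N)" "vline k", OF _ vline_shift]
  by (simp add: central_arc_cover)

lemma cover_geodesic_eq:
  assumes "N > 0" "a < b" "c < d" "cover N ` geodesic a b = cover N ` geodesic c d"
  shows "\<exists>m. c = a + m * int N \<and> d = b + m * int N"
proof -
  \<comment> \<open>The highest point of a geodesic: its height is the radius, its abscissa the
    centre. Points with the same image differ by a translation, which preserves heights, so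
    comparing heights both ways equates the radii.\<close>
  define top where "top a b = Complex ((of_int a + of_int b) / 2) ((of_int b - of_int a) / 2)" for a b :: int
  have top: "top a b \<in> geodesic a b" if "a < b" for a b
    using that by (simp add: top_def geodesic_Q upper_def Q_def power2_eq_square field_simps)
  have Im_le: "Im z \<le> (of_int b - of_int a) / 2" "Im z = (of_int b - of_int a) / 2 \<Longrightarrow> Re z = (of_int a + of_int b) / 2"
    if "z \<in> geodesic a b" "a < b" for z a b
  proof -
    have *: "(Im z)\<^sup>2 + (Re z - (of_int a + of_int b) / 2)\<^sup>2 = ((of_int b - of_int a) / 2)\<^sup>2"
      using that by (simp add: geodesic_Q Q_def power2_eq_square field_simps)
    have "(Im z)\<^sup>2 \<le> ((of_int b - of_int a) / 2)\<^sup>2" unfolding *[symmetric] by simp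
    then show "Im z \<le> (of_int b - of_int a) / 2" by (rule power2_le_imp_le) (use that(2) in simp)
    show "Re z = (of_int a + of_int b) / 2" if "Im z = (of_int b - of_int a) / 2" using * unfolding that by simp
  qed
  have lift: "\<exists>m. top a b + of_int (m * int N) \<in> geodesic c d"
    if "a < b" "cover N ` geodesic a b = cover N ` geodesic c d" for a b c d
  proof -
    have "cover N (top a b) \<in> cover N ` geodesic c d" using imageI[OF top[OF that(1)], of "cover N"] unfolding that(2) .
    then obtain z where z: "cover N (top a b) = cover N z" "z \<in> geodesic c d" by (rule imageE)
    then obtain m where "z = top a b + of_int (m * int N)" using cover_eq_iff[OF assms(1), of z "top a b"] by metis
    then show ?thesis using z by blast
  qed
  obtain m where m: "top a b + of_int (m * int N) \<in> geodesic c d" using lift assms by blast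
  obtain m' where m': "top c d + of_int (m' * int N) \<in> geodesic a b" using lift[of c d a b] assms by auto
  have "(of_int b - real_of_int a) / 2 \<le> (of_int d - of_int c) / 2" using Im_le(1)[OF m assms(3)] by (simp add: top_def)
  moreover have "(of_int d - real_of_int c) / 2 \<le> (of_int b - of_int a) / 2" using Im_le(1)[OF m' assms(2)] by (simp add: top_def)
  ultimately have r: "(of_int b - real_of_int a) / 2 = (of_int d - of_int c) / 2" by linarith
  then have "real_of_int (b - a) = of_int (d - c)" by simp
  then have 1: "b - a = d - c" by (simp only: of_int_eq_iff)
  have "Re (top a b + of_int (m * int N)) = (of_int c + of_int d) / 2"
    using r by (intro Im_le(2)[OF m assms(3)]) (simp add: top_def)
  then have "real_of_int (a + b + 2 * (m * int N)) = of_int (c + d)" by (simp add: top_def field_simps)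
  then have "a + b + 2 * (m * int N) = c + d" by (simp only: of_int_eq_iff)
  with 1 have "c = a + m * int N \<and> d = b + m * int N" by linarith
  then show ?thesis ..
qed

lemma cover_geodesic_neq_central:
  assumes "N > 0" "a < b"
  shows "cover N ` geodesic a b \<noteq> central_arc N k"
proof
  assume eq: "cover N ` geodesic a b = central_arc N k"
  \<comment> \<open>A vertical line reaches every height, whereas the geodesic stays below height
    \<open>b - a\<close>.\<close>
  let ?z = "Complex (of_int k) (of_int b - of_int a)"
  have "?z \<in> vline k" using assms by (simp add: vline_def upper_def)
  then have "cover N ?z \<in> cover N ` geodesic a b" unfolding eq central_arc_cover[OF assms(1)] by blast
  then obtain w where w: "w \<in> geodesic a b" "cover N ?z = cover N w" by blast
  then obtain m where m: "?z = w + of_int (m * int N)" using cover_eq_iff[OF assms(1)] by blast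
  have Im: "Im w = of_int b - of_int a" using arg_cong[OF m, of Im] by simp
  have "w \<in> upper" "Q a b w = 0" using w assms by (auto simp: geodesic_Q)
  then have "of_int a < Re w" "Re w < of_int b" using Q_Re_bounds[of a b w] assms by auto
  then have "(Re w - of_int a) * (of_int b - Re w) < (of_int b - of_int a) * (of_int b - of_int a)"
    by (intro mult_strict_mono) auto
  then show False using \<open>Q a b w = 0\<close> unfolding Q_def Im power2_eq_square by (simp add: algebra_simps)
qed

lemma cw_bounds: "N > 0 \<Longrightarrow> i < cw N i j \<and> cw N i j \<le> i + int N"
proof -
  assume "N > 0"
  then have "0 \<le> (j - i - 1) mod int N" "(j - i - 1) mod int N < int N" by auto
  then show ?thesis unfolding cw_def by linarith
qed

lemma cw_self: "a < b \<Longrightarrow> b \<le> a + int N \<Longrightarrow> cw N a b = b"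
  by (simp add: cw_def mod_pos_pos_trivial)

lemma cw_succ_iff: "cw N i j = i + 1 \<longleftrightarrow> [j = i + 1] (mod int N)"
  by (auto simp: cw_def cong_iff_dvd_diff dvd_eq_mod_eq_0 algebra_simps)

lemma arcs_eq:
  assumes "N > 0"
  shows "arcs N = {cover N ` geodesic a b |a b. a + 2 \<le> b \<and> b \<le> a + int N} \<union> range (central_arc N)"
proof -
  have "{peripheral_arc N i j |i j. \<not> [j = i + 1] (mod int N)}
      = {cover N ` geodesic a b |a b. a + 2 \<le> b \<and> b \<le> a + int N}"
  proof (intro equalityI subsetI)
    fix A assume "A \<in> {peripheral_arc N i j |i j. \<not> [j = i + 1] (mod int N)}"
    then obtain i j where "A = cover N ` geodesic i (cw N i j)" "cw N i j \<noteq> i + 1"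
      unfolding peripheral_arc_def cw_succ_iff by blast
    moreover from this have "i + 2 \<le> cw N i j" "cw N i j \<le> i + int N" using cw_bounds[OF assms, of i j] by auto
    ultimately show "A \<in> {cover N ` geodesic a b |a b. a + 2 \<le> b \<and> b \<le> a + int N}" by blast
  next
    fix A assume "A \<in> {cover N ` geodesic a b |a b. a + 2 \<le> b \<and> b \<le> a + int N}"
    then obtain a b where ab: "A = cover N ` geodesic a b" "a + 2 \<le> b" "b \<le> a + int N" by blast
    then have "cw N a b = b" by (intro cw_self) auto
    then have "A = peripheral_arc N a b" "\<not> [b = a + 1] (mod int N)"
      using ab cw_succ_iff[of N a b] by (auto simp: peripheral_arc_def)
    then show "A \<in> {peripheral_arc N i j |i j. \<not> [j = i + 1] (mod int N)}" by blast
  qed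
  then show ?thesis by (simp only: arcs_def)
qed

section \<open>The lift of a triangulation of the punctured disc\<close>

locale punctured_triangulation =
  fixes N :: nat and T :: "complex set set"
  assumes N_ge: "N \<ge> 3" and triangulation: "disc_triangulation N T"
begin

lemma N_gt: "N > 0" using N_ge by simp

text \<open>The boundary sides are added because no arc lies over them; they end the recursion over
  apexes.\<close>

definition edge :: "int \<Rightarrow> int \<Rightarrow> bool" where
  "edge a b \<longleftrightarrow> b = a + 1 \<or> a + 2 \<le> b \<and> b \<le> a + int N \<and> cover N ` geodesic a b \<in> T"

definition spoke :: "int set" where
  "spoke = {k. central_arc N k \<in> T}"

lemma T_arcs: "T \<subseteq> arcs N" and T_disjoint: "A \<in> T \<Longrightarrow> B \<in> T \<Longrightarrow> A \<noteq> B \<Longrightarrow> A \<inter> B = {}"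
  using triangulation by (auto simp: disc_triangulation_def noncrossing_def pairwise_def disjnt_def)

text \<open>The form in which maximality is used: adding an arc that meets no other member of
  \<open>T\<close> keeps the collection non-crossing.\<close>

lemma T_maximal:
  assumes "A \<in> arcs N" "\<And>B. B \<in> T \<Longrightarrow> A \<inter> B \<noteq> {} \<Longrightarrow> B = A"
  shows "A \<in> T"
proof -
  have "noncrossing N (insert A T)"
    using triangulation assms by (auto simp: disc_triangulation_def noncrossing_def pairwise_insert disjnt_def)
  then have "insert A T = T" using triangulation by (auto simp: disc_triangulation_def)
  then show ?thesis by auto
qed

lemma edge_mult_shift: "edge (a + m * int N) (b + m * int N) \<longleftrightarrow> edge a b"
  using cover_geodesic_shift[OF N_gt, of a b m] by (auto simp: edge_def)

lemma spoke_mult_shift: "k + m * int N \<in> spoke \<longleftrightarrow> k \<in> spoke"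
  by (simp add: spoke_def central_arc_shift N_gt)

lemma T_cases:
  assumes "A \<in> T"
  obtains (peripheral) a b where "a + 2 \<le> b" "edge a b" "A = cover N ` geodesic a b"
    | (central) k where "k \<in> spoke" "A = central_arc N k"
proof -
  have "A \<in> arcs N" using assms T_arcs by blast
  then consider a b where "A = cover N ` geodesic a b" "a + 2 \<le> b" "b \<le> a + int N" | k where "A = central_arc N k"
    unfolding arcs_eq[OF N_gt] by blast
  then show ?thesis using assms that by cases (auto simp: edge_def spoke_def)
qed

lemma meets_lift:
  assumes "cover N ` A \<inter> cover N ` B \<noteq> {}"
  obtains z m where "z \<in> A" "z + of_int (m * int N) \<in> B"
proof -
  obtain z w where zw: "z \<in> A" "w \<in> B" "cover N z = cover N w" using assms by auto
  then obtain m where "w = z + of_int (m * int N)" using cover_eq_iff[OF N_gt] by metis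
  then show ?thesis using that zw by blast
qed

lemma edge_maximal:
  assumes ab: "a < b" "b \<le> a + int N"
    and E: "\<And>c d. edge c d \<Longrightarrow> \<not> (a < c \<and> c < b \<and> b < d) \<and> \<not> (c < a \<and> a < d \<and> d < b)"
    and K: "\<And>k. k \<in> spoke \<Longrightarrow> \<not> (a < k \<and> k < b)"
  shows "edge a b"
proof (cases "b = a + 1")
  case False
  then have ab2: "a + 2 \<le> b" using ab by simp
  have "cover N ` geodesic a b \<in> T"
  proof (rule T_maximal)
    show "cover N ` geodesic a b \<in> arcs N" using ab2 ab arcs_eq[OF N_gt] by blast
    fix B assume B: "B \<in> T" "cover N ` geodesic a b \<inter> B \<noteq> {}"
    from B(1) show "B = cover N ` geodesic a b"
    proof (cases rule: T_cases)
      case (peripheral c d)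
      then obtain z m where z: "z \<in> geodesic c d" "z + of_int (m * int N) \<in> geodesic a b"
        using B(2) meets_lift[of "geodesic c d" "geodesic a b"] by (metis inf_commute)
      let ?c = "c + m * int N" and ?d = "d + m * int N"
      have "z + of_int (m * int N) \<in> geodesic ?c ?d" using z peripheral by (simp only: geodesic_shift)
      then have "(a = ?c \<and> b = ?d) \<or> (a < ?c \<and> ?c < b \<and> b < ?d) \<or> (?c < a \<and> a < ?d \<and> ?d < b)"
        using geodesic_meet[of a b ?c ?d] z peripheral ab by auto
      moreover have "edge ?c ?d" using peripheral by (simp add: edge_mult_shift)
      ultimately have "a = ?c" "b = ?d" using E by blast+
      then show ?thesis using peripheral cover_geodesic_shift[OF N_gt, of c d m] by simp
    next
      case (central k)
      then obtain z m where z: "z \<in> vline k" "z + of_int (m * int N) \<in> geodesic a b"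
        using B(2) meets_lift[of "vline k" "geodesic a b"] central_arc_cover[OF N_gt] by (metis inf_commute)
      then have "z + of_int (m * int N) \<in> vline (k + m * int N)" by (simp only: vline_shift)
      then have "a < k + m * int N \<and> k + m * int N < b" using vline_meet z ab by blast
      moreover have "k + m * int N \<in> spoke" using central by (simp add: spoke_mult_shift)
      ultimately show ?thesis using K by blast
    qed
  qed
  then show ?thesis using ab2 ab by (simp add: edge_def)
qed (simp add: edge_def)

lemma spoke_maximal:
  assumes "\<And>a b. edge a b \<Longrightarrow> \<not> (a < k \<and> k < b)"
  shows "k \<in> spoke"
proof -
  have "central_arc N k \<in> T"
  proof (rule T_maximal)
    show "central_arc N k \<in> arcs N" by (simp add: arcs_def)
    fix B assume B: "B \<in> T" "central_arc N k \<inter> B \<noteq> {}"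
    from B(1) show "B = central_arc N k"
    proof (cases rule: T_cases)
      case (peripheral c d)
      then obtain z m where z: "z \<in> geodesic c d" "z + of_int (m * int N) \<in> vline k"
        using B(2) meets_lift[of "geodesic c d" "vline k"] central_arc_cover[OF N_gt] by (metis inf_commute)
      let ?c = "c + m * int N" and ?d = "d + m * int N"
      have "z + of_int (m * int N) \<in> geodesic ?c ?d" using z peripheral by (simp only: geodesic_shift)
      then have "?c < k \<and> k < ?d" using vline_meet[of ?c ?d _ k] z peripheral by auto
      moreover have "edge ?c ?d" using peripheral by (simp add: edge_mult_shift)
      ultimately show ?thesis using assms by blast
    next
      case (central l)
      then obtain z m where "z \<in> vline l" "z + of_int (m * int N) \<in> vline k"
        using B(2) meets_lift[of "vline l" "vline k"] central_arc_cover[OF N_gt] by (metis inf_commute)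
      then have "real_of_int k = of_int (l + m * int N)" by (simp add: vline_def)
      then have "k = l + m * int N" by linarith
      then show ?thesis using central central_arc_shift[OF N_gt, of l m] by simp
    qed
  qed
  then show ?thesis by (simp add: spoke_def)
qed

lemma edge_not_cross: "edge a b \<Longrightarrow> edge c d \<Longrightarrow> a < c \<Longrightarrow> c < b \<Longrightarrow> b < d \<Longrightarrow> False"
proof -
  assume h: "edge a b" "edge c d" "a < c" "c < b" "b < d"
  then have T: "cover N ` geodesic a b \<in> T" "cover N ` geodesic c d \<in> T" "b \<le> a + int N" by (auto simp: edge_def)
  obtain z where "z \<in> geodesic a b" "z \<in> geodesic c d" using geodesic_cross[OF h(3-5)] by blast
  then have "cover N ` geodesic a b = cover N ` geodesic c d" using T_disjoint[OF T(1,2)] by blast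
  \<comment> \<open>Both lifts belong to the same arc, so the second is a translate of the first by
    a positive multiple of \<open>N\<close>. It would then start no earlier than
    \<open>a + N\<close>, hence not before \<open>b\<close>.\<close>
  then obtain m where m: "c = a + m * int N" using cover_geodesic_eq[OF N_gt, of a b c d] h by auto
  then have "m * int N > 0" using h by simp
  then have "m \<ge> 1" using N_gt by (simp add: zero_less_mult_iff)
  then have "int N \<le> m * int N" by (simp add: mult_le_cancel_right1)
  then show False using m h T by linarith
qed

lemma edge_not_spoke: "edge a b \<Longrightarrow> k \<in> spoke \<Longrightarrow> a < k \<Longrightarrow> k < b \<Longrightarrow> False"
proof -
  assume h: "edge a b" "k \<in> spoke" "a < k" "k < b"
  then have T: "cover N ` geodesic a b \<in> T" "central_arc N k \<in> T" by (auto simp: edge_def spoke_def)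
  obtain z where "z \<in> geodesic a b" "z \<in> vline k" using vline_cross[OF h(3,4)] by blast
  then have "cover N ` geodesic a b \<inter> central_arc N k \<noteq> {}" unfolding central_arc_cover[OF N_gt] by blast
  then show False using T_disjoint[OF T] cover_geodesic_neq_central[OF N_gt, of a b k] h by auto
qed

sublocale lifted_triangulation "int N" edge spoke
proof
  show "int N > 0" using N_gt by simp
  show less: "a < b" if "edge a b" for a b using that by (auto simp: edge_def)
  show succ: "edge a (a + 1)" for a by (simp add: edge_def)
  show False if "edge a b" "edge c d" "a < c" "c < b" "b < d" for a b c d using that edge_not_cross by blast
  show False if "edge a b" "k \<in> spoke" "a < k" "k < b" for a b k using that edge_not_spoke by blast
  show "edge (a + int N) (b + int N) \<longleftrightarrow> edge a b" for a b using edge_mult_shift[of a 1 b] by simp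
  show per: "k + int N \<in> spoke \<longleftrightarrow> k \<in> spoke" for k using spoke_mult_shift[of k 1] by simp
  have len: "b - a \<le> int N" if "edge a b" for a b using that N_gt by (auto simp: edge_def)
  show "spoke \<noteq> {}"
  proof -
    \<comment> \<open>Take an edge of maximal length. No edge passes over its left end
      \<open>a\<close>: it would cross this edge or be longer. So the central arc at
      \<open>a\<close> crosses nothing.\<close>
    have "edge (fst (0, 1)) (snd (0, 1))" using succ[of 0] by simp
    moreover have "\<forall>q. edge (fst q) (snd q) \<longrightarrow> nat (snd q - fst q) < Suc N" using len by fastforce
    ultimately have "\<exists>p. edge (fst p) (snd p) \<and> (\<forall>q. edge (fst q) (snd q) \<longrightarrow> nat (snd q - fst q) \<le> nat (snd p - fst p))"
      by (rule ex_has_greatest_nat[where P = "\<lambda>p. edge (fst p) (snd p)" and f = "\<lambda>p. nat (snd p - fst p)"])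
    then obtain a b where ab: "edge a b" "\<And>c d. edge c d \<Longrightarrow> nat (d - c) \<le> nat (b - a)" by fastforce
    have "a \<in> spoke"
    proof (rule spoke_maximal)
      fix c d assume cd: "edge c d"
      show "\<not> (c < a \<and> a < d)"
      proof
        assume "c < a \<and> a < d"
        then show False using ab(2)[OF cd] edge_not_cross[OF cd ab(1)] less[OF ab(1)] by (cases "d < b") auto
      qed
    qed
    then show ?thesis by blast
  qed
  show "edge k l" if "k \<in> spoke" "l \<in> spoke" "k < l" "spoke \<inter> {k<..<l} = {}" for k l
  proof (rule edge_maximal)
    \<comment> \<open>\<open>k + int N\<close> is again a spoke and cannot lie strictly between
      \<open>k\<close> and \<open>l\<close>.\<close>
    show "l \<le> k + int N" using that per[of k] N_gt by force
    show "\<not> (k < c \<and> c < l \<and> l < d) \<and> \<not> (c < k \<and> k < d \<and> d < l)" if "edge c d" for c d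
      using edge_not_spoke[OF that] \<open>k \<in> spoke\<close> \<open>l \<in> spoke\<close> by blast
  qed (use that in auto)
  show "\<exists>c. a < c \<and> c < b \<and> edge a c \<and> edge c b" if ab: "edge a b" "a + 2 \<le> b" for a b
  proof -
    \<comment> \<open>The apex is the last vertex before \<open>b\<close> joined to
      \<open>a\<close>. An edge crossing the geodesic from it to \<open>b\<close> would cross one of
      the edges at \<open>a\<close>, or join \<open>a\<close> to a later vertex before
      \<open>b\<close>.\<close>
    define S where "S = {x. a < x \<and> x < b \<and> edge a x}"
    have fin: "finite S" by (rule finite_subset[of _ "{a..b}"]) (auto simp: S_def)
    have "a + 1 \<in> S" using ab succ by (simp add: S_def)
    then have c: "Max S \<in> S" using fin Max_in by blast
    define c where "c = Max S"
    have c: "a < c" "c < b" "edge a c" using c by (auto simp: S_def c_def)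
    have max: "y \<le> c" if "edge a y" "y < b" for y
      using that less Max_ge[OF fin, of y] by (auto simp: S_def c_def)
    have "edge c b"
    proof (rule edge_maximal)
      show "b \<le> c + int N" using len[OF ab(1)] c by simp
      show "\<not> (c < k \<and> k < b)" if "k \<in> spoke" for k using edge_not_spoke[OF ab(1) that] c by auto
      fix x y assume xy: "edge x y"
      show "\<not> (c < x \<and> x < b \<and> b < y) \<and> \<not> (x < c \<and> c < y \<and> y < b)"
        using edge_not_cross[OF ab(1) xy] edge_not_cross[OF xy ab(1)] edge_not_cross[OF c(3) xy] max[of y] xy c
        by (metis linorder_less_linear order_less_le_trans order_less_trans not_less)
    qed (use c in auto)
    then show ?thesis using c by blast
  qed
qed

end

section \<open>The regions of the triangulation\<close>

text \<open>The condition for a side of length 1 is dropped: no arc separates the triangle from the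
  points below such a side, so the region extends to the boundary.\<close>

fun reg :: "tri \<Rightarrow> complex set" where
  "reg (Tri a c b) = {z \<in> upper. Q a b z < 0 \<and> (c = a + 1 \<or> 0 < Q a c z) \<and> (b = c + 1 \<or> 0 < Q c b z)}"
| "reg (Cen k l) = {z \<in> upper. of_int k < Re z \<and> Re z < of_int l \<and> (l = k + 1 \<or> 0 < Q k l z)}"

lemma reg_upper: "reg t \<subseteq> upper"
  by (cases t) auto

lemma continuous_on_Q: "continuous_on A (Q a b)"
  unfolding Q_def[abs_def] by (intro continuous_intros)

lemma open_upper: "open upper"
  unfolding upper_def by (intro open_Collect_less continuous_intros)

lemma open_reg: "open (reg t)"
  by (cases t) (auto simp: upper_def intro!: open_Collect_conj open_Collect_disj open_Collect_less continuous_intros continuous_on_Q)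

section \<open>Hyperbolic convexity\<close>

definition hconvex :: "complex set \<Rightarrow> bool" where
  "hconvex S \<longleftrightarrow> (\<exists>C. convex C \<and> S = {z \<in> upper. (Re z, (Re z)\<^sup>2 + (Im z)\<^sup>2) \<in> C})"

lemma hconvex_Int:
  assumes "hconvex S" "hconvex S'" shows "hconvex (S \<inter> S')"
proof -
  obtain C C' where "convex C" "convex C'" "S = {z \<in> upper. (Re z, (Re z)\<^sup>2 + (Im z)\<^sup>2) \<in> C}"
    "S' = {z \<in> upper. (Re z, (Re z)\<^sup>2 + (Im z)\<^sup>2) \<in> C'}" using assms unfolding hconvex_def by blast
  then show ?thesis unfolding hconvex_def by (intro exI[of _ "C \<inter> C'"]) (auto intro: convex_Int)
qed

lemma hconvex_halfplane: "hconvex {z \<in> upper. \<alpha> * Re z + \<beta> * ((Re z)\<^sup>2 + (Im z)\<^sup>2) < \<gamma>}"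
  unfolding hconvex_def
  by (intro exI[of _ "{p. inner (\<alpha>, \<beta>) p < \<gamma>}"] conjI convex_halfspace_lt) (simp add: inner_prod_def)

lemma hconvex_upper: "hconvex upper"
  unfolding hconvex_def by (intro exI[of _ UNIV]) auto

text \<open>\<open>Q a b z\<close> equals \<open>|z|^2 - (a + b) * Re z + a * b\<close>, which is
  affine in \<open>Re z\<close> and \<open>|z|^2\<close>.\<close>

lemma hconvex_Q: "hconvex {z \<in> upper. Q a b z < 0}" "hconvex {z \<in> upper. 0 < Q a b z}"
proof -
  have "{z \<in> upper. Q a b z < 0} = {z \<in> upper. - of_int (a + b) * Re z + 1 * ((Re z)\<^sup>2 + (Im z)\<^sup>2) < - of_int (a * b)}"
    by (auto simp: Q_def power2_eq_square algebra_simps)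
  then show "hconvex {z \<in> upper. Q a b z < 0}" using hconvex_halfplane by presburger
  have "{z \<in> upper. 0 < Q a b z} = {z \<in> upper. of_int (a + b) * Re z + (- 1) * ((Re z)\<^sup>2 + (Im z)\<^sup>2) < of_int (a * b)}"
    by (auto simp: Q_def power2_eq_square algebra_simps)
  then show "hconvex {z \<in> upper. 0 < Q a b z}" using hconvex_halfplane by presburger
qed

text \<open>The map \<open>z \<mapsto> (Re z, \<bar>z\<bar>\<^sup>2)\<close> sends the upper half plane onto the epigraph of a parabola and geodesics to
  straight lines, so hyperbolic convexity becomes Euclidean convexity.\<close>

lemma hconvex_connected:
  assumes "hconvex S" shows "connected S"
proof -
  obtain C where C: "convex C" "S = {z \<in> upper. (Re z, (Re z)\<^sup>2 + (Im z)\<^sup>2) \<in> C}"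
    using assms unfolding hconvex_def by blast
  let ?P = "{p :: real \<times> real. (fst p)\<^sup>2 < snd p}"
  let ?g = "\<lambda>p. Complex (fst p) (sqrt (snd p - (fst p)\<^sup>2))"
  have "convex ?P"
  proof (rule convexI)
    fix p q :: "real \<times> real" and s t :: real
    assume *: "p \<in> ?P" "q \<in> ?P" "0 \<le> s" "0 \<le> t" "s + t = 1"
    have s: "s = 1 - t" using * by simp
    have "(s * fst p + t * fst q)\<^sup>2 = s * (fst p)\<^sup>2 + t * (fst q)\<^sup>2 - s * t * (fst p - fst q)\<^sup>2"
      unfolding s by (simp add: power2_eq_square algebra_simps)
    also have "\<dots> \<le> s * (fst p)\<^sup>2 + t * (fst q)\<^sup>2" using * by simp
    also have "\<dots> < s * snd p + t * snd q"
    proof (cases "s = 0")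
      case False
      then have "s * (fst p)\<^sup>2 < s * snd p" "t * (fst q)\<^sup>2 \<le> t * snd q"
        using * by (auto intro: mult_left_mono)
      then show ?thesis by linarith
    qed (use * in auto)
    finally show "s *\<^sub>R p + t *\<^sub>R q \<in> ?P" by simp
  qed
  then have "connected (C \<inter> ?P)" using C by (intro convex_connected convex_Int)
  moreover have "continuous_on (C \<inter> ?P) ?g" by (intro continuous_intros)
  ultimately have "connected (?g ` (C \<inter> ?P))" by (rule connected_continuous_image[rotated])
  moreover have "?g ` (C \<inter> ?P) = S"
  proof (intro equalityI subsetI)
    fix z assume z: "z \<in> S"
    let ?p = "(Re z, (Re z)\<^sup>2 + (Im z)\<^sup>2)"
    have "?p \<in> C \<inter> ?P" "?g ?p = z" using z C(2) by (auto simp: upper_def complex_eq_iff)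
    then show "z \<in> ?g ` (C \<inter> ?P)" by (metis (no_types, lifting) image_eqI)
  next
    fix z assume "z \<in> ?g ` (C \<inter> ?P)"
    then obtain p where "p \<in> C" "p \<in> ?P" "z = ?g p" by blast
    then show "z \<in> S" unfolding C(2) by (auto simp: upper_def)
  qed
  ultimately show ?thesis by simp
qed

lemma hconvex_reg: "hconvex (reg t)"
proof (cases t)
  case (Tri a c b)
  have side: "hconvex {z \<in> upper. P \<or> 0 < Q x y z}" for P x y
    using hconvex_Q(2)[of x y] hconvex_upper by (cases P) auto
  have "reg t = {z \<in> upper. Q a b z < 0} \<inter> ({z \<in> upper. c = a + 1 \<or> 0 < Q a c z} \<inter> {z \<in> upper. b = c + 1 \<or> 0 < Q c b z})"
    unfolding Tri by auto
  then show ?thesis by (simp only: hconvex_Int side hconvex_Q)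
next
  case (Cen k l)
  have side: "hconvex {z \<in> upper. P \<or> 0 < Q x y z}" for P x y
    using hconvex_Q(2)[of x y] hconvex_upper by (cases P) auto
  have re: "hconvex {z \<in> upper. of_int k < Re z}" "hconvex {z \<in> upper. Re z < of_int l}"
    using hconvex_halfplane[of "- 1" 0 "- of_int k"] hconvex_halfplane[of 1 0 "of_int l"] by simp_all
  have "reg t = {z \<in> upper. of_int k < Re z} \<inter> ({z \<in> upper. Re z < of_int l} \<inter> {z \<in> upper. l = k + 1 \<or> 0 < Q k l z})"
    unfolding Cen by auto
  then show ?thesis by (simp only: hconvex_Int side re)
qed

lemma reg_shift: "z + of_int m \<in> reg (shift m t) \<longleftrightarrow> z \<in> reg t"
  by (cases t) (auto simp: Q_shift)

lemma shift_shift: "shift m (shift n t) = shift (m + n) t" "shift 0 t = t"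
  by (cases t; simp)+

section \<open>Integer corners as closure points\<close>

lemma closure_Q_nonneg: "z \<in> closure S \<Longrightarrow> (\<And>z. z \<in> S \<Longrightarrow> 0 \<le> Q a b z) \<Longrightarrow> 0 \<le> Q a b z"
proof -
  assume *: "z \<in> closure S" "\<And>z. z \<in> S \<Longrightarrow> 0 \<le> Q a b z"
  have "closure S \<subseteq> {z. 0 \<le> Q a b z}"
    using * by (intro closure_minimal closed_Collect_le continuous_intros continuous_on_Q) auto
  then show ?thesis using * by auto
qed

lemma closure_Q_nonpos: "z \<in> closure S \<Longrightarrow> (\<And>z. z \<in> S \<Longrightarrow> Q a b z \<le> 0) \<Longrightarrow> Q a b z \<le> 0"
proof -
  assume *: "z \<in> closure S" "\<And>z. z \<in> S \<Longrightarrow> Q a b z \<le> 0"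
  have "closure S \<subseteq> {z. Q a b z \<le> 0}"
    using * by (intro closure_minimal closed_Collect_le continuous_intros continuous_on_Q) auto
  then show ?thesis using * by auto
qed

lemma closure_strip:
  assumes "z \<in> closure S" "\<And>z. z \<in> S \<Longrightarrow> a < Re z \<and> Re z < b"
  shows "a \<le> Re z \<and> Re z \<le> b"
proof -
  have "closure S \<subseteq> {z. a \<le> Re z \<and> Re z \<le> b}"
    using assms by (intro closure_minimal closed_Collect_conj closed_Collect_le continuous_intros) force+
  then show ?thesis using assms by auto
qed

lemma Q_of_int: "Q a b (of_int x) = of_int ((x - a) * (x - b))"
  by (simp add: Q_def)

lemma closure_limit:
  assumes "\<And>x. 0 < x \<Longrightarrow> x < 1 \<Longrightarrow> f x \<in> S" "(f \<longlongrightarrow> l) (at_right (0::real))"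
  shows "l \<in> closure S"
proof (rule Lim_in_closed_set[OF closed_closure])
  show "\<forall>\<^sub>F x in at_right 0. f x \<in> closure S"
    unfolding eventually_at_right_field using assms(1) closure_subset by (intro exI[of _ 1]) auto
qed (use assms(2) in auto)

text \<open>The curve runs along the geodesic from \<open>c\<close> to
  \<open>c + \<sigma> * \<mu>\<close>, the sign choosing the side; \<open>\<mu> \<ge> 1\<close>
  keeps it above the real axis for \<open>x < 1\<close>.\<close>

lemma closure_fan:
  assumes "\<mu> \<ge> 1" "\<sigma> = 1 \<or> \<sigma> = - 1"
    and "\<And>x y. 0 < x \<Longrightarrow> x < 1 \<Longrightarrow> 0 < y \<Longrightarrow> x\<^sup>2 + y\<^sup>2 = \<mu> * x \<Longrightarrow> Complex (of_int c + \<sigma> * x) y \<in> S"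
  shows "of_int c \<in> closure S"
proof (rule closure_limit)
  let ?f = "\<lambda>x. Complex (of_int c + \<sigma> * x) (sqrt (\<mu> * x - x\<^sup>2))"
  show "?f x \<in> S" if "0 < x" "x < 1" for x
  proof -
    have "x * x < \<mu> * x" using that assms(1) by (intro mult_strict_right_mono) auto
    then have "0 < \<mu> * x - x\<^sup>2" by (simp add: power2_eq_square)
    then show ?thesis using that by (intro assms(3)) auto
  qed
  have "(?f \<longlongrightarrow> Complex (of_int c + \<sigma> * 0) (sqrt (\<mu> * 0 - 0\<^sup>2))) (at_right 0)"
    by (intro tendsto_intros)
  moreover have "Complex (of_int c + \<sigma> * 0) (sqrt (\<mu> * 0 - 0\<^sup>2)) = of_int c" by (simp add: complex_eq_iff)
  ultimately show "(?f \<longlongrightarrow> of_int c) (at_right 0)" by simp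
qed

lemma corner_closure_Tri:
  assumes "a < c" "c < b"
  shows "of_int a \<in> closure (reg (Tri a c b))" "of_int b \<in> closure (reg (Tri a c b))" "of_int c \<in> closure (reg (Tri a c b))"
proof -
  define A C B where "A = real_of_int a" and "C = real_of_int c" and "B = real_of_int b"
  have ABC: "A + 1 \<le> C" "C + 1 \<le> B" using assms by (auto simp: A_def B_def C_def)
  note d = A_def[symmetric] B_def[symmetric] C_def[symmetric]
  show "of_int a \<in> closure (reg (Tri a c b))"
  \<comment> \<open>The geodesic from \<open>a\<close> to the midpoint of \<open>c\<close> and
    \<open>b\<close> leaves \<open>a\<close> between the sides \<open>a c\<close> and
    \<open>a b\<close>.\<close>
  proof (rule closure_fan[where \<mu> = "(C + B) / 2 - A" and \<sigma> = 1])
    have "A * 2 + 3 \<le> C + B" using ABC by linarith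
    then show "1 \<le> (C + B) / 2 - A" by (simp add: field_simps)
    fix x y :: real assume xy: "0 < x" "x < 1" "0 < y" "x\<^sup>2 + y\<^sup>2 = ((C + B) / 2 - A) * x"
    let ?z = "Complex (of_int a + 1 * x) y"
    have "Q a b ?z = (x\<^sup>2 + y\<^sup>2) - (B - A) * x" by (simp add: Q_def d power2_eq_square algebra_simps)
    also have "\<dots> = - ((B - C) / 2 * x)" unfolding xy by (simp add: field_simps)
    finally have 1: "Q a b ?z < 0" using ABC xy by simp
    have "Q a c ?z = (x\<^sup>2 + y\<^sup>2) - (C - A) * x" by (simp add: Q_def d power2_eq_square algebra_simps)
    also have "\<dots> = (B - C) / 2 * x" unfolding xy by (simp add: field_simps)
    finally have e: "Q a c ?z = (B - C) / 2 * x" .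
    have 2: "0 < Q a c ?z" unfolding e using ABC xy by simp
    have "0 < (A + x - C) * (A + x - B)" using ABC xy by (intro mult_neg_neg) auto
    then have 3: "0 < Q c b ?z" using xy by (simp add: Q_def d add_pos_pos)
    show "?z \<in> reg (Tri a c b)" using 1 2 3 xy by (simp add: upper_def)
  qed simp
  show "of_int b \<in> closure (reg (Tri a c b))"
  proof (rule closure_fan[where \<mu> = "B - (A + C) / 2" and \<sigma> = "- 1"])
    have "A + C + 3 \<le> B * 2" using ABC by linarith
    then show "1 \<le> B - (A + C) / 2" by (simp add: field_simps)
    fix x y :: real assume xy: "0 < x" "x < 1" "0 < y" "x\<^sup>2 + y\<^sup>2 = (B - (A + C) / 2) * x"
    let ?z = "Complex (of_int b + - 1 * x) y"
    have "Q a b ?z = (x\<^sup>2 + y\<^sup>2) - (B - A) * x" by (simp add: Q_def d power2_eq_square algebra_simps)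
    also have "\<dots> = - ((C - A) / 2 * x)" unfolding xy by (simp add: field_simps)
    finally have 1: "Q a b ?z < 0" using ABC xy by simp
    have "Q c b ?z = (x\<^sup>2 + y\<^sup>2) - (B - C) * x" by (simp add: Q_def d power2_eq_square algebra_simps)
    also have "\<dots> = (C - A) / 2 * x" unfolding xy by (simp add: field_simps)
    finally have e: "Q c b ?z = (C - A) / 2 * x" .
    have 2: "0 < Q c b ?z" unfolding e using ABC xy by simp
    have "0 < (B - x - A) * (B - x - C)" using ABC xy by (intro mult_pos_pos) auto
    then have 3: "0 < Q a c ?z" using xy by (simp add: Q_def d add_pos_pos)
    show "?z \<in> reg (Tri a c b)" using 1 2 3 xy by (simp add: upper_def)
  qed simp
  show "of_int c \<in> closure (reg (Tri a c b))"
  \<comment> \<open>Down the vertical line at \<open>c\<close>, which avoids both short sides;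
    \<open>(C - A) * (B - C) \<ge> 1\<close> puts heights less than 1 below the long side.\<close>
  proof (rule closure_limit)
    have "1 \<le> (C - A) * (B - C)" using mult_mono[of 1 "C - A" 1 "B - C"] ABC by simp
    moreover have "y\<^sup>2 < 1" if "0 < y" "y < 1" for y :: real using that by (simp add: power_less_one_iff)
    ultimately have "0 < y \<Longrightarrow> y < 1 \<Longrightarrow> (C - A) * (C - B) + y\<^sup>2 < 0" for y :: real
      by (smt (verit) minus_diff_eq mult_minus_right)
    then show "Complex C y \<in> reg (Tri a c b)" if "0 < y" "y < 1" for y
      using that by (simp add: Q_def d upper_def)
    have "((\<lambda>y. Complex C y) \<longlongrightarrow> Complex C 0) (at_right 0)" by (intro tendsto_intros)
    moreover have "Complex C 0 = of_int c" by (simp add: C_def complex_eq_iff)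
    ultimately show "((\<lambda>y. Complex C y) \<longlongrightarrow> of_int c) (at_right 0)" by simp
  qed
qed

lemma corner_closure_Cen:
  assumes "k < l"
  shows "of_int k \<in> closure (reg (Cen k l))" "of_int l \<in> closure (reg (Cen k l))"
proof -
  define K L where "K = real_of_int k" and "L = real_of_int l"
  have KL: "K + 1 \<le> L" using assms by (auto simp: K_def L_def)
  note d = K_def[symmetric] L_def[symmetric]
  show "of_int k \<in> closure (reg (Cen k l))"
  \<comment> \<open>The geodesic from \<open>k\<close> to \<open>l + 1\<close> runs above the side
    from \<open>k\<close> to \<open>l\<close>.\<close>
  proof (rule closure_fan[where \<mu> = "L - K + 1" and \<sigma> = 1])
    fix x y :: real assume xy: "0 < x" "x < 1" "0 < y" "x\<^sup>2 + y\<^sup>2 = (L - K + 1) * x"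
    let ?z = "Complex (of_int k + 1 * x) y"
    have "Q k l ?z = (x\<^sup>2 + y\<^sup>2) - (L - K) * x" by (simp add: Q_def d power2_eq_square algebra_simps)
    then have "0 < Q k l ?z" unfolding xy using xy by (simp add: algebra_simps)
    then show "?z \<in> reg (Cen k l)" using xy KL by (simp add: upper_def d)
  qed (use KL in auto)
  show "of_int l \<in> closure (reg (Cen k l))"
  proof (rule closure_fan[where \<mu> = "L - K + 1" and \<sigma> = "- 1"])
    fix x y :: real assume xy: "0 < x" "x < 1" "0 < y" "x\<^sup>2 + y\<^sup>2 = (L - K + 1) * x"
    let ?z = "Complex (of_int l + - 1 * x) y"
    have "Q k l ?z = (x\<^sup>2 + y\<^sup>2) - (L - K) * x" by (simp add: Q_def d power2_eq_square algebra_simps)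
    then have "0 < Q k l ?z" unfolding xy using xy by (simp add: algebra_simps)
    then show "?z \<in> reg (Cen k l)" using xy KL by (simp add: upper_def d)
  qed (use KL in auto)
qed

text \<open>The closed sign conditions at an integer: it lies between \<open>a\<close> and
  \<open>b\<close>, but strictly below neither short side. Where a side of length 1 has no
  condition, no integer lies strictly below it.\<close>

lemma closure_reg_Tri:
  assumes "a < c" "c < b" "of_int x \<in> closure (reg (Tri a c b))"
  shows "x \<in> {a, c, b}"
proof -
  have "Q a b (of_int x) \<le> 0" using assms(3) by (rule closure_Q_nonpos) auto
  moreover have "0 \<le> Q a c (of_int x)" if "c \<noteq> a + 1"
    by (rule closure_Q_nonneg[OF assms(3)]) (use that in auto)
  moreover have "0 \<le> Q c b (of_int x)" if "b \<noteq> c + 1"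
    by (rule closure_Q_nonneg[OF assms(3)]) (use that in auto)
  ultimately show ?thesis using assms(1,2) unfolding Q_of_int
    by (cases "c = a + 1"; cases "b = c + 1") (auto simp: mult_le_0_iff zero_le_mult_iff)
qed

lemma closure_reg_Cen:
  assumes "k < l" "of_int x \<in> closure (reg (Cen k l))"
  shows "x \<in> {k, l}"
proof -
  have "of_int k \<le> Re (of_int x) \<and> Re (of_int x) \<le> of_int l"
    using assms(2) by (rule closure_strip) auto
  moreover have "0 \<le> Q k l (of_int x)" if "l \<noteq> k + 1"
    by (rule closure_Q_nonneg[OF assms(2)]) (use that in auto)
  ultimately show ?thesis using assms(1) unfolding Q_of_int by (cases "l = k + 1") (auto simp: zero_le_mult_iff)
qed

context punctured_triangulation
begin

lemma closure_reg_iff: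
  assumes "t \<in> all_tris"
  shows "of_int x \<in> closure (reg t) \<longleftrightarrow> x \<in> corners t"
proof (cases t)
  case (Tri a c b)
  then have "a < c" "c < b" using assms by (auto simp: Tri_in)
  then show ?thesis unfolding Tri using closure_reg_Tri[of a c b x] corner_closure_Tri[of a c b] by auto
next
  case (Cen k l)
  then have "k < l" using assms by (auto simp: Cen_in consec_def)
  then show ?thesis unfolding Cen using closure_reg_Cen[of k l x] corner_closure_Cen[of k l] by auto
qed

lemma reg_nonempty: assumes "t \<in> all_tris" shows "reg t \<noteq> {}"
proof -
  obtain x where "x \<in> corners t" by (cases t) auto
  then show ?thesis using closure_reg_iff[OF assms, of x] by auto
qed

section \<open>Disjointness and covering of the lifted triangles\<close>

lemma edges_nested:
  assumes "edge a b" "edge c d" "of_int a < x" "x < of_int b" "of_int c < (x :: real)" "x < of_int d"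
  shows "(a \<le> c \<and> d \<le> b) \<or> (c \<le> a \<and> b \<le> d)"
proof -
  have "a < d" "c < b" using assms by linarith+
  show ?thesis
  proof (rule ccontr)
    assume "\<not> ?thesis"
    then have "(a < c \<and> b < d) \<or> (c < a \<and> d < b)" by linarith
    then show False using edge_cross[OF assms(1,2)] edge_cross[OF assms(2,1)] \<open>a < d\<close> \<open>c < b\<close> by blast
  qed
qed

lemma edge_in_sector:
  assumes "edge a b" "consec k l" "of_int a < x" "x < of_int b" "of_int k < (x :: real)" "x < of_int l"
  shows "k \<le> a \<and> b \<le> l"
proof -
  have "a < l" "k < b" using assms by linarith+
  then show ?thesis using edge_spoke[OF assms(1), of k] edge_spoke[OF assms(1), of l] assms(2)
    by (auto simp: consec_def not_le[symmetric])
qed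

text \<open>Otherwise non-crossing puts the edge from \<open>a\<close> to \<open>b\<close> below one
  of the sides \<open>p x\<close> and \<open>x q\<close>. The region has positive \<open>Q\<close>
  for that side, hence by \<open>Q_nested\<close> also positive \<open>Q a b\<close>.\<close>

lemma reg_Tri_edge:
  assumes "Tri p x q \<in> all_tris" "z \<in> reg (Tri p x q)" "edge a b" "a + 2 \<le> b" "Q a b z \<le> 0"
  shows "p \<ge> a \<and> q \<le> b"
proof (rule ccontr)
  assume neg: "\<not> (p \<ge> a \<and> q \<le> b)"
  have h: "p < x" "x < q" "edge p x" "edge x q" "edge p q" using assms(1) by (auto simp: Tri_in)
  have z: "z \<in> upper" "Q p q z < 0" "x = p + 1 \<or> 0 < Q p x z" "q = x + 1 \<or> 0 < Q x q z" using assms(2) by auto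
  have re: "of_int p < Re z" "Re z < of_int q" "of_int a < Re z" "Re z < of_int b"
    using Q_Re_bounds[of p q z] Q_Re_bounds[of a b z] z h assms by auto
  then have n: "p \<le> a" "b \<le> q" using edges_nested[OF h(5) assms(3), of "Re z"] neg by auto
  have "b \<le> x \<or> x \<le> a"
  proof (rule ccontr)
    assume "\<not> ?thesis"
    then have "a < x" "x < b" by auto
    then have "p = a" "b = q" using edge_cross[OF h(3) assms(3)] edge_cross[OF assms(3) h(4)] n by force+
    then show False using neg by simp
  qed
  then show False
  proof
    assume "b \<le> x"
    then show False using Q_nested(1)[of p a b x z] z(3) re n assms by auto
  next
    assume "x \<le> a"
    then show False using Q_nested(1)[of x a b q z] z(4) re n assms by auto
  qed
qed

lemma reg_Cen_edge:
  assumes "consec k l" "z \<in> reg (Cen k l)" "edge a b" "a + 2 \<le> b" "Q a b z \<le> 0"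
  shows False
proof -
  have z: "z \<in> upper" "of_int k < Re z" "Re z < of_int l" "l = k + 1 \<or> 0 < Q k l z" using assms(2) by auto
  have re: "of_int a < Re z" "Re z < of_int b" using Q_Re_bounds[of a b z] z assms by auto
  have "k \<le> a" "b \<le> l" using edge_in_sector[OF assms(3,1) re z(2,3)] by auto
  then show False using Q_nested(1)[of k a b l z] z re assms by auto
qed

lemma reg_disjoint:
  assumes "t \<in> all_tris" "t' \<in> all_tris" "z \<in> reg t" "z \<in> reg t'"
  shows "t = t'"
proof (cases t; cases t')
  fix a c b a' c' b' assume t: "t = Tri a c b" "t' = Tri a' c' b'"
  have h: "a < c" "c < b" "edge a c" "edge c b" "edge a b" "a' < c'" "c' < b'" "edge a' c'" "edge c' b'" "edge a' b'"
    using assms t by (auto simp: Tri_in)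
  have "Q a b z \<le> 0" "Q a' b' z \<le> 0" using assms t by auto
  \<comment> \<open>Each long side lies below the other, so they agree; two different apexes would
    then give crossing sides.\<close>
  then have "a = a'" "b = b'" using reg_Tri_edge[of a c b z a' b'] reg_Tri_edge[of a' c' b' z a b] assms t h by auto
  moreover have "c = c'"
    using edge_cross[of a c c' b] edge_cross[of a c' c b] h calculation by (metis linorder_neqE_linordered_idom)
  ultimately show ?thesis using t by simp
next
  fix a c b k l assume t: "t = Tri a c b" "t' = Cen k l"
  then show ?thesis using reg_Cen_edge[of k l z a b] assms by (auto simp: Tri_in Cen_in)
next
  fix a c b k l assume t: "t = Cen k l" "t' = Tri a c b"
  then show ?thesis using reg_Cen_edge[of k l z a b] assms by (auto simp: Tri_in Cen_in)
next
  fix k l k' l' assume t: "t = Cen k l" "t' = Cen k' l'"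
  then have c: "consec k l" "consec k' l'" "of_int k < Re z" "Re z < of_int l" "of_int k' < Re z" "Re z < of_int l'"
    using assms by (auto simp: Cen_in)
  then have "k < l'" "k' < l" by linarith+
  then have "k = k'" "l = l'" using c(1,2) unfolding consec_def by (force simp: disjoint_iff)+
  then show ?thesis using t by simp
qed

definition on_arcs :: "complex \<Rightarrow> bool" where
  "on_arcs z \<longleftrightarrow> (\<exists>a b. edge a b \<and> a + 2 \<le> b \<and> Q a b z = 0) \<or> (\<exists>k\<in>spoke. Re z = of_int k)"

lemma cover_on_arcs:
  assumes "z \<in> upper"
  shows "cover N z \<in> \<Union>T \<longleftrightarrow> on_arcs z"
proof
  assume "cover N z \<in> \<Union>T"
  then obtain A where A: "A \<in> T" "cover N z \<in> A" by blast
  from A(1) show "on_arcs z"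
  proof (cases rule: T_cases)
    case (peripheral a b)
    then obtain w where w: "w \<in> geodesic a b" "cover N z = cover N w" using A(2) by blast
    then obtain m where m: "z = w + of_int (m * int N)" using cover_eq_iff[OF N_gt, of z w] by blast
    have "Q (a + m * int N) (b + m * int N) z = 0" using w peripheral unfolding m Q_shift by (simp add: geodesic_Q)
    moreover have "edge (a + m * int N) (b + m * int N)" using peripheral by (simp add: edge_mult_shift)
    ultimately show ?thesis unfolding on_arcs_def using peripheral(1)
      by (intro disjI1 exI[of _ "a + m * int N"] exI[of _ "b + m * int N"]) auto
  next
    case (central k)
    then obtain w where w: "w \<in> vline k" "cover N z = cover N w" using A(2) central_arc_cover[OF N_gt] by blast
    then obtain m where m: "z = w + of_int (m * int N)" using cover_eq_iff[OF N_gt, of z w] by blast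
    then have "Re z = of_int (k + m * int N)" using w by (simp add: vline_def)
    moreover have "k + m * int N \<in> spoke" using central by (simp add: spoke_mult_shift)
    ultimately show ?thesis unfolding on_arcs_def by blast
  qed
next
  assume "on_arcs z"
  then show "cover N z \<in> \<Union>T" unfolding on_arcs_def
  proof (elim disjE exE conjE bexE)
    fix a b assume *: "edge a b" "a + 2 \<le> b" "Q a b z = 0"
    then have "cover N ` geodesic a b \<in> T" "z \<in> geodesic a b" using assms by (auto simp: edge_def geodesic_Q)
    then show ?thesis by blast
  next
    fix k assume "k \<in> spoke" "Re z = of_int k"
    then have "central_arc N k \<in> T" "z \<in> vline k" using assms by (auto simp: spoke_def vline_def)
    then show ?thesis using central_arc_cover[OF N_gt, of k] by blast
  qed
qed

lemma reg_not_on_arcs: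
  assumes "t \<in> all_tris" "z \<in> reg t"
  shows "\<not> on_arcs z"
proof
  assume "on_arcs z"
  then show False unfolding on_arcs_def
  proof (elim disjE exE conjE bexE)
    fix a b assume *: "edge a b" "a + 2 \<le> b" "Q a b z = 0"
    show False
    proof (cases t)
      case (Tri p x q)
      have z: "z \<in> upper" "Q p q z < 0" using assms Tri by auto
      have h: "edge p q" "p < q" using assms Tri by (auto simp: Tri_in)
      have "a \<le> p \<and> q \<le> b" using reg_Tri_edge[of p x q z a b] assms Tri * by auto
      then show False using Q_nested(1)[of a p q b z] Q_Re_bounds[of p q z] z h * by auto
    next
      case (Cen k l)
      then show False using reg_Cen_edge[of k l z a b] assms * by (auto simp: Cen_in)
    qed
  next
    fix k assume *: "k \<in> spoke" "Re z = of_int k"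
    show False
    proof (cases t)
      case (Tri p x q)
      have "z \<in> upper" "Q p q z < 0" "edge p q" "p < q" using assms Tri by (auto simp: Tri_in)
      then have "p < k" "k < q" using Q_Re_bounds[of p q z] * by auto
      then show False using edge_spoke \<open>edge p q\<close> * by blast
    next
      case (Cen k' l)
      then show False using assms * by (auto simp: Cen_in consec_def)
    qed
  qed
qed

text \<open>Start in the sector over \<open>Re z\<close> and descend: a point below an edge is in
  the triangle at that edge or below one of its shorter sides, because off the arcs the relevant
  \<open>Q\<close> do not vanish.\<close>

lemma reg_cover:
  assumes "z \<in> upper" "\<not> on_arcs z"
  shows "\<exists>t\<in>all_tris. z \<in> reg t"
proof -
  have nz: "Q a b z \<noteq> 0" if "edge a b" "a + 2 \<le> b" for a b using assms that by (auto simp: on_arcs_def)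
  have nk: "Re z \<noteq> of_int k" if "k \<in> spoke" for k using assms that by (auto simp: on_arcs_def)
  let ?k = "lo \<lfloor>Re z\<rfloor>" and ?l = "hi \<lfloor>Re z\<rfloor>"
  have "?k \<le> \<lfloor>Re z\<rfloor>" "\<lfloor>Re z\<rfloor> + 1 \<le> ?l" using lo_hi[of "\<lfloor>Re z\<rfloor>"] by auto
  then have "of_int ?k \<le> Re z" "Re z < of_int ?l" by linarith+
  then have re: "of_int ?k < Re z" "Re z < of_int ?l" using nk[OF lo_hi(4)[of "\<lfloor>Re z\<rfloor>"]] by linarith+
  have "\<exists>t\<in>under a b. z \<in> reg t" if "edge a b" "a + 2 \<le> b" "Q a b z < 0" for a b
    using that
  proof (induction rule: edge_induct)
    case (apex a c b)
    have h: "a < c" "c < b" "edge a c" "edge c b" using apex by (auto simp: Tri_in)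
    note sp = under_split(1)[OF apex(1)]
    show ?case
    proof (cases "(a + 2 \<le> c \<and> Q a c z < 0) \<or> (c + 2 \<le> b \<and> Q c b z < 0)")
      case True
      then show ?thesis using apex.IH sp by blast
    next
      case False
      then have "c = a + 1 \<or> 0 < Q a c z" "b = c + 1 \<or> 0 < Q c b z" using nz[OF h(3)] nz[OF h(4)] h by force+
      then have "z \<in> reg (Tri a c b)" using assms apex.prems by simp
      then show ?thesis using sp by blast
    qed
  qed simp
  moreover have "?l = ?k + 1 \<or> 0 < Q ?k ?l z \<or> ?k + 2 \<le> ?l \<and> Q ?k ?l z < 0"
    using nz[OF consec_edge[OF lo_hi(1)]] re by (smt (verit) of_int_less_iff)
  moreover have "z \<in> reg (Cen ?k ?l)" if "?l = ?k + 1 \<or> 0 < Q ?k ?l z" using that re assms by simp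
  ultimately show ?thesis using consec_edge[OF lo_hi(1)] lo_hi(1) Cen_in under_subset by blast
qed

definition face :: "tri \<Rightarrow> complex set" where
  "face t = cover N ` reg t"

lemma face_shift: "face (shift (m * int N) t) = face t"
  unfolding face_def by (rule cover_image_shift[OF N_gt reg_shift])

lemma face_meet:
  assumes "t \<in> all_tris" "t' \<in> all_tris" "face t \<inter> face t' \<noteq> {}"
  shows "\<exists>m. t' = shift (m * int N) t"
proof -
  obtain z m where z: "z \<in> reg t" "z + of_int (m * int N) \<in> reg t'"
    using meets_lift[of "reg t" "reg t'"] assms(3) unfolding face_def by blast
  have "z + of_int (m * int N) \<in> reg (shift (m * int N) t)" using z(1) by (simp only: reg_shift)
  then have "shift (m * int N) t = t'"
    using reg_disjoint[of "shift (m * int N) t" t'] z(2) assms by (simp only: all_tris_shift)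
  then show ?thesis by blast
qed

lemma face_props: assumes "t \<in> all_tris" shows "open (face t)" "connected (face t)" "face t \<noteq> {}"
  unfolding face_def using open_cover_image[OF N_gt open_reg] hconvex_connected[OF hconvex_reg[of t]] reg_nonempty[OF assms]
  by (auto intro: connected_continuous_image continuous_on_cover)

text \<open>The faces are open, connected, nonempty and pairwise disjoint, and they fill the
  complement of the arcs; such a family consists of the components.\<close>

lemma triangles_eq: "triangles N T = face ` all_tris"
  unfolding triangles_def
proof (rule components_open_unique)
  show "pairwise disjnt (face ` all_tris)"
  proof (rule pairwiseI)
    fix A B assume "A \<in> face ` all_tris" "B \<in> face ` all_tris" "A \<noteq> B"
    then obtain t t' where t: "t \<in> all_tris" "t' \<in> all_tris" "A = face t" "B = face t'" "face t \<noteq> face t'" by blast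
    then have "face t \<inter> face t' = {}" using face_meet[of t t'] face_shift by metis
    then show "disjnt A B" using t by (simp add: disjnt_def)
  qed
  show "\<Union>(face ` all_tris) = ball 0 1 - {0} - \<Union>T"
  proof (intro equalityI subsetI)
    fix p assume "p \<in> \<Union>(face ` all_tris)"
    then obtain t z where t: "t \<in> all_tris" "z \<in> reg t" "p = cover N z" unfolding face_def by blast
    then have "z \<in> upper" using reg_upper by blast
    then show "p \<in> ball 0 1 - {0} - \<Union>T"
      using cover_on_arcs reg_not_on_arcs[OF t(1,2)] cover_upper[OF N_gt] t by blast
  next
    fix p assume p: "p \<in> ball 0 1 - {0} - \<Union>T"
    then obtain z where z: "z \<in> upper" "p = cover N z" using cover_upper[OF N_gt] by blast
    then have "\<not> on_arcs z" using p cover_on_arcs[OF z(1)] by blast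
    then show "p \<in> \<Union>(face ` all_tris)" using reg_cover[OF z(1)] z unfolding face_def by blast
  qed
  show "open A \<and> connected A \<and> A \<noteq> {}" if "A \<in> face ` all_tris" for A using that face_props by blast
qed

end

section \<open>Matching numbers\<close>

text \<open>Incidence becomes a 0/1 weight. Regions at no vertex of \<open>I\<close> are discarded,
  so finiteness is asked only of regions that can be used.\<close>

lemma card_matchings:
  assumes "finite I" "finite {r \<in> R. \<exists>p\<in>I. inc p r}"
  shows "card (matchings inc I R) = wmatch (\<lambda>p r. of_bool (inc p r)) I {r \<in> R. \<exists>p\<in>I. inc p r}"
proof -
  let ?R = "{r \<in> R. \<exists>p\<in>I. inc p r}" and ?w = "\<lambda>p r. of_bool (inc p r) :: nat"
  let ?S = "{f \<in> I \<rightarrow>\<^sub>E ?R. inj_on f I}"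
  have S: "matchings inc I R = {f \<in> ?S. \<forall>p\<in>I. inc p (f p)}" by (auto simp: matchings_def PiE_def Pi_def)
  have fin: "finite ?S" using assms by (simp add: finite_PiE)
  have "(\<Prod>p\<in>I. ?w p (f p)) = of_bool (\<forall>p\<in>I. inc p (f p))" for f
  proof (cases "\<forall>p\<in>I. inc p (f p)")
    case False
    then obtain p where "p \<in> I" "\<not> inc p (f p)" by blast
    then have "(\<Prod>p\<in>I. ?w p (f p)) = 0" using assms(1) by (intro prod_zero) (auto intro!: bexI[of _ p])
    then show ?thesis using False by simp
  qed simp
  then have "wmatch ?w I ?R = (\<Sum>f\<in>?S. of_bool (\<forall>p\<in>I. inc p (f p)))" by (simp add: wmatch_def)
  also have "\<dots> = card (?S \<inter> {f. \<forall>p\<in>I. inc p (f p)})" using fin by (simp only: sum_of_bool_eq of_nat_id)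
  also have "?S \<inter> {f. \<forall>p\<in>I. inc p (f p)} = matchings inc I R" unfolding S by blast
  finally show ?thesis by (rule sym)
qed

lemma vertex_eq_iff: "N > 0 \<Longrightarrow> vertex N c = vertex N d \<longleftrightarrow> (\<exists>m. c = d + m * int N)"
proof -
  assume "N > 0"
  have "(of_int c :: complex) = of_int d + of_int (m * int N) \<longleftrightarrow> c = d + m * int N" for m
    by (metis of_int_add of_int_eq_iff)
  then show ?thesis unfolding vertex_def cover_eq_iff[OF \<open>N > 0\<close>] by simp
qed

lemma small_multiple: "\<bar>m * int N\<bar> < int N \<Longrightarrow> m = 0"
proof (rule ccontr)
  assume *: "\<bar>m * int N\<bar> < int N" "m \<noteq> 0"
  then have "1 * int N \<le> \<bar>m\<bar> * int N" by (intro mult_right_mono) auto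
  then show False using * by (simp add: abs_mult)
qed

lemma vertex_inj:
  assumes "N > 0" shows "inj_on (vertex N) {A<..A + int N}"
proof (rule inj_onI)
  fix c d assume cd: "c \<in> {A<..A + int N}" "d \<in> {A<..A + int N}" "vertex N c = vertex N d"
  then obtain m where m: "c = d + m * int N" using vertex_eq_iff[OF assms] by blast
  then have "m = 0" using cd by (intro small_multiple[of m N]) auto
  then show "c = d" using m by simp
qed

lemma vertex_range:
  assumes "N > 0" shows "vertex N ` {A<..A + int N} = range (vertex N)"
proof (intro equalityI subsetI)
  fix p assume "p \<in> range (vertex N)"
  then obtain c where c: "p = vertex N c" by blast
  let ?m = "- ((c - A - 1) div int N)"
  have "0 \<le> (c - A - 1) mod int N" "(c - A - 1) mod int N < int N" using assms by auto
  moreover have "c + ?m * int N = A + 1 + (c - A - 1) mod int N"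
    using div_mult_mod_eq[of "c - A - 1" "int N"] by linarith
  ultimately have "c + ?m * int N \<in> {A<..A + int N}" by simp
  moreover have "vertex N (c + ?m * int N) = p" using vertex_eq_iff[OF assms, of "c + ?m * int N" c] c by blast
  ultimately show "p \<in> vertex N ` {A<..A + int N}" by blast
qed auto

lemma vertex_remove:
  assumes "N > 0" "x \<in> {A<..A + int N}" "vertex N x = vertex N i"
  shows "vertex N ` ({A<..A + int N} - {x}) = range (vertex N) - {vertex N i}"
proof -
  have "vertex N ` ({A<..A + int N} - {x}) = vertex N ` {A<..A + int N} - vertex N ` {x}"
    by (rule inj_on_image_set_diff[OF vertex_inj[OF assms(1), of A]]) (use assms(2) in auto)
  then show ?thesis using assms(3) vertex_range[OF assms(1), of A] by simp
qed

text \<open>Openness of the covering map lifts closure points, but only to the full preimage: any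
  translate of \<open>S\<close> may be the one that is approached.\<close>

lemma cover_closure_lift:
  assumes "N > 0" "cover N x \<in> closure (cover N ` S)"
  shows "x \<in> closure (cover N -` (cover N ` S))"
  unfolding closure_iff_nhds_not_empty
proof (intro allI impI)
  fix W V assume "V \<subseteq> W" "open V" "x \<in> V"
  then have "open (cover N ` V)" "cover N x \<in> cover N ` V" using open_cover_image assms by auto
  moreover have "cover N ` S \<inter> W \<noteq> {}" if "open W" "cover N x \<in> W" for W
    using assms(2) that unfolding closure_iff_nhds_not_empty by (meson subset_refl)
  ultimately have "cover N ` S \<inter> cover N ` V \<noteq> {}" by metis
  then obtain p where p: "p \<in> cover N ` S" "p \<in> cover N ` V" by blast
  from p(2) obtain v where "p = cover N v" "v \<in> V" by (rule imageE)
  with p(1) have "v \<in> V" "cover N v \<in> cover N ` S" by simp_all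
  then have "v \<in> cover N -` (cover N ` S) \<inter> W" using \<open>V \<subseteq> W\<close> by auto
  then show "cover N -` (cover N ` S) \<inter> W \<noteq> {}" by blast
qed

lemma cover_closure_image: "x \<in> closure S \<Longrightarrow> cover N x \<in> closure (cover N ` S)"
  by (rule subsetD[OF continuous_image_closure_subset[OF continuous_on_cover[of UNIV] subset_UNIV] imageI])

context punctured_triangulation
begin

lemma lift_unique:
  assumes "cover N z = cover N w" "a < Re z" "Re z < b" "a < Re w" "Re w < b" "b \<le> a + real N"
  shows "z = w"
proof -
  obtain m where m: "z = w + of_int (m * int N)" using assms(1) cover_eq_iff[OF N_gt] by blast
  have "Re z = Re w + of_int (m * int N)" unfolding m by simp
  then have "\<bar>real_of_int (m * int N)\<bar> < real_of_int (int N)" using assms(2-) by simp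
  then have "\<bar>m * int N\<bar> < int N" by linarith
  then show ?thesis using m small_multiple[of m N] by simp
qed

section \<open>Truncation below an arc\<close>

definition piece :: "int \<Rightarrow> int \<Rightarrow> tri \<Rightarrow> complex set" where
  "piece i b t = cover N ` (reg t \<inter> below_geodesic i b)"

lemma below_strip: "i < b \<Longrightarrow> z \<in> below_geodesic i b \<Longrightarrow> z \<in> upper \<and> of_int i < Re z \<and> Re z < of_int b"
  using Q_Re_bounds[of i b z] by (auto simp: below_Q)

lemma below_lift_unique:
  assumes "i < b" "b \<le> i + int N" "z \<in> below_geodesic i b" "w \<in> below_geodesic i b" "cover N z = cover N w"
  shows "z = w"
proof (rule lift_unique[of z w "of_int i" "of_int b"])
  show "real_of_int b \<le> of_int i + real N" using assms(2) by linarith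
qed (use assms(5) below_strip[OF assms(1,3)] below_strip[OF assms(1,4)] in auto)

lemma piece_disjoint:
  assumes "i < b" "b \<le> i + int N" "t \<in> all_tris" "t' \<in> all_tris" "piece i b t \<inter> piece i b t' \<noteq> {}"
  shows "t = t'"
proof -
  obtain z w where zw: "z \<in> reg t" "z \<in> below_geodesic i b" "w \<in> reg t'" "w \<in> below_geodesic i b" "cover N z = cover N w"
    using assms(5) unfolding piece_def by auto
  then have "z = w" using below_lift_unique assms by blast
  then show ?thesis using reg_disjoint assms zw by blast
qed

text \<open>Each translate of the lifted triangle gives at most one piece: its part in the half disc
  is hyperbolically convex, hence connected, and the covering map is injective on the half disc,
  whose width is at most \<open>N\<close>.\<close>

lemma components_piece:
  assumes "i < b" "b \<le> i + int N" "t \<in> all_tris"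
  shows "components (face t \<inter> cover N ` below_geodesic i b)
    = piece i b ` {t'. (\<exists>m. t' = shift (m * int N) t) \<and> reg t' \<inter> below_geodesic i b \<noteq> {}}" (is "_ = piece i b ` ?S")
proof (rule components_open_unique)
  have S: "?S \<subseteq> all_tris" using assms(3) by (auto simp: all_tris_shift)
  show "pairwise disjnt (piece i b ` ?S)"
  proof (rule pairwiseI)
    fix A B assume "A \<in> piece i b ` ?S" "B \<in> piece i b ` ?S" "A \<noteq> B"
    then obtain t1 t2 where t: "t1 \<in> all_tris" "t2 \<in> all_tris" "A = piece i b t1" "B = piece i b t2" using S by blast
    then show "disjnt A B" using piece_disjoint[OF assms(1,2), of t1 t2] \<open>A \<noteq> B\<close> by (auto simp: disjnt_def)
  qed
  show "\<Union>(piece i b ` ?S) = face t \<inter> cover N ` below_geodesic i b"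
  proof (intro equalityI subsetI)
    fix p assume "p \<in> \<Union>(piece i b ` ?S)"
    then obtain m z where "z \<in> reg (shift (m * int N) t)" "z \<in> below_geodesic i b" "p = cover N z"
      unfolding piece_def by blast
    then show "p \<in> face t \<inter> cover N ` below_geodesic i b"
      using face_shift[of m t] unfolding face_def by blast
  next
    fix p assume "p \<in> face t \<inter> cover N ` below_geodesic i b"
    then obtain z w where zw: "z \<in> reg t" "p = cover N z" "w \<in> below_geodesic i b" "p = cover N w"
      unfolding face_def by blast
    then obtain m where m: "w = z + of_int (m * int N)" using cover_eq_iff[OF N_gt, of w z] by metis
    then have "w \<in> reg (shift (m * int N) t)" using zw(1) by (simp only: reg_shift)
    then have "p \<in> piece i b (shift (m * int N) t)" "shift (m * int N) t \<in> ?S" using zw unfolding piece_def by blast+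
    then show "p \<in> \<Union>(piece i b ` ?S)" by blast
  qed
  show "open A \<and> connected A \<and> A \<noteq> {}" if A: "A \<in> piece i b ` ?S" for A
  proof -
    obtain t' where t': "t' \<in> ?S" "A = piece i b t'" using A by blast
    have "hconvex (below_geodesic i b)" using hconvex_Q(1)[of i b] assms(1) by (simp add: below_Q)
    then have "connected (reg t' \<inter> below_geodesic i b)" by (intro hconvex_connected hconvex_Int hconvex_reg)
    moreover have "below_geodesic i b = upper \<inter> {z. Q i b z < 0}" using assms(1) by (auto simp: below_Q)
    then have "open (below_geodesic i b)"
      using open_upper by (auto intro!: open_Int open_Collect_less continuous_intros continuous_on_Q)
    then have "open (reg t' \<inter> below_geodesic i b)" using open_reg by (rule open_Int[rotated])
    ultimately show ?thesis using t' open_cover_image[OF N_gt]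
      unfolding piece_def by (auto intro: connected_continuous_image continuous_on_cover)
  qed
qed

lemma truncation_eq:
  assumes "cw N i j = b"
  shows "truncation N T i j = piece i b ` {t \<in> all_tris. reg t \<inter> below_geodesic i b \<noteq> {}}"
proof -
  have b: "i < b" "b \<le> i + int N" using cw_bounds[OF N_gt, of i j] assms by auto
  have "truncation N T i j = (\<Union>t\<in>all_tris. components (face t \<inter> cover N ` below_geodesic i b))"
    unfolding truncation_def triangles_eq truncated_disc_def assms by blast
  also have "\<dots> = (\<Union>t\<in>all_tris. piece i b ` {t'. (\<exists>m. t' = shift (m * int N) t) \<and> reg t' \<inter> below_geodesic i b \<noteq> {}})"
    using components_piece[OF b] by simp
  also have "\<dots> = piece i b ` {t \<in> all_tris. reg t \<inter> below_geodesic i b \<noteq> {}}"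
  proof -
    have "t \<in> {t'. (\<exists>m. t' = shift (m * int N) t) \<and> reg t' \<inter> below_geodesic i b \<noteq> {}}"
      if "reg t \<inter> below_geodesic i b \<noteq> {}" for t using that shift_shift(2)[of t] by (auto intro!: exI[of _ 0])
    then show ?thesis by (auto simp: all_tris_shift)
  qed
  finally show ?thesis .
qed

lemma piece_incident:
  assumes "t \<in> all_tris" "i < c" "c < b" "b \<le> i + int N"
  shows "incident (vertex N c) (piece i b t) \<longleftrightarrow> c \<in> corners t"
proof -
  \<comment> \<open>The full disc rather than its upper half: an open neighbourhood of the boundary
    point \<open>c\<close>.\<close>
  let ?U = "{z. Q i b z < 0}"
  have ib: "i < b" using assms by simp
  have U: "open ?U" by (intro open_Collect_less continuous_intros continuous_on_Q)
  have cU: "of_int c \<in> ?U" using assms by (auto simp: Q_of_int mult_pos_neg simp del: of_int_mult)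
  have below: "below_geodesic i b = upper \<inter> ?U" using below_Q[OF ib] by auto
  show ?thesis
  proof
    assume "c \<in> corners t"
    then have "of_int c \<in> ?U \<inter> closure (reg t)" using closure_reg_iff[OF assms(1)] cU by blast
    then have "of_int c \<in> closure (?U \<inter> reg t)" using open_Int_closure_subset[OF U] by blast
    moreover have "?U \<inter> reg t = reg t \<inter> below_geodesic i b" using reg_upper below by blast
    ultimately show "incident (vertex N c) (piece i b t)"
      unfolding incident_def piece_def vertex_def using cover_closure_image by simp
  next
    assume "incident (vertex N c) (piece i b t)"
    then have "of_int c \<in> closure (cover N -` piece i b t)"
      unfolding incident_def piece_def vertex_def using cover_closure_lift[OF N_gt] by blast
    then have "of_int c \<in> closure (?U \<inter> cover N -` piece i b t)" using cU open_Int_closure_subset[OF U] by blast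
    \<comment> \<open>Inside this disc only one lift of the piece is visible, since points of the
      upper half with equal images coincide.\<close>
    moreover have "?U \<inter> cover N -` piece i b t \<subseteq> reg t"
    proof
      fix w assume w: "w \<in> ?U \<inter> cover N -` piece i b t"
      then obtain s where s: "s \<in> reg t" "s \<in> below_geodesic i b" "cover N w = cover N s" unfolding piece_def by blast
      then obtain m where "w = s + of_int (m * int N)" using cover_eq_iff[OF N_gt] by blast
      then have "w \<in> upper" using s(2) below by (simp only: upper_shift) blast
      then have "w = s" using below_lift_unique[OF ib assms(4), of w s] s w below by blast
      then show "w \<in> reg t" using s by simp
    qed
    ultimately have "of_int c \<in> closure (reg t)" using closure_mono by blast
    then show "c \<in> corners t" using closure_reg_iff[OF assms(1)] by blast
  qed
qed

text \<open>At the vertices strictly between \<open>i\<close> and \<open>b\<close> a piece has the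
  same corners as its lifted triangle, and different triangles with such corners give different
  pieces.\<close>

lemma truncated_matching_number:
  assumes "cw N i j = b"
  shows "card (matchings incident (vertex N ` {i<..<b}) (truncation N T i j)) = F i b"
proof -
  have b: "i < b" "b \<le> i + int N" using cw_bounds[OF N_gt, of i j] assms by auto
  let ?I = "{i<..<b}" and ?D = "{t \<in> all_tris. corners t \<inter> {i<..<b} \<noteq> {}}"
  let ?w = "\<lambda>p r. of_bool (incident p r) :: nat"
  have inc: "incident (vertex N c) (piece i b t) \<longleftrightarrow> c \<in> corners t" if "t \<in> all_tris" "c \<in> ?I" for c t
    using piece_incident[OF that(1)] that(2) b by auto
  have ne: "reg t \<inter> below_geodesic i b \<noteq> {}" if t: "t \<in> ?D" for t
  proof -
    obtain c where "c \<in> corners t" "c \<in> ?I" using t by blast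
    then have "vertex N c \<in> closure (piece i b t)" using inc[of t c] t by (auto simp: incident_def)
    then show ?thesis unfolding piece_def by auto
  qed
  have R: "{r \<in> truncation N T i j. \<exists>p\<in>vertex N ` ?I. incident p r} = piece i b ` ?D"
  proof (intro equalityI subsetI)
    fix r assume "r \<in> {r \<in> truncation N T i j. \<exists>p\<in>vertex N ` ?I. incident p r}"
    then obtain t c where "t \<in> all_tris" "r = piece i b t" "c \<in> ?I" "incident (vertex N c) r"
      unfolding truncation_eq[OF assms] by blast
    then show "r \<in> piece i b ` ?D" using inc[of t c] by blast
  next
    fix r assume "r \<in> piece i b ` ?D"
    then obtain t c where t: "t \<in> ?D" "r = piece i b t" "c \<in> ?I" "c \<in> corners t" by blast
    then have "r \<in> truncation N T i j" unfolding truncation_eq[OF assms] using ne[OF t(1)] by blast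
    moreover have "incident (vertex N c) r" using inc[of t c] t by blast
    ultimately show "r \<in> {r \<in> truncation N T i j. \<exists>p\<in>vertex N ` ?I. incident p r}" using t(3) by blast
  qed
  have fin: "finite ?D" by (rule finite_incident)
  have "inj_on (piece i b) ?D"
  proof (rule inj_onI)
    fix t t' assume t: "t \<in> ?D" "t' \<in> ?D" "piece i b t = piece i b t'"
    then have "piece i b t \<inter> piece i b t' \<noteq> {}" using ne[OF t(1)] unfolding piece_def by auto
    then show "t = t'" using piece_disjoint[OF b, of t t'] t by blast
  qed
  moreover have "inj_on (vertex N) ?I" using vertex_inj[OF N_gt, of i] b by (auto intro: inj_on_subset)
  moreover have "?w (vertex N c) (piece i b t) = wt c t" if "c \<in> ?I" "t \<in> ?D" for c t
    using inc[of t c] that by (simp add: wt_def)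
  ultimately have "wmatch ?w (vertex N ` ?I) (piece i b ` ?D) = wmatch wt ?I ?D"
    using fin by (intro wmatch_image) auto
  moreover have "card (matchings incident (vertex N ` ?I) (truncation N T i j)) = wmatch ?w (vertex N ` ?I) (piece i b ` ?D)"
    using card_matchings[of "vertex N ` ?I" "truncation N T i j" incident] fin unfolding R by simp
  ultimately show ?thesis using b by (simp add: F_def)
qed

section \<open>The central matching numbers\<close>

lemma spoke_before_eq: "spoke_before N T i = lo i"
proof -
  have "(LEAST d. central_arc N (i - int d) \<in> T) = nat (i - lo i)"
  proof (rule Least_equality)
    show "central_arc N (i - int (nat (i - lo i))) \<in> T" using lo_hi[of i] by (simp add: spoke_def)
    fix d assume "central_arc N (i - int d) \<in> T"
    then have "i - int d \<in> spoke" by (simp add: spoke_def)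
    then have "i - int d \<le> lo i" using lo_hi[of i] unfolding consec_def by force
    then show "nat (i - lo i) \<le> d" by linarith
  qed
  then show ?thesis using lo_hi[of i] by (simp add: spoke_before_def)
qed

lemma spoke_after_eq: "spoke_after N T i = hi i"
proof -
  have "(LEAST d. 0 < d \<and> central_arc N (i + int d) \<in> T) = nat (hi i - i)"
  proof (rule Least_equality)
    show "0 < nat (hi i - i) \<and> central_arc N (i + int (nat (hi i - i))) \<in> T" using lo_hi[of i] by (simp add: spoke_def)
    fix d assume "0 < d \<and> central_arc N (i + int d) \<in> T"
    then have "i + int d \<in> spoke" "d > 0" by (auto simp: spoke_def)
    then have "hi i \<le> i + int d" using lo_hi[of i] unfolding consec_def by force
    then show "nat (hi i - i) \<le> d" by linarith
  qed
  then show ?thesis using lo_hi[of i] by (simp add: spoke_after_def)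
qed

lemma consec_length: "consec k l \<Longrightarrow> l \<le> k + int N"
  by (rule edge_length[OF consec_edge])

lemma reg_sectors: "t \<in> sectors A B \<Longrightarrow> z \<in> reg t \<Longrightarrow> of_int A < Re z \<and> Re z < of_int B"
proof (cases t)
  case (Tri a c b)
  assume "t \<in> sectors A B" "z \<in> reg t"
  then have "A \<le> a" "b \<le> B" "a < b" "z \<in> upper" "Q a b z \<le> 0" using Tri by (auto simp: Tri_sectors Tri_in)
  then show ?thesis using Q_Re_bounds[of a b z] by force
next
  case (Cen k l)
  assume "t \<in> sectors A B" "z \<in> reg t"
  then have "A \<le> k" "l \<le> B" "of_int k < Re z" "Re z < of_int l" using Cen by (auto simp: Cen_sectors)
  then show ?thesis by linarith
qed

lemma face_inj:
  assumes "B \<le> A + int N" shows "inj_on face (sectors A B)"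
proof (rule inj_onI)
  fix t t' assume t: "t \<in> sectors A B" "t' \<in> sectors A B" "face t = face t'"
  have all: "t \<in> all_tris" "t' \<in> all_tris" using t sectors_subset by blast+
  obtain z where z: "z \<in> reg t" using reg_nonempty[OF all(1)] by blast
  then have "cover N z \<in> face t'" unfolding t(3)[symmetric] by (simp add: face_def)
  then obtain w where w: "w \<in> reg t'" "cover N z = cover N w" unfolding face_def by blast
  have "real_of_int B \<le> of_int A + real N" using assms by linarith
  then have "z = w" using lift_unique[OF w(2), of "of_int A" "of_int B"] reg_sectors[OF t(1) z] reg_sectors[OF t(2) w(1)] by auto
  then show "t = t'" using reg_disjoint[OF all] z w by blast
qed

lemma strip_triangles:
  "{s \<in> triangles N T. s \<subseteq> cover N ` strip N T i} = face ` sectors (lo i) (hi i)"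
proof (intro equalityI subsetI)
  let ?k = "lo i" and ?l = "hi i"
  fix s assume "s \<in> {s \<in> triangles N T. s \<subseteq> cover N ` strip N T i}"
  then obtain t where t: "t \<in> all_tris" "s = face t" "face t \<subseteq> cover N ` strip N T i" unfolding triangles_eq by blast
  obtain z where z: "z \<in> reg t" using reg_nonempty[OF t(1)] by blast
  then have "cover N z \<in> cover N ` strip N T i" using t(3) unfolding face_def by blast
  then obtain w where w: "w \<in> strip N T i" "cover N z = cover N w" by blast
  then obtain m where m: "w = z + of_int (m * int N)" using cover_eq_iff[OF N_gt, of w z] by metis
  \<comment> \<open>The translate of the lift that meets the strip; edges do not pass over spokes,
    so it lies between \<open>?k\<close> and \<open>?l\<close>.\<close>
  define t' where "t' = shift (m * int N) t"
  have t': "t' \<in> all_tris" "w \<in> reg t'" using t z m by (auto simp only: t'_def all_tris_shift reg_shift)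
  have re: "of_int ?k < Re w" "Re w < of_int ?l" using w(1) by (auto simp: strip_def spoke_before_eq spoke_after_eq)
  have "t' \<in> sectors ?k ?l"
  proof (cases t')
    case (Tri a c b)
    have h: "edge a b" "a < b" "Q a b w \<le> 0" "w \<in> upper" using t' Tri by (auto simp: Tri_in)
    then show ?thesis using edge_in_sector[OF h(1) lo_hi(1)[of i], of "Re w"] Q_Re_bounds[of a b w] re t' Tri by (auto simp: Tri_sectors)
  next
    case (Cen k l)
    then have c: "consec k l" "of_int k < Re w" "Re w < of_int l" using t' by (auto simp: Cen_in)
    have "k < ?l" "?k < l" using c re by linarith+
    then have "?k \<le> k" "l \<le> ?l" using c(1) lo_hi(1)[of i] unfolding consec_def by force+
    then show ?thesis using c Cen by (simp add: Cen_sectors)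
  qed
  then show "s \<in> face ` sectors ?k ?l" using face_shift[of m t] t(2) unfolding t'_def by blast
next
  fix s assume "s \<in> face ` sectors (lo i) (hi i)"
  then obtain t where t: "t \<in> sectors (lo i) (hi i)" "s = face t" by blast
  have "reg t \<subseteq> strip N T i" using reg_sectors[OF t(1)] reg_upper by (auto simp: strip_def spoke_before_eq spoke_after_eq)
  then show "s \<in> {s \<in> triangles N T. s \<subseteq> cover N ` strip N T i}"
    using t sectors_subset unfolding triangles_eq face_def by blast
qed

lemma strip_incident_face:
  assumes "t \<in> sectors (lo i) (hi i)"
  shows "strip_incident N T i c (face t) \<longleftrightarrow> c \<in> corners t"
proof -
  have "strip N T i \<inter> cover N -` face t = reg t"
  proof (intro equalityI subsetI)
    fix w assume w: "w \<in> strip N T i \<inter> cover N -` face t"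
    then obtain z where z: "z \<in> reg t" "cover N w = cover N z" unfolding face_def by blast
    have "real_of_int (hi i) \<le> of_int (lo i) + real N" using consec_length[OF lo_hi(1), of i] by linarith
    then have "w = z" using lift_unique[OF z(2), of "of_int (lo i)" "of_int (hi i)"] reg_sectors[OF assms z(1)] w
      by (auto simp: strip_def spoke_before_eq spoke_after_eq)
    then show "w \<in> reg t" using z by simp
  next
    fix w assume "w \<in> reg t"
    then show "w \<in> strip N T i \<inter> cover N -` face t"
      using reg_sectors[OF assms] reg_upper by (auto simp: strip_def spoke_before_eq spoke_after_eq face_def)
  qed
  then show ?thesis using closure_reg_iff[OF subsetD[OF sectors_subset assms], of c] unfolding strip_incident_def by simp
qed

lemma central_matching_number_eq: "central_matching_number N T i = X i"
proof -
  let ?k = "lo i" and ?l = "hi i"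
  let ?I = "{?k..?l} - {strip_position N T i}" and ?D = "sectors ?k ?l"
  let ?w = "\<lambda>p r. of_bool (strip_incident N T i p r) :: nat"
  let ?R = "{r \<in> face ` ?D. \<exists>p\<in>?I. strip_incident N T i p r}"
  have inj: "inj_on face ?D" using consec_length[OF lo_hi(1)] by (rule face_inj)
  have "central_matching_number N T i = wmatch ?w ?I ?R"
    unfolding central_matching_number_def strip_triangles spoke_before_eq spoke_after_eq
    by (rule card_matchings) auto
  also have "\<dots> = wmatch ?w ?I (face ` ?D)"
    by (rule wmatch_drop[symmetric]) auto
  also have "\<dots> = wmatch ?w (id ` ?I) (face ` ?D)" by simp
  also have "\<dots> = wmatch wt ?I ?D"
    using inj by (intro wmatch_image) (auto simp: strip_incident_face wt_def)
  also have "\<dots> = X i"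
  proof (cases "hi i = i + int N")
    case True
    \<comment> \<open>The arc at \<open>i\<close> is the only central one: the strip is a whole
      period, the omitted copy of \<open>i\<close> is its last vertex, and the matching is
      forced.\<close>
    then have "i \<in> spoke" using lo_hi(5)[of i] spoke_period by simp
    then have "lo i = i" using lo_hi[of i] unfolding consec_def by force
    have "?I = {?k..<?l}" using True by (auto simp: strip_position_def spoke_after_eq)
    then show ?thesis using wmatch_sectors_ends[of ?k ?l] lo_hi[of i] X_spoke[OF \<open>i \<in> spoke\<close>] by simp
  next
    case False
    then have "?I = {?k..?l} - {i}" by (simp add: strip_position_def spoke_after_eq)
    then show ?thesis using wmatch_sectors_without[of ?k ?l i] lo_hi[of i] by simp
  qed
  finally show ?thesis .
qed

end

lemma shift_inj: "shift m t = shift n t \<Longrightarrow> m = n"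
  by (cases t) auto

lemma corners_shift: "x \<in> corners (shift m t) \<longleftrightarrow> x - m \<in> corners t"
  by (cases t) auto

lemma cw_cong: "[cw N i j = j] (mod int N)"
proof -
  have "j - cw N i j = (j - i - 1) div int N * int N"
    using div_mult_mod_eq[of "j - i - 1" "int N"] unfolding cw_def by linarith
  then have "int N dvd j - cw N i j" by simp
  then show ?thesis by (simp only: cong_iff_dvd_diff dvd_diff_commute)
qed

lemma cw_unique:
  assumes "N > 0" "i < b" "b \<le> i + int N" "[b = j] (mod int N)"
  shows "cw N i j = b"
proof -
  have "[cw N i j = b] (mod int N)" using cw_cong[of N i j] assms(4) by (meson cong_sym cong_trans)
  then obtain m where "cw N i j = b + m * int N" by (metis cong_iff_lin cong_sym mult.commute)
  moreover have "i < cw N i j" "cw N i j \<le> i + int N" using cw_bounds[OF assms(1)] by auto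
  ultimately have "m = 0" using assms by (intro small_multiple[of m N]) auto
  then show ?thesis using \<open>cw N i j = b + m * int N\<close> by simp
qed

context punctured_triangulation
begin

section \<open>The loop numbers\<close>

lemma components_lift:
  assumes "t \<in> all_tris"
  shows "components (upper \<inter> cover N -` face t) = range (\<lambda>m. reg (shift (m * int N) t))"
proof (rule components_open_unique)
  let ?R = "\<lambda>m. reg (shift (m * int N) t)"
  have all: "shift (m * int N) t \<in> all_tris" for m using assms by (simp add: all_tris_shift)
  show "pairwise disjnt (range ?R)"
  proof (rule pairwiseI)
    fix A B assume "A \<in> range ?R" "B \<in> range ?R" "A \<noteq> B"
    then obtain m n where mn: "A = ?R m" "B = ?R n" by blast
    show "disjnt A B"
    proof (rule ccontr)
      assume "\<not> disjnt A B"
      then obtain z where "z \<in> ?R m" "z \<in> ?R n" unfolding mn disjnt_def by blast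
      then have "shift (m * int N) t = shift (n * int N) t" using reg_disjoint[OF all all] by blast
      then show False using \<open>A \<noteq> B\<close> mn by simp
    qed
  qed
  show "\<Union>(range ?R) = upper \<inter> cover N -` face t"
  proof (intro equalityI subsetI)
    fix z assume "z \<in> \<Union>(range ?R)"
    then obtain m where m: "z \<in> ?R m" by blast
    then have "cover N z \<in> face t" using face_shift[of m t] unfolding face_def by blast
    then show "z \<in> upper \<inter> cover N -` face t" using m reg_upper by blast
  next
    fix z assume "z \<in> upper \<inter> cover N -` face t"
    then obtain w where w: "w \<in> reg t" "cover N z = cover N w" unfolding face_def by blast
    then obtain m where "z = w + of_int (m * int N)" using cover_eq_iff[OF N_gt] by blast
    then have "z \<in> ?R m" using w by (simp only: reg_shift)
    then show "z \<in> \<Union>(range ?R)" by blast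
  qed
  show "open A \<and> connected A \<and> A \<noteq> {}" if "A \<in> range ?R" for A
    using that open_reg hconvex_connected[OF hconvex_reg] reg_nonempty[OF all] by blast
qed

text \<open>The components upstairs are the translates of one lift, so moving the corner instead of
  the triangle counts the translates of \<open>c\<close> among the corners of
  \<open>t\<close>.\<close>

lemma corners_at_face:
  assumes "t \<in> all_tris"
  shows "corners_at N (face t) c = card {m. c - m * int N \<in> corners t}"
proof -
  let ?R = "\<lambda>m. reg (shift (m * int N) t)"
  have all: "shift (m * int N) t \<in> all_tris" for m using assms by (simp add: all_tris_shift)
  have "{C \<in> components (upper \<inter> cover N -` face t). of_int c \<in> closure C} = ?R ` {m. c - m * int N \<in> corners t}"
    unfolding components_lift[OF assms] using closure_reg_iff[OF all, of c] corners_shift[of c _ t] by auto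
  moreover have "inj ?R"
  proof (rule injI)
    fix m n assume *: "?R m = ?R n"
    obtain z where "z \<in> ?R m" using reg_nonempty[OF all] by blast
    then have "shift (m * int N) t = shift (n * int N) t" using reg_disjoint[OF all all] * by blast
    then show "m = n" using shift_inj[of "m * int N" t "n * int N"] N_gt by simp
  qed
  ultimately show ?thesis unfolding corners_at_def by (simp add: card_image inj_on_subset)
qed

lemma corners_at_vertex:
  assumes "t \<in> all_tris" "vertex N c = vertex N d"
  shows "corners_at N (face t) c = corners_at N (face t) d"
proof -
  obtain n where n: "c = d + n * int N" using vertex_eq_iff[OF N_gt] assms(2) by blast
  have "bij_betw (\<lambda>m. m - n) {m. c - m * int N \<in> corners t} {m. d - m * int N \<in> corners t}"
    by (rule bij_betwI[where g = "\<lambda>m. m + n"]) (auto simp: n algebra_simps)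
  then show ?thesis unfolding corners_at_face[OF assms(1)] by (rule bij_betw_same_card)
qed

text \<open>Within one period only the ends \<open>A\<close> and \<open>A + int N\<close> lie over
  the same vertex. This is the weight expected by \<open>wmatch_loop\<close>.\<close>

lemma corners_at_window:
  assumes "t \<in> sectors A (A + int N)" "A < c" "c \<le> A + int N"
  shows "corners_at N (face t) c = (if c = A + int N then wt A t + wt c t else wt c t)"
proof -
  have all: "t \<in> all_tris" using assms sectors_subset by blast
  have m: "m = 0 \<or> (m = 1 \<and> c = A + int N)" if "c - m * int N \<in> corners t" for m
  proof (rule ccontr)
    assume neg: "\<not> ?thesis"
    have b: "A \<le> c - m * int N" "c - m * int N \<le> A + int N" using corners_sectors[OF assms(1) that] by auto
    consider "m \<le> - 1" | "m = 1" "c < A + int N" | "m \<ge> 2" using neg assms(3) by force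
    then show False
    proof cases
      case 1
      then have "m * int N \<le> - 1 * int N" by (intro mult_right_mono) auto
      then show False using b assms by linarith
    next
      case 3
      then have "2 * int N \<le> m * int N" by (intro mult_right_mono) auto
      then show False using b assms N_gt by linarith
    qed (use b in auto)
  qed
  have "c - x * int N \<in> corners t \<longleftrightarrow> x = 0 \<and> c \<in> corners t \<or> x = 1 \<and> c = A + int N \<and> A \<in> corners t" for x
    using m[of x] by auto
  then have "{m. c - m * int N \<in> corners t} =
      (if c \<in> corners t then {0} else {}) \<union> (if c = A + int N \<and> A \<in> corners t then {1} else {})"
    by auto
  then show ?thesis unfolding corners_at_face[OF all] by (auto simp: wt_def)
qed

lemma face_sectors: assumes "A \<in> spoke" shows "face ` sectors A (A + int N) = face ` all_tris"
proof (intro equalityI subsetI)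
  fix s assume "s \<in> face ` all_tris"
  then obtain t where t: "t \<in> all_tris" "s = face t" by blast
  \<comment> \<open>The leftmost integer corner, to be translated into the period starting at
    \<open>A\<close>; the spoke at \<open>A + int N\<close> then bounds the triangle on the
    right.\<close>
  define a where "a = (case t of Tri a c b \<Rightarrow> a | Cen k l \<Rightarrow> k)"
  define m where "m = - ((a - A) div int N)"
  have "0 \<le> (a - A) mod int N" "(a - A) mod int N < int N" using N_gt by auto
  moreover have "a + m * int N = A + (a - A) mod int N"
    using div_mult_mod_eq[of "a - A" "int N"] unfolding m_def by linarith
  ultimately have a: "A \<le> a + m * int N" "a + m * int N < A + int N" by linarith+
  have A': "A + int N \<in> spoke" using assms by (simp add: spoke_period)
  have t': "shift (m * int N) t \<in> all_tris" using t by (simp add: all_tris_shift)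
  have "shift (m * int N) t \<in> sectors A (A + int N)"
  proof (cases t)
    case (Tri p x q)
    then have h: "edge (p + m * int N) (q + m * int N)" "a = p" using t' by (auto simp: Tri_in a_def)
    then have "q + m * int N \<le> A + int N" using edge_spoke[OF h(1) A'] a by force
    then show ?thesis using t' Tri a h by (simp add: Tri_sectors)
  next
    case (Cen k l)
    then have h: "consec (k + m * int N) (l + m * int N)" "a = k" using t' by (auto simp: Cen_in a_def)
    then have "l + m * int N \<le> A + int N" using a A' unfolding consec_def by force
    then show ?thesis using Cen a h by (simp add: Cen_sectors)
  qed
  then show "s \<in> face ` sectors A (A + int N)" using face_shift[of m t] t(2) by blast
qed (use sectors_subset[of A "A + int N"] in blast)

lemma puncture_incident:
  assumes "t \<in> all_tris"
  shows "incident 0 (face t) \<longleftrightarrow> (\<exists>k l. t = Cen k l)"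
proof (cases t)
  case (Tri a c b)
  have h: "edge a b" "a < b" using assms Tri by (auto simp: Tri_in)
  \<comment> \<open>An edge has length at most \<open>N\<close>, so the region below it stays below
    height \<open>N\<close>, where the covering map has modulus
    \<open>exp (- 2 * pi)\<close>.\<close>
  have "face t \<subseteq> {p. exp (- 2 * pi) \<le> norm p}"
  proof
    fix p assume "p \<in> face t"
    then obtain z where z: "z \<in> upper" "Q a b z < 0" "p = cover N z" unfolding face_def Tri by auto
    have re: "of_int a < Re z" "Re z < of_int b" using Q_Re_bounds[of a b z] z h by auto
    have "b - a \<le> int N" using edge_length[OF h(1)] by simp
    then have "of_int b - of_int a \<le> real N" by linarith
    then have "Re z - of_int a \<le> real N" "of_int b - Re z \<le> real N" using re by linarith+
    then have "(Re z - of_int a) * (of_int b - Re z) \<le> real N * real N" using re by (intro mult_mono) auto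
    then have "(Im z)\<^sup>2 \<le> (real N)\<^sup>2" using z(2) by (simp add: Q_def power2_eq_square algebra_simps)
    then have "Im z \<le> real N" by (rule power2_le_imp_le) simp
    then have "- 2 * pi \<le> - 2 * pi * Im z / real N" using N_gt by (simp add: field_simps)
    then show "p \<in> {p. exp (- 2 * pi) \<le> norm p}" unfolding z(3) mem_Collect_eq norm_cover by simp
  qed
  then have "closure (face t) \<subseteq> {p. exp (- 2 * pi) \<le> norm p}"
    by (intro closure_minimal closed_Collect_le continuous_intros)
  then have "0 \<notin> closure (face t)" by (auto simp: not_le)
  then show ?thesis using Tri by (simp add: incident_def)
next
  case (Cen k l)
  have kl: "k < l" using assms Cen by (auto simp: Cen_in consec_def)
  define D where "D = real_of_int (l - k)"
  have D: "1 \<le> D" "real_of_int l = of_int k + D" using kl by (auto simp: D_def)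
  \<comment> \<open>A vertical ray over \<open>k + 1/2\<close> that rises to infinity as
    \<open>x\<close> tends to 0. The logarithm makes the modulus of its image a multiple of
    \<open>x\<close>; heights of at least \<open>D \<ge> 1\<close> keep it above the side from
    \<open>k\<close> to \<open>l\<close>.\<close>
  let ?y = "\<lambda>x. D - real N / (2 * pi) * ln x"
  let ?f = "\<lambda>x. Complex (of_int k + 1 / 2) (?y x)"
  have in_reg: "?f x \<in> reg t" if "0 < x" "x < 1" for x :: real
  proof -
    have "real N / (2 * pi) * ln x \<le> 0" using that by (intro mult_nonneg_nonpos) auto
    then have y: "D \<le> ?y x" by simp
    have "D * 1 \<le> D * D" using D by (intro mult_left_mono) auto
    also have "\<dots> \<le> ?y x * ?y x" using y D by (intro mult_mono) auto
    finally have "D \<le> (?y x)\<^sup>2" by (simp add: power2_eq_square)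
    moreover have "Q k l (?f x) = (?y x)\<^sup>2 - D / 2 + 1 / 4" unfolding Q_def D(2) by (simp add: field_simps)
    ultimately have "0 < Q k l (?f x)" using D(1) by linarith
    moreover have "?f x \<in> upper" using y D by (simp add: upper_def)
    moreover have "of_int k < Re (?f x)" "Re (?f x) < of_int l" unfolding D(2) using D(1) by auto
    ultimately show ?thesis unfolding Cen by simp
  qed
  have "0 \<in> closure (face t)"
  proof (rule closure_limit)
    show "cover N (?f x) \<in> face t" if "0 < x" "x < 1" for x using in_reg[OF that] unfolding face_def by blast
    have norm: "norm (cover N (?f x)) = exp (- 2 * pi * D / real N) * x" if "0 < x" for x
    proof -
      have e: "- 2 * pi * ?y x / real N = - 2 * pi * D / real N + ln x" using N_gt by (simp add: field_simps)
      show ?thesis unfolding norm_cover complex.sel e exp_add using that by simp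
    qed
    have "((\<lambda>x. exp (- 2 * pi * D / real N) * x) \<longlongrightarrow> exp (- 2 * pi * D / real N) * 0) (at_right 0)"
      by (intro tendsto_intros)
    then have "((\<lambda>x. norm (cover N (?f x))) \<longlongrightarrow> exp (- 2 * pi * D / real N) * 0) (at_right 0)"
      by (rule Lim_transform_eventually) (rule eventually_mono[OF eventually_at_right_less norm[symmetric]])
    then have "((\<lambda>x. norm (cover N (?f x))) \<longlongrightarrow> 0) (at_right 0)" by simp
    then show "((\<lambda>x. cover N (?f x)) \<longlongrightarrow> 0) (at_right 0)" by (rule tendsto_norm_zero_cancel)
  qed
  then show ?thesis using Cen by (simp add: incident_def)
qed

text \<open>Expansion along the row of the puncture. For each central triangle the disc is cut open
  along the left side of that triangle, and \<open>wmatch_loop\<close> counts the rest; the cut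
  changes with the triangle, the value \<open>X i\<close> does not.\<close>

lemma loop_number:
  "(\<Sum>f\<in>matchings incident (insert 0 (range (vertex N) - {vertex N i})) (triangles N T).
     \<Prod>c\<in>{i<..<i + int N}. corners_at N (f (vertex N c)) c) = spokes * X i"
proof -
  let ?J = "{i<..<i + int N}" and ?R = "face ` all_tris"
  \<comment> \<open>The spokes \<open>A\<close> with \<open>A \<le> i < A + N\<close>, one for each
    central arc, so that \<open>i\<close> lies in the period starting at \<open>A\<close>.\<close>
  let ?K = "spoke \<inter> {i - int N<..i}" and ?c = "\<lambda>A. face (Cen A (hi A))"
  \<comment> \<open>The weight of a boundary point needs a lift of it; for faces the choice is
    immaterial by \<open>corners_at_vertex\<close>. As weights vanish where there is no incidence,
    the sum over matchings becomes a sum over all injections.\<close>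
  define w :: "complex \<Rightarrow> complex set \<Rightarrow> nat"
    where "w p r = (if p = 0 then of_bool (incident 0 r) else corners_at N r (SOME c. vertex N c = p))" for p r
  have v0: "vertex N c \<noteq> 0" for c by (simp add: vertex_def cover_exp)
  have wv: "w (vertex N c) (face t) = corners_at N (face t) c" if "t \<in> all_tris" for c t
  proof -
    have "vertex N (SOME d. vertex N d = vertex N c) = vertex N c"
      by (rule someI[of "\<lambda>d. vertex N d = vertex N c" c]) (rule refl)
    from corners_at_vertex[OF that this] show ?thesis by (simp add: w_def v0)
  qed
  have J: "vertex N ` ?J = range (vertex N) - {vertex N i}"
  proof -
    have "?J = {i<..i + int N} - {i + int N}" by auto
    moreover have "vertex N (i + int N) = vertex N i" using vertex_eq_iff[OF N_gt, of "i + int N" i] by (metis mult_1)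
    ultimately show ?thesis using vertex_remove[OF N_gt, of "i + int N" i i] N_gt by simp
  qed
  have injJ: "inj_on (vertex N) ?J" using vertex_inj[OF N_gt, of i] by (rule inj_on_subset) auto
  obtain A0 where "A0 \<in> spoke" using spoke_exists by blast
  then have finR: "finite ?R" using face_sectors[of A0] by (metis finite_imageI finite_sectors)
  let ?I = "insert 0 (vertex N ` ?J)"
  have prod: "(\<Prod>p\<in>?I. w p (f p)) = of_bool (incident 0 (f 0)) * (\<Prod>c\<in>?J. corners_at N (f (vertex N c)) c)"
    if "f \<in> ?I \<rightarrow>\<^sub>E ?R" for f
  proof -
    have "(\<Prod>p\<in>?I. w p (f p)) = w 0 (f 0) * (\<Prod>p\<in>vertex N ` ?J. w p (f p))" using v0 by (subst prod.insert) auto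
    also have "(\<Prod>p\<in>vertex N ` ?J. w p (f p)) = (\<Prod>c\<in>?J. w (vertex N c) (f (vertex N c)))"
      using injJ by (simp add: prod.reindex)
    also have "\<dots> = (\<Prod>c\<in>?J. corners_at N (f (vertex N c)) c)"
    proof (rule prod.cong[OF refl])
      fix c assume "c \<in> ?J"
      then have "f (vertex N c) \<in> ?R" using that by (auto simp: PiE_def Pi_def)
      then obtain t where "t \<in> all_tris" "f (vertex N c) = face t" by blast
      then show "w (vertex N c) (f (vertex N c)) = corners_at N (f (vertex N c)) c" using wv by simp
    qed
    finally show ?thesis by (simp add: w_def)
  qed
  have zero: "corners_at N (face t) c = 0" if "t \<in> all_tris" "\<not> incident (vertex N c) (face t)" for t c
  proof -
    have "c - m * int N \<notin> corners t" for m
    proof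
      assume "c - m * int N \<in> corners t"
      then have "cover N (of_int (c - m * int N)) \<in> closure (face t)"
        unfolding face_def using closure_reg_iff[OF that(1)] cover_closure_image by blast
      moreover have "vertex N (c - m * int N) = vertex N c"
        using vertex_eq_iff[OF N_gt, of "c" "c - m * int N"] by (metis diff_add_cancel)
      ultimately show False using that(2) by (simp add: incident_def vertex_def)
    qed
    then show ?thesis unfolding corners_at_face[OF that(1)] by simp
  qed
  have "(\<Sum>f\<in>matchings incident ?I ?R. \<Prod>c\<in>?J. corners_at N (f (vertex N c)) c) = wmatch w ?I ?R"
    unfolding wmatch_def
  proof (rule sum.mono_neutral_cong_left)
    show "finite {f \<in> ?I \<rightarrow>\<^sub>E ?R. inj_on f ?I}" using finR by (simp add: finite_PiE)
    show "matchings incident ?I ?R \<subseteq> {f \<in> ?I \<rightarrow>\<^sub>E ?R. inj_on f ?I}" by (auto simp: matchings_def)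
    show "\<forall>f\<in>{f \<in> ?I \<rightarrow>\<^sub>E ?R. inj_on f ?I} - matchings incident ?I ?R. (\<Prod>p\<in>?I. w p (f p)) = 0"
    proof
      fix f assume f: "f \<in> {f \<in> ?I \<rightarrow>\<^sub>E ?R. inj_on f ?I} - matchings incident ?I ?R"
      then obtain p where p: "p \<in> ?I" "\<not> incident p (f p)" unfolding matchings_def by blast
      have "f p \<in> ?R" using f p(1) by (auto simp: PiE_def Pi_def)
      then obtain t where t: "t \<in> all_tris" "f p = face t" by blast
      have "w p (f p) = 0"
      proof (cases "p = 0")
        case True
        then show ?thesis using p(2) by (simp add: w_def)
      next
        case False
        then obtain c where "p = vertex N c" using p(1) by blast
        then show ?thesis using wv[OF t(1), of c] zero[OF t(1), of c] p(2) t(2) by simp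
      qed
      then show "(\<Prod>p\<in>?I. w p (f p)) = 0" using p(1) by (intro prod_zero) auto
    qed
    fix f assume f: "f \<in> matchings incident ?I ?R"
    then have "incident 0 (f 0)" "f \<in> ?I \<rightarrow>\<^sub>E ?R" by (auto simp: matchings_def)
    then show "(\<Prod>c\<in>?J. corners_at N (f (vertex N c)) c) = (\<Prod>p\<in>?I. w p (f p))" using prod by simp
  qed
  also have "\<dots> = (\<Sum>r\<in>?R. w 0 r * wmatch w (vertex N ` ?J) (?R - {r}))"
    using finR v0 by (intro wmatch_insert) auto
  also have "\<dots> = (\<Sum>r\<in>?c ` ?K. wmatch w (vertex N ` ?J) (?R - {r}))"
  proof (rule sum.mono_neutral_cong_right)
    have Cen: "Cen A (hi A) \<in> all_tris" if "A \<in> spoke" for A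
    proof -
      have "lo A = A" using lo_hi[of A] that unfolding consec_def by force
      then show ?thesis using lo_hi(1)[of A] by (simp add: Cen_in)
    qed
    then show "?c ` ?K \<subseteq> ?R" by blast
    show "w 0 r * wmatch w (vertex N ` ?J) (?R - {r}) = wmatch w (vertex N ` ?J) (?R - {r})" if "r \<in> ?c ` ?K" for r
    proof -
      have "incident 0 r" using that puncture_incident[OF Cen] by blast
      then show ?thesis by (simp add: w_def)
    qed
    show "\<forall>r\<in>?R - ?c ` ?K. w 0 r * wmatch w (vertex N ` ?J) (?R - {r}) = 0"
    proof
      fix r assume r: "r \<in> ?R - ?c ` ?K"
      then obtain t where t: "t \<in> all_tris" "r = face t" by blast
      have "\<not> incident 0 r"
      proof
        assume "incident 0 r"
        then obtain k l where kl: "t = Cen k l" using puncture_incident[OF t(1)] t(2) by blast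
        then have c: "consec k l" using t(1) by (simp add: Cen_in)
        obtain m where m: "k + m * int N \<in> {i - int N<..i}"
        proof
          have "0 \<le> (i - k) mod int N" "(i - k) mod int N < int N" using N_gt by auto
          then show "k + ((i - k) div int N) * int N \<in> {i - int N<..i}"
            using div_mult_mod_eq[of "i - k" "int N"] by (simp only: greaterThanAtMost_iff) linarith
        qed
        have c': "consec (k + m * int N) (l + m * int N)" using c by (simp add: consec_shift)
        then have "hi (k + m * int N) = l + m * int N" "k + m * int N \<in> ?K"
          using consec_unique[OF c', of "k + m * int N"] m by (auto simp: consec_def)
        then have "r = ?c (k + m * int N)" "k + m * int N \<in> ?K" using face_shift[of m t] kl t(2) by auto
        then show False using r by blast
      qed
      then show "w 0 r * wmatch w (vertex N ` ?J) (?R - {r}) = 0" by (simp add: w_def)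
    qed
  qed (rule finR)
  also have "\<dots> = (\<Sum>A\<in>?K. wmatch w (vertex N ` ?J) (?R - {?c A}))"
  proof (rule sum.reindex_cong[OF _ refl refl])
    show "inj_on ?c ?K"
    proof (rule inj_onI)
      fix A B assume AB: "A \<in> ?K" "B \<in> ?K" "?c A = ?c B"
      have "lo A = A" "lo B = B" using lo_hi[of A] lo_hi[of B] AB unfolding consec_def by force+
      then have all: "Cen A (hi A) \<in> all_tris" "Cen B (hi B) \<in> all_tris"
        using lo_hi(1)[of A] lo_hi(1)[of B] by (auto simp: Cen_in)
      then obtain m where "B = A + m * int N" using face_meet[OF all] AB(3) face_props(3)[OF all(2)] by auto
      moreover from this have "m = 0" using AB by (intro small_multiple[of m N]) auto
      ultimately show "A = B" by simp
    qed
  qed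
  also have "\<dots> = (\<Sum>A\<in>?K. X i)"
  proof (rule sum.cong[OF refl])
    fix A assume A: "A \<in> ?K"
    \<comment> \<open>The vertex over \<open>i\<close> in the period after \<open>A\<close>, which
      excludes \<open>A\<close>; so \<open>i = A\<close> is represented by
      \<open>A + int N\<close>.\<close>
    let ?x = "if i = A then A + int N else i"
    let ?L = "{A<..A + int N} - {?x}" and ?D = "sectors A (A + int N) - {Cen A (hi A)}"
    let ?w = "\<lambda>p t. if p = A + int N then wt A t + wt p t else wt p t"
    have x: "?x \<in> {A<..A + int N}" using A N_gt by auto
    have "vertex N ?x = vertex N i" using vertex_eq_iff[OF N_gt, of "A + int N" A] by (metis mult_1)
    then have L: "vertex N ` ?L = vertex N ` ?J" using vertex_remove[OF N_gt x] J by simp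
    have inj: "inj_on face (sectors A (A + int N))" by (rule face_inj) simp
    have "lo A = A" using lo_hi[of A] A unfolding consec_def by force
    then have "Cen A (hi A) \<in> sectors A (A + int N)"
      using lo_hi(1)[of A] consec_length[OF lo_hi(1), of A] by (simp add: Cen_sectors)
    then have D: "face ` ?D = ?R - {?c A}"
      using inj_on_image_set_diff[OF inj, of "sectors A (A + int N)" "{Cen A (hi A)}"] face_sectors[of A] A by auto
    have "wmatch w (vertex N ` ?L) (face ` ?D) = wmatch ?w ?L ?D"
    proof (rule wmatch_image)
      show "inj_on (vertex N) ?L" using vertex_inj[OF N_gt, of A] by (rule inj_on_subset) auto
      show "inj_on face ?D" using inj by (rule inj_on_subset) auto
      show "w (vertex N p) (face t) = ?w p t" if "p \<in> ?L" "t \<in> ?D" for p t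
      proof -
        have "t \<in> sectors A (A + int N)" "A < p" "p \<le> A + int N" using that by auto
        then show ?thesis using wv[of t p] corners_at_window[of t A p] sectors_subset[of A "A + int N"] by auto
      qed
    qed auto
    then show "wmatch w (vertex N ` ?J) (?R - {?c A}) = X i"
      unfolding L D using wmatch_loop[of A i ?w] A by simp
  qed
  also have "\<dots> = spokes * X i" using card_window[of "i - int N"] by simp
  finally show ?thesis unfolding J triangles_eq .
qed

lemma matching_number_eq:
  "matching_number N T i j = (if [j = i] (mod int N) then spokes * X i else F i (cw N i j))"
proof -
  have "\<not> [i = i + 1] (mod int N)" using N_ge by (simp add: cong_iff_dvd_diff)
  then have "\<not> [j = i] (mod int N)" if "[j = i + 1] (mod int N)" using that by (meson cong_sym cong_trans)
  moreover have "F i (cw N i j) = 1" if "[j = i + 1] (mod int N)" using that cw_succ_iff[of N i j] F_succ[of i] by simp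
  ultimately show ?thesis
    unfolding matching_number_def using loop_number[of i] truncated_matching_number[of i j "cw N i j"] by auto
qed

section \<open>The frieze relations for the matching numbers\<close>

lemma not_cong: "0 < \<bar>a - b\<bar> \<Longrightarrow> \<bar>a - b\<bar> < int N \<Longrightarrow> \<not> [a = b] (mod int N)"
proof
  assume *: "0 < \<bar>a - b\<bar>" "\<bar>a - b\<bar> < int N" "[a = b] (mod int N)"
  then obtain k where k: "a - b = k * int N" by (metis cong_iff_dvd_diff dvd_def mult.commute)
  then have "k = 0" using *(2) small_multiple[of k N] by simp
  then show False using k *(1) by simp
qed

lemma frieze: "frieze_pattern_D N (matching_number N T) (central_matching_number N T)"
proof -
  let ?m = "matching_number N T" and ?q = "central_matching_number N T"
  note m0 = central_matching_number_eq
  have diag: "?m i i = spokes * X i" for i by (simp add: matching_number_eq)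
  have off: "?m i j = F i b" if "i < b" "b < i + int N" "[b = j] (mod int N)" for i j b
  proof -
    have "\<not> [b = i] (mod int N)" using that by (intro not_cong) auto
    then have "\<not> [j = i] (mod int N)" using that(3) by (meson cong_trans)
    then show ?thesis using cw_unique[OF N_gt, of i b j] that by (simp add: matching_number_eq)
  qed
  have prev: "?m (i + 1) i = F (i + 1) (i + int N)" for i
    using off[of "i + 1" "i + int N" i] N_ge by (simp add: cong_def)
  have prev': "?m i (i - 1) = F i (i + int N - 1)" for i
    using prev[of "i - 1"] by (simp add: algebra_simps)
  have prev2: "?m (i + 1) (i - 1) = F (i + 1) (i + int N - 1)" for i
  proof (rule off)
    show "[i + int N - 1 = i - 1] (mod int N)" by (simp add: cong_iff_dvd_diff)
  qed (use N_ge in auto)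
  \<comment> \<open>This is \<open>F_frieze\<close> for \<open>i\<close> and
    \<open>i + N - 1\<close>, whose outer entry \<open>F i (i + N)\<close> factors as
    \<open>m_ii * m_i0\<close> by \<open>F_loop\<close>.\<close>
  have R2: "?m i (i - 1) * ?m (i + 1) i = ?m (i + 1) (i - 1) * ?m i i * ?q i + 1" for i
    unfolding prev prev' prev2 diag m0
    using F_frieze[of i "i + int N - 1"] F_loop[of i] N_ge by (simp add: algebra_simps)
  have R3: "?m i i * ?q (i + 1) = ?m (i + 1) i + 1" for i
    using F_almost_loop[of i] by (simp add: diag prev m0)
  have R4: "?q i * ?m (i + 1) (i + 1) = ?m (i + 1) i + 1" for i
    unfolding diag prev m0 using F_almost_loop[of i] by (simp add: algebra_simps)
  have R1: "?m i j * ?m (i + 1) (j + 1) = ?m (i + 1) j * ?m i (j + 1) + 1"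
    if "\<not> [j = i - 1] (mod int N)" "\<not> [j = i] (mod int N)" "\<not> [j = i + 1] (mod int N)" for i j
  proof -
    define b where "b = cw N i j"
    have b: "i < b" "b \<le> i + int N" "[b = j] (mod int N)" using cw_bounds[OF N_gt, of i j] cw_cong[of N i j] by (auto simp: b_def)
    have "[i + int N = i] (mod int N)" "[i + int N - 1 = i - 1] (mod int N)" by (simp_all add: cong_iff_dvd_diff)
    then have "b \<noteq> i + int N" "b \<noteq> i + int N - 1" "b \<noteq> i + 1"
      using that b(3) by (metis cong_sym cong_trans)+
    \<comment> \<open>The excluded residues keep all four index pairs away from the loops, so the
      lifts \<open>b\<close> and \<open>b + 1\<close> serve for \<open>i\<close> and
      \<open>i + 1\<close> alike.\<close>
    then have b': "i + 1 < b" "b + 1 < i + int N" using b by auto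
    have "[b + 1 = j + 1] (mod int N)" using b(3) by (simp add: cong_iff_dvd_diff)
    then show ?thesis
      using F_frieze[of i b] off[of i b j] off[of "i + 1" "b + 1" "j + 1"] off[of "i + 1" b j] off[of i "b + 1" "j + 1"] b b' by simp
  qed
  have succ: "?m i (i + 1) = 1" for i by (simp add: matching_number_def)
  have per: "?m i j = ?m i' j'" if c: "[i = i'] (mod int N)" "[j = j'] (mod int N)" for i i' j j'
  proof -
    obtain n where n: "i' = i + n * int N" using c(1) by (metis cong_iff_lin mult.commute)
    have "[j = i] (mod int N) \<longleftrightarrow> [j' = i'] (mod int N)" using c by (meson cong_sym cong_trans)
    moreover have "cw N i' j' = cw N i j + n * int N"
    proof (rule cw_unique[OF N_gt])
      have "[cw N i j + n * int N = cw N i j] (mod int N)" by (simp add: cong_iff_dvd_diff)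
      then show "[cw N i j + n * int N = j'] (mod int N)" using cw_cong[of N i j] c(2) by (meson cong_trans)
    qed (use cw_bounds[OF N_gt, of i j] n in auto)
    ultimately show ?thesis by (simp add: matching_number_eq n X_shift F_shift)
  qed
  have pos: "?m i j > 0" for i j
  proof -
    consider "[j = i - 1] (mod int N)" | "[j = i] (mod int N)" | "[j = i + 1] (mod int N)"
      | "\<not> [j = i - 1] (mod int N)" "\<not> [j = i] (mod int N)" "\<not> [j = i + 1] (mod int N)" by blast
    then show ?thesis
    proof cases
      case 1
      then have "?m i j = ?m i (i - 1)" by (rule per[OF cong_refl])
      then show ?thesis using R2[of i] by (cases "?m i (i - 1) = 0") auto
    next
      case 2
      then have "?m i j = ?m i i" by (rule per[OF cong_refl])
      then show ?thesis using R3[of i] by (cases "?m i i = 0") auto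
    next
      case 3
      then have "?m i j = ?m i (i + 1)" by (rule per[OF cong_refl])
      then show ?thesis using succ[of i] by simp
    next
      case 4
      then show ?thesis using R1[OF 4] by (cases "?m i j = 0") auto
    qed
  qed
  have pos0: "?q i > 0" for i using R4[of i] by (cases "?q i = 0") auto
  have per0: "?q i = ?q i'" if c: "[i = i'] (mod int N)" for i i'
  proof -
    obtain n where n: "i' = i + n * int N" using c by (metis cong_iff_lin mult.commute)
    show ?thesis unfolding n m0 by (rule X_shift[symmetric])
  qed
  show ?thesis unfolding frieze_pattern_D_def
  proof (intro conjI allI impI)
    show "?m i j = ?m i' j'" if "[i = i'] (mod int N)" "[j = j'] (mod int N)" for i i' j j' using that by (rule per)
    show "?q i = ?q i'" if "[i = i'] (mod int N)" for i i' using that by (rule per0)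
    show "?m i j * ?m (i + 1) (j + 1) = ?m (i + 1) j * ?m i (j + 1) + 1"
      if "\<not> [j = i - 1] (mod int N) \<and> \<not> [j = i] (mod int N) \<and> \<not> [j = i + 1] (mod int N)" for i j
      by (rule R1) (use that in blast)+
  qed (rule pos pos0 succ R2 R3 R4)+
qed

end

theorem theorem4p9:
  fixes N :: nat and T :: "complex set set"
  assumes "N \<ge> 3" and "disc_triangulation N T"
  shows "frieze_pattern_D N (matching_number N T) (central_matching_number N T)"
proof -
  interpret punctured_triangulation N T using assms by (rule punctured_triangulation.intro)
  show ?thesis by (rule frieze)
qed

end
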